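(* Let $h\ge1$ be an integer. Then, as $n\to\infty$, $$\mathrm{prob}_{\mathcal O}(h;n)\sim\frac{4\alpha_h}{\log n},\qquad \mathrm{prob}_{\mathcal D}(h;n)\sim\frac{\beta_h}{\log 2}.$$
   Context: A partition $\lambda=(\lambda_1\ge\lambda_2\ge\dots\ge\lambda_\ell>0)$ of $n$ is drawn as its Ferrers diagram: left-adjusted rows of boxes, with $\lambda_i$ boxes in row $i$. The hook number (hook length) of a box is the number of boxes in the L-shape consisting of that box, all boxes to its right in the same row, and all boxes below it in the same column. Let $\mathcal O$ be the class of partitions all of whose parts are odd and $\mathcal D$ the class of partitions whose parts are pairwise distinct. For $\mathcal L\in\{\mathcal O,\mathcal D\}$, $\mathrm{prob}_{\mathcal L}(h;n)$ is the probability that a row, selected uniformly at random from among all rows of the Ferrers diagrams of all partitions of $n$ in $\mathcal L$, contains a box with hook number $h$. The constants are $$\alpha_h=\sum_{j=0}^{\lceil h/2\rceil-1}\binom{h-j-1}{j}I_A(j,2h-4j)+\sum_{j=0}^{\lfloor h/2\rfloor-1}\binom{h-j-2}{j}I_A(j,2h-4j-2),$$ $$\beta_h=\sum_{j=0}^{\lceil h/2\rceil-1}\binom{h-j-1}{j}I_B(j+1,h-j),$$ where $$I_A(j,l)=\int_0^\infty(1-e^{-2x})^je^{-lx}\,dx,\qquad I_B(j,k)=\int_0^\infty\frac{e^{-jx}}{(1+e^{-x})^k}\,dx.$$ Empty sums are $0$, and $f(n)\sim g(n)$ means $f(n)/g(n)\to1$. *)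

theory Defs
  imports "HOL-Probability.Probability" "HOL-Library.Landau_Symbols"
begin

definition partitions :: "nat \<Rightarrow> nat list set" where
  "partitions n = {p. sorted_wrt (\<ge>) p \<and> (\<forall>k\<in>set p. k > 0) \<and> sum_list p = n}"

definition odd_partitions :: "nat \<Rightarrow> nat list set" where
  "odd_partitions n = {p \<in> partitions n. \<forall>k\<in>set p. odd k}"

definition distinct_partitions :: "nat \<Rightarrow> nat list set" where
  "distinct_partitions n = {p \<in> partitions n. distinct p}"

text \<open>Boxes are pairs (row, column), both counted from 0, with rows numbered downwards.\<close>

definition ferrers :: "nat list \<Rightarrow> (nat \<times> nat) set" where
  "ferrers p = {(i, j). i < length p \<and> j < p ! i}"

definition hook :: "nat list \<Rightarrow> nat \<times> nat \<Rightarrow> (nat \<times> nat) set" where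
  "hook p b = {(i, j) \<in> ferrers p.
     (i = fst b \<and> snd b \<le> j) \<or> (j = snd b \<and> fst b \<le> i)}"

definition hook_number :: "nat list \<Rightarrow> nat \<times> nat \<Rightarrow> nat" where
  "hook_number p b = card (hook p b)"

definition row_has_hook :: "nat \<Rightarrow> nat list \<Rightarrow> nat \<Rightarrow> bool" where
  "row_has_hook h p i \<longleftrightarrow> (\<exists>j. (i, j) \<in> ferrers p \<and> hook_number p (i, j) = h)"

text \<open>A row is recorded together with the partition it belongs to, so that equally long rows
  of different (or of the same) diagrams count separately.\<close>

definition diagram_rows :: "nat list set \<Rightarrow> (nat list \<times> nat) set" where
  "diagram_rows L = {(p, i). p \<in> L \<and> i < length p}"

text \<open>The class \<open>L\<close> is given as the function sending \<open>n\<close> to its set of partitions of \<open>n\<close>.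
  For both classes considered here, the set of rows is finite, and it is nonempty for \<open>n > 0\<close>;
  the value at \<open>n = 0\<close> carries no meaning.\<close>

definition hook_prob :: "(nat \<Rightarrow> nat list set) \<Rightarrow> nat \<Rightarrow> nat \<Rightarrow> real" where
  "hook_prob L h n =
     measure_pmf.prob (pmf_of_set (diagram_rows (L n))) {(p, i). row_has_hook h p i}"

definition I_A :: "nat \<Rightarrow> nat \<Rightarrow> real" where
  "I_A j l = integral {0..} (\<lambda>x::real. (1 - exp (-2 * x)) ^ j * exp (- real l * x))"

definition I_B :: "nat \<Rightarrow> nat \<Rightarrow> real" where
  "I_B j k = integral {0..} (\<lambda>x::real. exp (- real j * x) / (1 + exp (- x)) ^ k)"

text \<open>A sum up to \<open>m - 1\<close> is written over \<open>j < m\<close>, which is empty for \<open>m = 0\<close>. For \<open>h \<ge> 1\<close>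
  no subtraction of natural numbers below is truncated within the range of summation.\<close>

definition alpha :: "nat \<Rightarrow> real" where
  "alpha h =
     (\<Sum>j<nat \<lceil>real h / 2\<rceil>. real ((h - j - 1) choose j) * I_A j (2 * h - 4 * j)) +
     (\<Sum>j<nat \<lfloor>real h / 2\<rfloor>. real ((h - j - 2) choose j) * I_A j (2 * h - 4 * j - 2))"

definition beta :: "nat \<Rightarrow> real" where
  "beta h =
     (\<Sum>j<nat \<lceil>real h / 2\<rceil>. real ((h - j - 1) choose j) * I_B (j + 1) (h - j))"

end

theory Submission
  imports Defs "HOL-Real_Asymp.Real_Asymp"
begin

text \<open>
  A row contains a box with hook number \<open>h\<close> iff, for some leg length \<open>j < h\<close>, exactly \<open>j\<close> of
  the rows below it are longer than \<open>a - (h - j)\<close>, where \<open>a\<close> is the length of the row. So the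
  rows to be counted are given by prescribing the multiplicities of the parts in a window of
  bounded width below \<open>a\<close>. Let \<open>q(n)\<close> be the number of partitions of \<open>n\<close> into distinct parts,
  which by Euler is also the number of those into odd parts. Inclusion-exclusion over the window
  reduces all counts to ratios \<open>q(n - m) / q(n)\<close>, and everything follows from the uniform
  estimate \<open>q(n - m) / q(n) = exp (- t m) + O (sqrt t * exp (- t m / 2))\<close>: the sums over \<open>a\<close>
  become Riemann sums with mesh \<open>t\<close> for the integrals \<open>I_A\<close> and \<open>I_B\<close>.

  For the estimate let each \<open>k \<le> n\<close> be a part with probability \<open>exp (- t k) / (1 + exp (- t k))\<close>,
  independently, where \<open>t\<close> (of order \<open>1 / sqrt n\<close>) is chosen such that the sum of the parts has
  mean \<open>n\<close>. Bounds on its characteristic function show that the distribution of the sum is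
  Lipschitz with constant \<open>O (t ^ 3)\<close> and is at least of order \<open>t powr (3/2)\<close> at \<open>n\<close>; the
  estimate needs no more than that, in particular no asymptotic formula for \<open>q\<close>.
\<close>

section \<open>The sum of a random set of parts\<close>

text \<open>Why the two bounds suffice: the sum of the random parts has variance of order
  \<open>t\<close> to the power -3, so point probabilities are of order \<open>t powr (3/2)\<close>
  and neighbouring ones differ by \<open>O (t ^ 3)\<close>. Shifting the argument by
  \<open>m\<close> thus costs the relative error
  \<open>m * t ^ 3 / t powr (3/2) = (t * m) * sqrt t\<close>; half of the factor
  \<open>exp (- t m)\<close> is given up to absorb \<open>t * m\<close>. Both classes are normalised
  by the same \<open>q(n)\<close>, which cancels in the probabilities together with one factor
  \<open>1 / t\<close>. Rows with hook number \<open>h\<close> number about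
  \<open>alpha h / t\<close> and \<open>beta h / t\<close> per partition. So do all rows of distinct
  partitions, about \<open>ln 2 / t\<close>. The rows of odd partitions do not give a convergent
  Riemann sum: a part \<open>a\<close> occurs about \<open>1 / (t a)\<close> times for
  \<open>a\<close> up to \<open>1 / t\<close>, and this harmonic sum over odd \<open>a\<close> is
  \<open>ln (1 / t) / (2 t)\<close>, that is \<open>ln n / (4 t)\<close>. This is the origin of the
  logarithm and of the factor 4, and the reason for a separate treatment of that count.\<close>

abbreviation avoiding_sets :: "nat set \<Rightarrow> nat \<Rightarrow> nat set set" where
  "avoiding_sets R N \<equiv> {S. finite S \<and> 0 \<notin> S \<and> S \<inter> R = {} \<and> \<Sum>S = N}"

text \<open>\<open>dcount {}\<close> is the number \<open>q\<close> of the overview. The set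
  \<open>R\<close> serves for windows of parts whose presence or absence has been settled
  beforehand.\<close>

definition dcount :: "nat set \<Rightarrow> nat \<Rightarrow> nat" where
  "dcount R N = card (avoiding_sets R N)"

lemma sum_mem_le:
  fixes S :: "nat set"
  assumes "finite S" "k \<in> S"
  shows "k \<le> \<Sum>S"
  using member_le_sum[of k S "\<lambda>x. x"] assms by auto

lemma dcount_sets_subset: "avoiding_sets R N \<subseteq> Pow {1..N}"
proof safe
  fix S :: "nat set" and k assume "finite S" "0 \<notin> S" "k \<in> S" "N = \<Sum>S"
  then show "k \<in> {1..\<Sum>S}"
    using sum_mem_le[of S k] by (cases k) auto
qed

lemma finite_dcount_sets: "finite (avoiding_sets R N)"
  by (rule finite_subset[OF dcount_sets_subset]) auto

lemma dcount_empty_eq: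
  assumes "l \<le> n"
  shows "dcount {} l = card {S \<in> Pow {1..n}. \<Sum>S = l}"
proof -
  have "avoiding_sets {} l = {S \<in> Pow {1..n}. \<Sum>S = l}"
    (is "?A = ?B")
  proof
    show "?A \<subseteq> ?B" using dcount_sets_subset[of "{}" l] assms by fastforce
    show "?B \<subseteq> ?A" using finite_subset by fastforce
  qed
  then show ?thesis by (simp add: dcount_def)
qed

lemma dcount_pos: "dcount {} n > 0"
proof -
  have "(if n = 0 then {} else {n}) \<in> avoiding_sets {} n" by auto
  then show ?thesis
    unfolding dcount_def using finite_dcount_sets[of "{}" n] by (metis (no_types, lifting) card_gt_0_iff empty_iff)
qed

definition occ :: "real \<Rightarrow> nat \<Rightarrow> real" where
  "occ t k = exp (- t * k) / (1 + exp (- t * k))"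

definition zpart :: "nat \<Rightarrow> real \<Rightarrow> real" where
  "zpart n t = (\<Prod>k=1..n. 1 + exp (- t * real k))"

text \<open>The distribution of the random sum for \<open>l \<le> n\<close> only: beyond
  \<open>n\<close>, \<open>dcount {} l\<close> also counts sets with elements larger than
  \<open>n\<close>, which the random set never contains.\<close>

definition law :: "nat \<Rightarrow> real \<Rightarrow> nat \<Rightarrow> real" where
  "law n t l = dcount {} l * exp (- t * l) / zpart n t"

definition charf :: "nat \<Rightarrow> real \<Rightarrow> real \<Rightarrow> complex" where
  "charf n t ph = (\<Prod>k=1..n. of_real (1 - occ t k) + of_real (occ t k) * cis (real k * ph))"

lemma one_plus_exp_pos: "1 + exp (x::real) > 0"
  by (simp add: add_pos_pos)

lemma zpart_pos: "zpart n t > 0"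
  unfolding zpart_def by (intro prod_pos) (auto simp: one_plus_exp_pos)

lemma occ_nonneg: "occ t k \<ge> 0" and occ_le_exp: "occ t k \<le> exp (- t * k)"
  and occ_le_1: "occ t k \<le> 1" and one_minus_occ: "1 - occ t k = 1 / (1 + exp (- t * k))"
  using one_plus_exp_pos[of "- t * k"] by (auto simp: occ_def field_simps)

lemma cis_sum: "finite S \<Longrightarrow> (\<Prod>k\<in>S. cis (f k)) = cis (\<Sum>k\<in>S. f k)"
  by (induction S rule: finite_induct) (auto simp: cis_mult)

text \<open>Multiplying out the product over subsets shows that a set \<open>S\<close> has a
  probability that depends on its sum alone; this links the independent model to partition
  counts.\<close>

lemma charf_expand:
  "charf n t ph = (\<Sum>S\<in>Pow {1..n}. of_real (exp (- t * real (\<Sum>S)) / zpart n t) * cis (real (\<Sum>S) * ph))"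
proof -
  let ?c = "\<lambda>k. 1 + exp (- t * real k)"
  have "charf n t ph = (\<Prod>k=1..n. (of_real (exp (- t * real k)) * cis (real k * ph) + 1) / of_real (?c k))"
    unfolding charf_def
  proof (rule prod.cong[OF refl])
    fix k :: nat
    have nz: "(of_real (?c k) :: complex) \<noteq> 0"
      using one_plus_exp_pos[of "- t * real k"] by (metis of_real_eq_0_iff less_irrefl)
    show "of_real (1 - occ t k) + of_real (occ t k) * cis (k * ph)
      = (of_real (exp (- t * k)) * cis (k * ph) + 1) / of_real (?c k)"
      unfolding one_minus_occ occ_def using nz by (simp add: field_simps)
  qed
  also have "\<dots> = (\<Prod>k=1..n. of_real (exp (- t * real k)) * cis (real k * ph) + 1) / of_real (zpart n t)"
    by (simp add: prod_dividef zpart_def)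
  also have "(\<Prod>k=1..n. of_real (exp (- t * real k)) * cis (real k * ph) + 1)
     = (\<Sum>S\<in>Pow {1..n}. \<Prod>k\<in>S. of_real (exp (- t * real k)) * cis (real k * ph))"
    by (subst prod_add) auto
  also have "\<dots> = (\<Sum>S\<in>Pow {1..n}. of_real (exp (- t * real (\<Sum>S))) * cis (real (\<Sum>S) * ph))"
  proof (rule sum.cong[OF refl])
    fix S :: "nat set" assume "S \<in> Pow {1..n}"
    then have fin: "finite S" using finite_subset by auto
    have "(\<Prod>k\<in>S. of_real (exp (- t * real k)) * cis (real k * ph)) = 
       of_real (\<Prod>k\<in>S. exp (- t * real k)) * (\<Prod>k\<in>S. cis (real k * ph))"
      by (simp add: prod.distrib)
    also have "(\<Prod>k\<in>S. exp (- t * real k)) = exp (- t * real (\<Sum>S))"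
      using fin by (simp add: exp_sum[symmetric] sum_distrib_left)
    also have "(\<Prod>k\<in>S. cis (real k * ph)) = cis (real (\<Sum>S) * ph)"
      using fin by (simp add: cis_sum sum_distrib_right)
    finally show "(\<Prod>k\<in>S. of_real (exp (- t * real k)) * cis (real k * ph))
      = of_real (exp (- t * real (\<Sum>S))) * cis (real (\<Sum>S) * ph)" .
  qed
  finally show ?thesis by (simp add: sum_divide_distrib)
qed

lemma has_integral_cos_int:
  "((\<lambda>ph. cos (of_int k * ph)) has_integral (if k = 0 then pi else 0)) {0..pi}"
proof (cases "k = 0")
  case True
  have "((\<lambda>ph::real. 1::real) has_integral pi) {0..pi}"
    using has_integral_const_real[of "1::real" 0 pi] by simp
  with True show ?thesis by simp
next
  case False
  have "((\<lambda>ph. cos (of_int k * ph)) has_integral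
     (sin (of_int k * pi) / of_int k - sin (of_int k * 0) / of_int k)) {0..pi}"
    using False
    by (intro fundamental_theorem_of_calculus)
       (auto intro!: derivative_eq_intros simp: has_real_derivative_iff_has_vector_derivative[symmetric])
  moreover have "sin (of_int k * pi) = 0"
    using sin_zero_iff_int2 by blast
  ultimately show ?thesis using False by simp
qed

text \<open>Fourier inversion. The coefficients are real, so the real part is even and half a period
  suffices; by \<open>has_integral_cos_int\<close> only the sets with sum \<open>l\<close>
  survive.\<close>

lemma law_fourier:
  assumes "l \<le> n"
  shows "((\<lambda>ph. Re (charf n t ph * cis (- (real l * ph)))) has_integral (pi * law n t l)) {0..pi}"
proof -
  let ?w = "\<lambda>S. exp (- t * real (\<Sum>S)) / zpart n t"
  have eq: "Re (charf n t ph * cis (- (real l * ph))) 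
    = (\<Sum>S\<in>Pow {1..n}. ?w S * cos (of_int (int (\<Sum>S) - int l) * ph))" for ph
  proof -
    have "charf n t ph * cis (- (real l * ph)) = 
      (\<Sum>S\<in>Pow {1..n}. of_real (?w S) * cis (of_int (int (\<Sum>S) - int l) * ph))"
      unfolding charf_expand sum_distrib_right mult.assoc cis_mult
      by (intro sum.cong refl) (simp add: algebra_simps)
    then show ?thesis by simp
  qed
  have "((\<lambda>ph. \<Sum>S\<in>Pow {1..n}. ?w S * cos (of_int (int (\<Sum>S) - int l) * ph)) has_integral
     (\<Sum>S\<in>Pow {1..n}. ?w S * (if int (\<Sum>S) - int l = 0 then pi else 0))) {0..pi}"
    by (intro has_integral_sum has_integral_mult_right has_integral_cos_int) auto
  moreover have "(\<Sum>S\<in>Pow {1..n}. ?w S * (if int (\<Sum>S) - int l = 0 then pi else 0)) = pi * law n t l"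
  proof -
    have "(\<Sum>S\<in>Pow {1..n}. ?w S * (if int (\<Sum>S) - int l = 0 then pi else 0))
      = (\<Sum>S\<in>{S \<in> Pow {1..n}. \<Sum>S = l}. ?w S * pi)"
      by (rule sum.mono_neutral_cong_right) (auto simp del: of_nat_sum split: if_splits)
    also have "\<dots> = (\<Sum>S\<in>{S \<in> Pow {1..n}. \<Sum>S = l}. exp (- t * real l) / zpart n t * pi)"
      by (rule sum.cong) auto
    finally show ?thesis by (simp add: law_def dcount_empty_eq[OF assms])
  qed
  ultimately show ?thesis by (simp only: eq)
qed

section \<open>Decay of the characteristic function\<close>

lemma power_le_exp:
  fixes x :: real
  assumes "x \<ge> 0"
  shows "x ^ n \<le> real n ^ n * exp x"
proof (cases "n = 0")
  case False
  have "x / n \<le> exp (x / n)"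
    using exp_ge_add_one_self[of "x / n"] by linarith
  then have "(x / n) ^ n \<le> exp (x / n) ^ n"
    using assms by (intro power_mono) auto
  also have "exp (x / n) ^ n = exp x"
    using False by (simp add: exp_of_nat_mult[symmetric])
  finally show ?thesis using False by (simp add: power_divide field_simps)
qed (use assms in auto)

lemma cos_ge_quadratic: "cos u \<ge> 1 - u\<^sup>2 / 2" for u :: real
proof -
  have "\<bar>sin (u / 2)\<bar> \<le> \<bar>u / 2\<bar>" by (rule abs_sin_x_le_abs_x)
  then have "(sin (u / 2))\<^sup>2 \<le> (u / 2)\<^sup>2" by (subst abs_le_square_iff[symmetric])
  moreover have "cos u = 1 - 2 * (sin (u / 2))\<^sup>2"
    using cos_double_sin[of "u / 2"] by simp
  ultimately show ?thesis by (simp add: power2_eq_square field_simps)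
qed

lemma norm_cis_diff_le: "cmod (cis a - cis b) \<le> \<bar>a - b\<bar>"
proof -
  have "(cmod (cis a - cis b))\<^sup>2 = (cos a - cos b)\<^sup>2 + (sin a - sin b)\<^sup>2"
    by (simp add: cmod_power2)
  also have "\<dots> = 2 - 2 * cos (a - b)"
    using sin_cos_squared_add[of a] sin_cos_squared_add[of b]
    by (simp add: cos_diff power2_eq_square algebra_simps)
  also have "\<dots> \<le> (a - b)\<^sup>2"
    using cos_ge_quadratic[of "a - b"] by simp
  finally show ?thesis
    by (metis abs_ge_zero norm_ge_zero power2_abs power2_le_imp_le)
qed

text \<open>Up to \<open>pi / 3\<close> the derivative is at least 1/2; from there on the sine is at
  least \<open>sin (pi / 3) > 4 / 5\<close>, while
  \<open>y / 2 \<le> pi / 4 < 4 / 5\<close>.\<close>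

lemma sin_ge_half:
  fixes y :: real
  assumes "0 \<le> y" "y \<le> pi / 2"
  shows "sin y \<ge> y / 2"
proof (cases "y \<le> pi / 3")
  case True
  have "\<exists>z. 0 \<le> z \<and> z \<le> y \<and> sin y - sin 0 = (y - 0) * cos z"
  proof (cases "y = 0")
    case False
    with assms have "0 < y" by simp
    then obtain z where "0 < z" "z < y" "sin y - sin 0 = (y - 0) * cos z"
      using MVT2[of 0 y sin cos] by (auto intro!: derivative_eq_intros)
    then show ?thesis by (intro exI[of _ z]) auto
  qed auto
  then obtain z where z: "0 \<le> z" "z \<le> y" "sin y = y * cos z" by auto
  have "cos z \<ge> cos (pi / 3)"
    using z True by (intro cos_monotone_0_pi_le) auto
  then have "cos z \<ge> 1 / 2" by (simp add: cos_60)
  then show ?thesis using z assms mult_left_mono[of "1/2" "cos z" y] by simp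
next
  case False
  have "sin (pi / 3) \<le> sin y"
    using False assms by (intro sin_monotone_2pi_le) auto
  moreover have "sin (pi / 3) \<ge> 4 / 5"
  proof -
    have "8 / 5 \<le> sqrt 3" by (rule real_le_rsqrt) (simp add: power2_eq_square)
    then show ?thesis unfolding sin_60 by simp
  qed
  moreover have "pi < 3.2" using pi_approx by simp
  ultimately show ?thesis using assms by simp
qed

lemma one_minus_cos_ge:
  fixes u :: real
  assumes "0 \<le> u" "u \<le> pi"
  shows "1 - cos u \<ge> u\<^sup>2 / 8"
proof -
  have "sin (u / 2) \<ge> u / 4" using sin_ge_half[of "u / 2"] assms by simp
  then have "(sin (u / 2))\<^sup>2 \<ge> (u / 4)\<^sup>2"
    using assms by (intro power_mono) auto
  moreover have "cos u = 1 - 2 * (sin (u / 2))\<^sup>2"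
    using cos_double_sin[of "u / 2"] by simp
  ultimately show ?thesis by (simp add: power2_eq_square field_simps)
qed

lemma dirichlet_kernel:
  fixes ph :: real
  shows "2 * sin (ph / 2) * (\<Sum>k\<in>{1..M::nat}. cos (real k * ph)) = sin ((real M + 1 / 2) * ph) - sin (ph / 2)"
proof (induction M)
  case (Suc M)
  have "sin ((real (Suc M) + 1 / 2) * ph) - sin ((real M + 1 / 2) * ph)
     = 2 * sin (ph / 2) * cos (real (Suc M) * ph)"
  proof -
    have *: "((real (Suc M) + 1 / 2) * ph - (real M + 1 / 2) * ph) / 2 = ph / 2"
      "((real (Suc M) + 1 / 2) * ph + (real M + 1 / 2) * ph) / 2 = real (Suc M) * ph"
      by (simp_all add: field_simps)
    show ?thesis
      using sin_diff_sin[of "(real (Suc M) + 1 / 2) * ph" "(real M + 1 / 2) * ph"]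
      unfolding * .
  qed
  then show ?case using Suc by (simp add: algebra_simps)
qed simp

lemma sum_cos_le:
  assumes "0 < ph" "ph \<le> pi"
  shows "(\<Sum>k\<in>{1..M::nat}. cos (real k * ph)) \<le> 2 / ph"
proof -
  have s: "sin (ph / 2) \<ge> ph / 4" using sin_ge_half[of "ph / 2"] assms by simp
  with assms have s0: "sin (ph / 2) > 0" by simp
  have "2 * sin (ph / 2) * (\<Sum>k=1..M. cos (real k * ph)) \<le> 1"
    unfolding dirichlet_kernel using s0 sin_le_one[of "(real M + 1 / 2) * ph"] by linarith
  then have "(\<Sum>k=1..M. cos (real k * ph)) \<le> 1 / (2 * sin (ph / 2))"
    using s0 by (simp add: field_simps)
  also have "\<dots> \<le> 1 / (ph / 2)"
    using s assms by (intro divide_left_mono) auto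
  finally show ?thesis by simp
qed

text \<open>The squared modulus is exactly \<open>1 - 2 * p * (1 - p) * (1 - cos u)\<close>, so the
  decay is governed by the variance \<open>p * (1 - p)\<close>.\<close>

lemma two_point_char_norm:
  assumes "0 \<le> p" "p \<le> (1::real)"
  shows "cmod (of_real (1 - p) + of_real p * cis u) \<le> exp (- (p * (1 - p) * (1 - cos u)))"
proof -
  have "(cmod (of_real (1 - p) + of_real p * cis u))\<^sup>2 = (1 - p + p * cos u)\<^sup>2 + (p * sin u)\<^sup>2"
    by (simp add: cmod_power2)
  also have "\<dots> = (1 - p + p * cos u)\<^sup>2 + p\<^sup>2 * (1 - (cos u)\<^sup>2)"
    by (simp add: power_mult_distrib sin_squared_eq)
  also have "\<dots> = 1 + (- (2 * (p * (1 - p) * (1 - cos u))))"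
    by (simp add: power2_eq_square algebra_simps)
  also have "\<dots> \<le> exp (- (2 * (p * (1 - p) * (1 - cos u))))"
    by (rule exp_ge_add_one_self)
  also have "\<dots> = (exp (- (p * (1 - p) * (1 - cos u))))\<^sup>2"
    by (simp add: power2_eq_square exp_add[symmetric])
  finally show ?thesis
    by (rule power2_le_imp_le) simp
qed

text \<open>Parts up to \<open>1 / t\<close> have a variance of constant order:
  \<open>y = exp (- t * k)\<close> lies between 1/3 and 1, and the variance is
  \<open>y / (1 + y)^2\<close>, at least (1/3) / 4.\<close>

lemma occ_var_ge:
  assumes "0 \<le> t" "t * real k \<le> 1"
  shows "occ t k * (1 - occ t k) \<ge> 1 / 12"
proof -
  define y where "y = exp (- t * real k)"
  have y: "0 < y" "y \<le> 1" using assms by (auto simp: y_def)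
  have "y \<ge> 1 / 3"
  proof -
    have "exp (t * real k) \<le> exp 1" using assms by simp
    also have "exp (1::real) \<le> 3" by (rule exp_le)
    finally show ?thesis by (simp add: y_def exp_minus field_simps)
  qed
  have eq: "occ t k * (1 - occ t k) = y / (1 + y)\<^sup>2"
    unfolding one_minus_occ by (simp add: occ_def y_def power2_eq_square)
  have "(1 + y)\<^sup>2 \<le> 2\<^sup>2" using y by (intro power_mono) auto
  then have "y / (1 + y)\<^sup>2 \<ge> (1 / 3) / 4"
    using y \<open>y \<ge> 1/3\<close> by (intro frac_le) auto
  then show ?thesis using eq by simp
qed

text \<open>Only the factors of parts up to \<open>1 / t\<close> are used, where
  \<open>occ_var_ge\<close> applies; the remaining ones have modulus at most 1.\<close>

lemma charf_norm_le:
  assumes "0 \<le> t" "t * real M \<le> 1" "M \<le> n"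
  shows "cmod (charf n t ph) \<le> exp (- (\<Sum>k=1..M. 1 - cos (real k * ph)) / 12)"
proof -
  let ?e = "\<lambda>k. occ t k * (1 - occ t k) * (1 - cos (real k * ph))"
  have nn: "?e k \<ge> 0" for k
    using occ_nonneg[of t k] occ_le_1[of t k] by (intro mult_nonneg_nonneg) auto
  have "cmod (charf n t ph) \<le> (\<Prod>k=1..n. exp (- ?e k))"
    unfolding charf_def prod_norm[symmetric]
    by (intro prod_mono conjI two_point_char_norm occ_nonneg occ_le_1) auto
  also have "\<dots> = exp (- (\<Sum>k=1..n. ?e k))"
    by (simp add: exp_sum sum_negf[symmetric])
  also have "\<dots> \<le> exp (- (\<Sum>k=1..M. 1 - cos (real k * ph)) / 12)"
  proof -
    have "(\<Sum>k=1..M. 1 - cos (real k * ph)) / 12 = (\<Sum>k=1..M. 1 / 12 * (1 - cos (real k * ph)))"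
      by (simp add: sum_distrib_left sum_divide_distrib)
    also have "\<dots> \<le> (\<Sum>k=1..M. ?e k)"
    proof (intro sum_mono mult_right_mono occ_var_ge)
      fix k assume "k \<in> {1..M}"
      then have "t * real k \<le> t * real M" using assms by (intro mult_left_mono) auto
      then show "t * real k \<le> 1" using assms by simp
    qed (use assms in auto)
    also have "\<dots> \<le> (\<Sum>k=1..n. ?e k)"
      using assms nn by (intro sum_mono2) auto
    finally show ?thesis by simp
  qed
  finally show ?thesis .
qed

lemma sum_squares_ge: "(\<Sum>k\<in>{1..N::nat}. (real k)\<^sup>2) \<ge> real N ^ 3 / 3"
proof (induction N)
  case (Suc N)
  have "real (Suc N) ^ 3 / 3 \<le> real N ^ 3 / 3 + (real (Suc N))\<^sup>2"
    by (simp add: power2_eq_square power3_eq_cube field_simps)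
  then show ?case using Suc by simp
qed simp

text \<open>All angles \<open>k * ph\<close> stay below \<open>pi\<close>, so the quadratic bound
  for \<open>1 - cos\<close> holds for each term. The constant is 288 = 8 * 3 * 12, from that bound,
  \<open>sum_squares_ge\<close> and \<open>charf_norm_le\<close>.\<close>

lemma charf_decay_near:
  assumes "0 \<le> t" "t * real N \<le> 1" "N \<le> n" "0 \<le> ph" "real N * ph \<le> 2"
  shows "cmod (charf n t ph) \<le> exp (- (ph\<^sup>2 * real N ^ 3 / 288))"
proof -
  have "ph\<^sup>2 * real N ^ 3 / 24 \<le> ph\<^sup>2 / 8 * (\<Sum>k=1..N. (real k)\<^sup>2)"
    using mult_left_mono[OF sum_squares_ge[of N], of "ph\<^sup>2 / 8"] by simp
  also have "\<dots> = (\<Sum>k=1..N. (real k * ph)\<^sup>2 / 8)"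
    by (simp add: sum_distrib_left power_mult_distrib mult.commute)
  also have "\<dots> \<le> (\<Sum>k=1..N. 1 - cos (real k * ph))"
  proof (intro sum_mono one_minus_cos_ge)
    fix k assume "k \<in> {1..N}"
    then have "real k * ph \<le> real N * ph" using assms by (intro mult_right_mono) auto
    also have "\<dots> \<le> 2" by fact
    finally show "real k * ph \<le> pi" using pi_gt3 by simp
  qed (use assms in auto)
  finally show ?thesis
    by (intro order_trans[OF charf_norm_le[OF assms(1-3)]]) simp
qed

text \<open>With \<open>2 * N\<close> terms, the cosine sum is at most
  \<open>2 / ph \<le> N\<close>, so at least half of the trivial contribution \<open>2 * N\<close>
  remains.\<close>

lemma charf_decay_far:
  assumes "0 \<le> t" "t * real (2 * N) \<le> 1" "2 * N \<le> n" "N > 0" "ph \<le> pi" "real N * ph \<ge> 2"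
  shows "cmod (charf n t ph) \<le> exp (- (real N / 12))"
proof -
  have th: "ph > 0" using assms by (smt (verit) mult_nonneg_nonpos of_nat_0_le_iff)
  have "(\<Sum>k\<in>{1..2 * N}. cos (real k * ph)) \<le> 2 / ph"
    by (rule sum_cos_le) (use th assms in auto)
  also have "\<dots> \<le> real N" using th assms by (simp add: field_simps)
  finally have "real N \<le> (\<Sum>k\<in>{1..2 * N}. 1 - cos (real k * ph))"
    by (simp add: sum_subtractf)
  then show ?thesis
    by (intro order_trans[OF charf_norm_le[OF assms(1-3)]]) simp
qed

text \<open>Both ranges are put under one rational bound that integrates in closed form. It decays
  like \<open>ph\<close> to the power -4, which is enough for the first moment in
  \<open>law_lipschitz\<close> and for the tail in \<open>law_lower_bound\<close>.\<close>

lemma charf_decay: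
  obtains K :: real where "K > 0"
    "\<And>n t ph. 0 < t \<Longrightarrow> t \<le> 1 / 4 \<Longrightarrow> 1 / t \<le> real n \<Longrightarrow> 0 \<le> ph \<Longrightarrow> ph \<le> pi \<Longrightarrow>
       cmod (charf n t ph) \<le> K / (1 + ph\<^sup>2 / t ^ 3)\<^sup>2"
proof -
  \<comment> \<open>With \<open>N \<ge> 1 / (4 * t)\<close>, the exponents of the near and far
    bounds become c = 1 / (288 * 64) times \<open>ph^2 / t ^ 3\<close> and d = 1 / (12 * 4) times
    \<open>1 / t\<close>. \<open>K1\<close> and \<open>K2\<close> come from
    \<open>power_le_exp\<close> with powers 2 and 6, the latter because \<open>z ^ 3\<close> gets
    squared.\<close>
  define c where "c = (1 / 18432 :: real)"
  define d where "d = (1 / 48 :: real)"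
  define K1 where "K1 = 4 / c\<^sup>2 * exp c"
  define K2 where "K2 = (1 + pi\<^sup>2)\<^sup>2 * (6 ^ 6 / d ^ 6)"
  have cd: "c > 0" "d > 0" by (auto simp: c_def d_def)
  have K1: "exp (- (c * y)) \<le> K1 / (1 + y)\<^sup>2" if "y \<ge> 0" for y
  proof -
    have "(c * (1 + y)) ^ 2 \<le> real 2 ^ 2 * exp (c * (1 + y))"
      using that cd by (intro power_le_exp) auto
    moreover have "exp (c * (1 + y)) = exp c * exp (c * y)"
      by (simp add: distrib_left exp_add)
    ultimately have "c\<^sup>2 * (1 + y)\<^sup>2 \<le> 4 * exp c * exp (c * y)"
      by (simp add: power_mult_distrib mult.assoc)
    then have "(1 + y)\<^sup>2 \<le> K1 * exp (c * y)"
      unfolding K1_def using cd by (simp add: field_simps)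
    then show ?thesis using that by (simp add: exp_minus field_simps)
  qed
  have K2: "exp (- (d * z)) \<le> K2 / (1 + ph\<^sup>2 * z ^ 3)\<^sup>2"
    if "z \<ge> 1" "0 \<le> ph" "ph \<le> pi" for z ph
  proof -
    have "(1 + ph\<^sup>2 * z ^ 3)\<^sup>2 \<le> ((1 + pi\<^sup>2) * z ^ 3)\<^sup>2"
    proof (rule power_mono)
      have "ph\<^sup>2 * z ^ 3 \<le> pi\<^sup>2 * z ^ 3"
        using that by (intro mult_right_mono power_mono) auto
      moreover have "1 \<le> z ^ 3" using that by simp
      ultimately show "1 + ph\<^sup>2 * z ^ 3 \<le> (1 + pi\<^sup>2) * z ^ 3" by (simp add: distrib_right)
    qed (use that in auto)
    also have "\<dots> = (1 + pi\<^sup>2)\<^sup>2 * ((d * z) ^ 6 / d ^ 6)"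
      using cd by (simp add: power_mult_distrib flip: power_mult)
    also have "\<dots> \<le> (1 + pi\<^sup>2)\<^sup>2 * (real 6 ^ 6 * exp (d * z) / d ^ 6)"
      using that cd by (intro mult_left_mono divide_right_mono power_le_exp) auto
    also have "\<dots> = K2 * exp (d * z)" by (simp add: K2_def)
    finally have "(1 + ph\<^sup>2 * z ^ 3)\<^sup>2 \<le> K2 * exp (d * z)" .
    moreover have "(1 + ph\<^sup>2 * z ^ 3)\<^sup>2 > 0"
      using that by (intro zero_less_power add_pos_nonneg) auto
    ultimately show ?thesis by (simp add: exp_minus field_simps)
  qed
  show thesis
  proof
    show "max K1 K2 > 0" unfolding K1_def using cd by (simp add: less_max_iff_disj)
    fix n :: nat and t ph :: real
    assume t: "0 < t" "t \<le> 1 / 4" and n: "1 / t \<le> real n" and ph: "0 \<le> ph" "ph \<le> pi"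
    \<comment> \<open>About half of \<open>1 / t\<close>, because the far range uses
      \<open>2 * N\<close> parts, all of which have to satisfy \<open>t * k \<le> 1\<close>. The
      bound \<open>t \<le> 1 / 4\<close> makes the loss by rounding at most another factor
      2.\<close>
    define N where "N = nat \<lfloor>1 / (2 * t)\<rfloor>"
    have "1 / (2 * t) \<ge> 2" using t by (simp add: field_simps)
    then have N: "real N \<le> 1 / (2 * t)" "real N \<ge> 1 / (2 * t) - 1" "N > 0"
      unfolding N_def by linarith+
    have N4: "real N \<ge> 1 / (4 * t)"
    proof -
      have "1 / (2 * t) = 1 / (4 * t) + 1 / (4 * t)" by (simp add: field_simps)
      moreover have "1 / (4 * t) \<ge> 1" using t by (simp add: field_simps)
      ultimately show ?thesis using N by linarith
    qed
    have tN: "t * real (2 * N) \<le> 1" using N(1) t by (simp add: field_simps)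
    have "real (2 * N) \<le> 1 / t" using N(1) by (simp add: field_simps)
    then have Nn: "2 * N \<le> n" using n by linarith
    have den: "(1 + ph\<^sup>2 / t ^ 3)\<^sup>2 > 0"
      using t by (intro zero_less_power add_pos_nonneg) auto
    show "cmod (charf n t ph) \<le> max K1 K2 / (1 + ph\<^sup>2 / t ^ 3)\<^sup>2"
    proof (cases "real N * ph \<le> 2")
      case True
      have tN': "t * real N \<le> 1" using tN mult_nonneg_nonneg[of t "real N"] t by (simp add: mult.left_commute)
      have "cmod (charf n t ph) \<le> exp (- (ph\<^sup>2 * real N ^ 3 / 288))"
        using t tN' Nn ph True by (intro charf_decay_near) auto
      also have "\<dots> \<le> exp (- (c * (ph\<^sup>2 / t ^ 3)))"
      proof -
        have "(1 / (4 * t)) ^ 3 \<le> real N ^ 3" using N4 t by (intro power_mono) auto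
        then have "ph\<^sup>2 * (1 / (4 * t)) ^ 3 \<le> ph\<^sup>2 * real N ^ 3" by (intro mult_left_mono) auto
        then show ?thesis by (simp add: c_def power_divide power_mult_distrib field_simps)
      qed
      also have "\<dots> \<le> K1 / (1 + ph\<^sup>2 / t ^ 3)\<^sup>2" using t by (intro K1) auto
      also have "\<dots> \<le> max K1 K2 / (1 + ph\<^sup>2 / t ^ 3)\<^sup>2"
        using den by (intro divide_right_mono) auto
      finally show ?thesis .
    next
      case False
      have "cmod (charf n t ph) \<le> exp (- (real N / 12))"
        using t tN Nn N ph False by (intro charf_decay_far) auto
      also have "\<dots> \<le> exp (- (d * (1 / t)))"
        using N4 by (simp add: d_def)
      also have "\<dots> \<le> K2 / (1 + ph\<^sup>2 * (1 / t) ^ 3)\<^sup>2"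
        using t ph by (intro K2) auto
      also have "\<dots> \<le> max K1 K2 / (1 + ph\<^sup>2 * (1 / t) ^ 3)\<^sup>2"
        using den by (intro divide_right_mono) auto
      finally show ?thesis by (simp add: power_divide)
    qed
  qed
qed

section \<open>Local bounds for the law of the sum\<close>

lemma has_integral_cubic_kernel:
  assumes "T > 0"
  shows "((\<lambda>ph::real. ph / (1 + ph\<^sup>2 / T)\<^sup>2) has_integral (T / 2 - T / 2 / (1 + pi\<^sup>2 / T))) {0..pi}"
proof -
  have pos: "1 + ph\<^sup>2 / T > 0" for ph :: real
    using assms by (intro add_pos_nonneg) auto
  have "((\<lambda>ph. ph / (1 + ph\<^sup>2 / T)\<^sup>2) has_integral
      (- (T / 2) / (1 + pi\<^sup>2 / T) - - (T / 2) / (1 + 0\<^sup>2 / T))) {0..pi}"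
  proof (rule fundamental_theorem_of_calculus)
    fix x :: real
    show "((\<lambda>ph. - (T / 2) / (1 + ph\<^sup>2 / T)) has_vector_derivative x / (1 + x\<^sup>2 / T)\<^sup>2) (at x within {0..pi})"
      unfolding has_real_derivative_iff_has_vector_derivative[symmetric]
    proof -
      have eq: "4 * x / ((2 + 2 * (x * x) / T) * (2 + 2 * (x * x) / T)) = x / ((1 + x * x / T) * (1 + x * x / T))"
      proof -
        have "2 + 2 * (x * x) / T = 2 * (1 + x * x / T)" by simp
        moreover have "4 * x / ((2 * D) * (2 * D)) = x / (D * D)" for D :: real by simp
        ultimately show ?thesis by metis
      qed
      show "((\<lambda>ph. - (T / 2) / (1 + ph\<^sup>2 / T)) has_real_derivative x / (1 + x\<^sup>2 / T)\<^sup>2) (at x within {0..pi})"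
        using pos[of x] assms eq
        by (auto intro!: derivative_eq_intros simp: power2_eq_square)
    qed
  qed simp
  then show ?thesis by simp
qed

lemma has_integral_inverse_fourth:
  assumes "0 < b" "b \<le> c"
  shows "((\<lambda>ph::real. 1 / ph ^ 4) has_integral (1 / (3 * b ^ 3) - 1 / (3 * c ^ 3))) {b..c}"
proof -
  have "((\<lambda>ph. 1 / ph ^ 4) has_integral (- (1 / (3 * c ^ 3)) - - (1 / (3 * b ^ 3)))) {b..c}"
  proof (rule fundamental_theorem_of_calculus)
    fix x :: real assume "x \<in> {b..c}"
    then have "x \<noteq> 0" using assms by auto
    then show "((\<lambda>ph. - (1 / (3 * ph ^ 3))) has_vector_derivative 1 / x ^ 4) (at x within {b..c})"
      unfolding has_real_derivative_iff_has_vector_derivative[symmetric]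
      by (auto intro!: derivative_eq_intros simp: field_simps power_numeral_reduce)
  qed (use assms in simp)
  then show ?thesis by simp
qed

text \<open>The difference of the two Fourier integrands is at most
  \<open>\<bar>l - l'\<bar> * ph\<close> times the modulus of the characteristic function, and the
  first moment of the bound from \<open>charf_decay\<close> is at most \<open>t ^ 3 / 2\<close>
  times its constant.\<close>

lemma law_lipschitz:
  obtains C :: real where "C > 0"
    "\<And>n t l l'. 0 < t \<Longrightarrow> t \<le> 1 / 4 \<Longrightarrow> 1 / t \<le> real n \<Longrightarrow> l \<le> n \<Longrightarrow> l' \<le> n \<Longrightarrow>
       \<bar>law n t l - law n t l'\<bar> \<le> C * \<bar>real l - real l'\<bar> * t ^ 3"
proof -
  obtain K where K: "K > 0"
    "\<And>n t ph. 0 < t \<Longrightarrow> t \<le> 1 / 4 \<Longrightarrow> 1 / t \<le> real n \<Longrightarrow> 0 \<le> ph \<Longrightarrow> ph \<le> pi \<Longrightarrow>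
       cmod (charf n t ph) \<le> K / (1 + ph\<^sup>2 / t ^ 3)\<^sup>2"
    using charf_decay by blast
  show thesis
  proof
    show "K / (2 * pi) > 0" using K by simp
    fix n l l' and t :: real
    assume t: "0 < t" "t \<le> 1 / 4" "1 / t \<le> real n" and l: "l \<le> n" "l' \<le> n"
    define d where "d = \<bar>real l - real l'\<bar>"
    let ?f = "\<lambda>ph. Re (charf n t ph * cis (- (real l * ph))) - Re (charf n t ph * cis (- (real l' * ph)))"
    have f: "(?f has_integral (pi * law n t l - pi * law n t l')) {0..pi}"
      by (intro has_integral_diff law_fourier l)
    let ?g = "\<lambda>ph. K * d * (ph / (1 + ph\<^sup>2 / t ^ 3)\<^sup>2)"
    have g: "(?g has_integral (K * d * (t ^ 3 / 2 - t ^ 3 / 2 / (1 + pi\<^sup>2 / t ^ 3)))) {0..pi}"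
      using t by (intro has_integral_mult_right has_integral_cubic_kernel) auto
    have "norm (integral {0..pi} ?f) \<le> integral {0..pi} ?g"
    proof (rule integral_norm_bound_integral)
      fix ph assume ph: "ph \<in> {0..pi}"
      have "norm (?f ph) = \<bar>Re (charf n t ph * (cis (- (real l * ph)) - cis (- (real l' * ph))))\<bar>"
        by (simp add: right_diff_distrib)
      also have "\<dots> \<le> cmod (charf n t ph) * cmod (cis (- (real l * ph)) - cis (- (real l' * ph)))"
        by (metis abs_Re_le_cmod norm_mult)
      also have "\<dots> \<le> (K / (1 + ph\<^sup>2 / t ^ 3)\<^sup>2) * \<bar>- (real l * ph) - - (real l' * ph)\<bar>"
        using ph t K(1) by (intro mult_mono K(2) norm_cis_diff_le) auto
      also have "\<bar>- (real l * ph) - - (real l' * ph)\<bar> = d * ph"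
      proof -
        have "- (real l * ph) - - (real l' * ph) = (real l' - real l) * ph" by (simp add: algebra_simps)
        then show ?thesis using ph by (simp add: abs_mult d_def abs_minus_commute)
      qed
      finally show "norm (?f ph) \<le> ?g ph" by simp
    qed (use has_integral_integrable[OF f] has_integral_integrable[OF g] in auto)
    also have "integral {0..pi} ?g \<le> K * d * (t ^ 3 / 2)"
      unfolding integral_unique[OF g] using t K(1)
      by (intro mult_left_mono) (auto simp: d_def intro!: divide_nonneg_nonneg add_nonneg_nonneg)
    finally have "pi * \<bar>law n t l - law n t l'\<bar> \<le> K * d * (t ^ 3 / 2)"
      unfolding integral_unique[OF f] by (simp add: abs_mult right_diff_distrib[symmetric])
    then show "\<bar>law n t l - law n t l'\<bar> \<le> K / (2 * pi) * \<bar>real l - real l'\<bar> * t ^ 3"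
      by (simp add: d_def field_simps)
  qed
qed

lemma exp_minus_quadratic:
  fixes v :: real
  assumes "v \<ge> 0"
  shows "1 - v \<le> exp (- v)" "exp (- v) \<le> 1 - v + v\<^sup>2 / 2"
proof -
  show "1 - v \<le> exp (- v)" using exp_ge_add_one_self[of "- v"] by simp
  have pos: "1 - v + v\<^sup>2 / 2 > 0"
  proof -
    have "1 - v + v\<^sup>2 / 2 = (1 - v / 2)\<^sup>2 + v\<^sup>2 / 4"
      by (simp add: power2_eq_square field_simps)
    moreover have "(1 - v / 2)\<^sup>2 + v\<^sup>2 / 4 > 0"
      by (cases "v = 0") (auto intro: add_nonneg_pos)
    ultimately show ?thesis by simp
  qed
  have "1 \<le> (1 - v + v\<^sup>2 / 2) * (1 + v + v\<^sup>2 / 2)"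
  proof -
    have "(1 - v + v\<^sup>2 / 2) * (1 + v + v\<^sup>2 / 2) = 1 + (v\<^sup>2 / 2)\<^sup>2"
      by (simp add: power2_eq_square field_simps)
    then show ?thesis by simp
  qed
  also have "\<dots> \<le> (1 - v + v\<^sup>2 / 2) * exp v"
    using pos exp_lower_Taylor_quadratic[OF assms] by (intro mult_left_mono) auto
  finally show "exp (- v) \<le> 1 - v + v\<^sup>2 / 2" by (simp add: exp_minus field_simps)
qed

lemma cis_taylor: "cmod (cis x - (1 + \<i> * of_real x - of_real (x\<^sup>2 / 2))) \<le> \<bar>x\<bar> ^ 3 / 6"
proof -
  have a: "(\<Sum>k\<le>2. (\<i> * complex_of_real x) ^ k / fact k) = 1 + \<i> * of_real x - of_real (x\<^sup>2 / 2)"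
    by (simp add: numeral_2_eq_2 power2_eq_square complex_eq_iff)
  have b: "\<bar>x\<bar> ^ Suc 2 / fact (Suc 2) = \<bar>x\<bar> ^ 3 / 6"
    by (simp add: fact_numeral eval_nat_numeral)
  show ?thesis
    using iexp_approx1[of x 2] unfolding a b cis_conv_exp .
qed

text \<open>The factor \<open>cis (- (p * u))\<close> centres the variable: in the second-order
  Taylor polynomials the linear terms cancel and the quadratic ones combine to \<open>1 - v\<close>,
  with \<open>v\<close> half the variance times \<open>u^2\<close>. The Gaussian factor has the same
  second-order part, so both differ from it by third-order terms. The factor \<open>p\<close> in the
  bound is what makes the sum over all parts converge.\<close>

lemma two_point_char_gauss:
  assumes p: "0 \<le> p" "p \<le> (1::real)"
  shows "cmod ((of_real (1 - p) + of_real p * cis u) * cis (- (p * u))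
           - of_real (exp (- (u\<^sup>2 * (p * (1 - p)) / 2)))) \<le> p * \<bar>u\<bar> ^ 3"
proof -
  define v where "v = u\<^sup>2 * (p * (1 - p)) / 2"
  define T where "T x = 1 + \<i> * of_real x - of_real (x\<^sup>2 / 2)" for x :: real
  define x where "x = - (p * u)"
  define y where "y = (1 - p) * u"
  have v0: "v \<ge> 0" using p by (simp add: v_def)
  have e: "(of_real (1 - p) + of_real p * cis u) * cis (- (p * u)) = of_real (1 - p) * cis x + of_real p * cis y"
    by (simp add: x_def y_def algebra_simps cis_mult)
  have T: "of_real (1 - p) * T x + of_real p * T y = of_real (1 - v)"
  proof (rule complex_eqI)
    show "Re (of_real (1 - p) * T x + of_real p * T y) = Re (of_real (1 - v))"
      by (simp add: T_def x_def y_def v_def) algebra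
    show "Im (of_real (1 - p) * T x + of_real p * T y) = Im (of_real (1 - v))"
      by (simp add: T_def x_def y_def)
  qed
  have pp: "p * (1 - p) \<le> 1"
    using mult_mono[of p 1 "1 - p" 1] p by simp
  have "cmod ((of_real (1 - p) * cis x + of_real p * cis y) - of_real (1 - v))
     = cmod (of_real (1 - p) * (cis x - T x) + of_real p * (cis y - T y))"
    unfolding T[symmetric] by (simp add: algebra_simps)
  also have "\<dots> \<le> cmod (of_real (1 - p) * (cis x - T x)) + cmod (of_real p * (cis y - T y))"
    by (rule norm_triangle_ineq)
  also have "\<dots> = (1 - p) * cmod (cis x - T x) + p * cmod (cis y - T y)"
    using p by (simp add: norm_mult del: of_real_diff)
  also have "\<dots> \<le> (1 - p) * (\<bar>x\<bar> ^ 3 / 6) + p * (\<bar>y\<bar> ^ 3 / 6)"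
    unfolding T_def using p by (intro add_mono mult_left_mono cis_taylor) auto
  also have "\<dots> \<le> (1 - p) * (p * \<bar>u\<bar> ^ 3 / 6) + p * (\<bar>u\<bar> ^ 3 / 6)"
  proof -
    have "\<bar>x\<bar> ^ 3 = p ^ 3 * \<bar>u\<bar> ^ 3" "\<bar>y\<bar> ^ 3 = (1 - p) ^ 3 * \<bar>u\<bar> ^ 3"
      using p by (auto simp: x_def y_def abs_mult power_mult_distrib)
    moreover have "p ^ 3 \<le> p" using power_decreasing[of 1 3 p] p by simp
    moreover have "(1 - p) ^ 3 \<le> 1" using p by (simp add: power_le_one)
    ultimately show ?thesis using p
      by (intro add_mono mult_left_mono divide_right_mono)
         (auto intro: mult_right_mono mult_left_le_one_le)
  qed
  also have "\<dots> \<le> p * \<bar>u\<bar> ^ 3 / 3"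
  proof -
    have "(1 - p) * (p * \<bar>u\<bar> ^ 3 / 6) \<le> 1 * (p * \<bar>u\<bar> ^ 3 / 6)"
      using p by (intro mult_right_mono) auto
    then show ?thesis by linarith
  qed
  finally have A: "cmod ((of_real (1 - p) * cis x + of_real p * cis y) - of_real (1 - v)) \<le> p * \<bar>u\<bar> ^ 3 / 3" .
  \<comment> \<open>The error \<open>v^2 / 2\<close> is of fourth order in \<open>u\<close> and fits
    under the cubic bound for small \<open>u\<close> only; for large \<open>u\<close> the trivial
    bound \<open>v\<close> is already small enough.\<close>
  have B: "\<bar>exp (- v) - (1 - v)\<bar> \<le> p * \<bar>u\<bar> ^ 3 / 2"
  proof (cases "\<bar>u\<bar> \<le> 1")
    case True
    have "\<bar>exp (- v) - (1 - v)\<bar> \<le> v\<^sup>2 / 2"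
      using exp_minus_quadratic[OF v0] by linarith
    also have "\<dots> = (p * (1 - p))\<^sup>2 * (\<bar>u\<bar> * \<bar>u\<bar> ^ 3) / 8"
      by (simp add: v_def power2_eq_square power3_eq_cube)
    also have "\<dots> \<le> p * (1 * \<bar>u\<bar> ^ 3) / 8"
    proof (intro divide_right_mono mult_mono)
      have "(p * (1 - p))\<^sup>2 = p * ((1 - p) * (p * (1 - p)))" by (simp add: power2_eq_square)
      also have "\<dots> \<le> p * 1"
        using p mult_mono[of "1 - p" 1 "p * (1 - p)" 1] pp by (intro mult_left_mono) auto
      finally show "(p * (1 - p))\<^sup>2 \<le> p" by simp
    qed (use True p in auto)
    also have "\<dots> \<le> p * \<bar>u\<bar> ^ 3 / 2" using p by simp
    finally show ?thesis .
  next
    case False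
    have "exp (- v) \<le> 1" using v0 by simp
    then have "\<bar>exp (- v) - (1 - v)\<bar> \<le> v"
      using exp_minus_quadratic[OF v0] by linarith
    also have "\<dots> \<le> p * \<bar>u\<bar> ^ 3 / 2"
    proof -
      have "u\<^sup>2 = \<bar>u\<bar> ^ 2" by simp
      also have "\<dots> \<le> \<bar>u\<bar> ^ 3" using False by (intro power_increasing) auto
      finally have "u\<^sup>2 * (p * (1 - p)) \<le> \<bar>u\<bar> ^ 3 * (p * 1)"
        using p by (intro mult_mono mult_left_mono) auto
      then show ?thesis by (simp add: v_def mult.commute)
    qed
    finally show ?thesis .
  qed
  have "cmod ((of_real (1 - p) * cis x + of_real p * cis y) - of_real (exp (- v)))
     \<le> cmod ((of_real (1 - p) * cis x + of_real p * cis y) - of_real (1 - v)) + cmod (of_real (1 - v) - of_real (exp (- v)))"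
    by (metis (no_types) diff_add_cancel add_diff_eq norm_triangle_ineq)
  also have "cmod (of_real (1 - v) - of_real (exp (- v))) = \<bar>exp (- v) - (1 - v)\<bar>"
    by (metis abs_minus_commute norm_of_real of_real_diff)
  finally have "cmod ((of_real (1 - p) * cis x + of_real p * cis y) - of_real (exp (- v))) \<le> p * \<bar>u\<bar> ^ 3 / 3 + p * \<bar>u\<bar> ^ 3 / 2"
    using A B by linarith
  also have "\<dots> \<le> p * \<bar>u\<bar> ^ 3" using p by simp
  finally show ?thesis unfolding e v_def .
qed

lemma sum_power_telescope:
  fixes x :: real
  shows "(1 - x) * (\<Sum>k\<in>{1..n::nat}. x ^ k) = x - x ^ Suc n"
  by (cases "n = 0") (use sum_gp_multiplied[of 1 n x] in auto)

lemma sum_exp_le: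
  assumes "(t::real) > 0"
  shows "(\<Sum>k\<in>{1..n::nat}. exp (- t * real k)) \<le> 1 / t"
proof -
  define x where "x = exp (- t)"
  have x: "0 < x" "x < 1" using assms by (auto simp: x_def)
  have "(\<Sum>k=1..n. exp (- t * real k)) = (\<Sum>k=1..n. x ^ k)"
    by (simp add: x_def exp_of_nat_mult[symmetric] mult.commute)
  also have "\<dots> \<le> x / (1 - x)"
  proof -
    have "(1 - x) * (\<Sum>k=1..n. x ^ k) = x - x ^ Suc n"
      by (rule sum_power_telescope)
    also have "\<dots> \<le> x" using x by simp
    finally show ?thesis using x by (simp add: field_simps)
  qed
  also have "\<dots> \<le> 1 / t"
  proof -
    have "t * x \<le> 1 - x"
      using mult_right_mono[OF exp_ge_add_one_self[of t], of x] x
      by (simp add: x_def exp_minus field_simps)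
    then show ?thesis using x assms by (simp add: field_simps)
  qed
  finally show ?thesis .
qed

text \<open>Half of the exponential absorbs \<open>k ^ j\<close> by \<open>power_le_exp\<close>; the
  other half is summed as a geometric series.\<close>

lemma sum_power_exp_le:
  assumes "(t::real) > 0"
  shows "(\<Sum>k\<in>{1..n::nat}. real k ^ j * exp (- t * real k)) \<le> 2 * (2 * real j) ^ j / t ^ Suc j"
proof -
  have "(\<Sum>k=1..n. real k ^ j * exp (- t * real k))
    \<le> (\<Sum>k=1..n. (2 * real j / t) ^ j * exp (- (t / 2) * real k))"
  proof (rule sum_mono)
    fix k
    have "(t * real k / 2) ^ j \<le> real j ^ j * exp (t * real k / 2)"
      using assms by (intro power_le_exp) auto
    then have "real k ^ j \<le> (2 * real j / t) ^ j * exp (t * real k / 2)"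
      using assms by (simp add: power_divide power_mult_distrib field_simps)
    then have "real k ^ j * exp (- t * real k) \<le> (2 * real j / t) ^ j * exp (t * real k / 2) * exp (- t * real k)"
      by (intro mult_right_mono) auto
    also have "\<dots> = (2 * real j / t) ^ j * exp (- (t / 2) * real k)"
      by (simp add: mult.assoc exp_add[symmetric])
    finally show "real k ^ j * exp (- t * real k) \<le> (2 * real j / t) ^ j * exp (- (t / 2) * real k)" .
  qed
  also have "\<dots> = (2 * real j / t) ^ j * (\<Sum>k=1..n. exp (- (t / 2) * real k))"
    by (simp add: sum_distrib_left)
  also have "\<dots> \<le> (2 * real j / t) ^ j * (1 / (t / 2))"
    using assms by (intro mult_left_mono sum_exp_le) auto
  also have "\<dots> = 2 * (2 * real j) ^ j / t ^ Suc j"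
    by (simp add: power_divide power_mult_distrib mult_ac)
  finally show ?thesis .
qed

text \<open>Since the mean is \<open>n\<close>, the linear terms of the exponents cancel. The constants \<open>16\<close> and
  \<open>432\<close> come from bounding the variance by \<open>32 / t ^ 3\<close> and the third moments by \<open>432 / t ^ 4\<close>.\<close>

lemma charf_gauss:
  assumes t: "0 < t" and ph: "ph \<ge> 0" and mean: "(\<Sum>k=1..n. real k * occ t k) = real n"
  shows "Re (charf n t ph * cis (- (real n * ph))) \<ge> exp (- (16 * (ph\<^sup>2 / t ^ 3))) - 432 * ph ^ 3 / t ^ 4"
proof -
  let ?p = "occ t"
  let ?v = "\<lambda>k. (real k * ph)\<^sup>2 * (?p k * (1 - ?p k)) / 2"
  let ?z = "\<lambda>k. (of_real (1 - ?p k) + of_real (?p k) * cis (real k * ph)) * cis (- (?p k * (real k * ph)))"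
  let ?w = "\<lambda>k. complex_of_real (exp (- ?v k))"
  have vnn: "?v k \<ge> 0" for k using occ_nonneg[of t k] occ_le_1[of t k] by auto
  have "(\<Prod>k=1..n. cis (- (?p k * (real k * ph)))) = cis (- (real n * ph))"
    unfolding mean[symmetric] by (subst cis_sum) (auto simp: sum_distrib_left sum_negf mult_ac)
  then have "(\<Prod>k=1..n. ?z k) = charf n t ph * cis (- (real n * ph))"
    by (simp add: charf_def prod.distrib)
  moreover have "cmod ((\<Prod>k=1..n. ?z k) - (\<Prod>k=1..n. ?w k)) \<le> (\<Sum>k=1..n. cmod (?z k - ?w k))"
  proof (rule norm_prod_diff)
    fix k assume "k \<in> {1..n}"
    have "cmod (of_real (1 - ?p k) + of_real (?p k) * cis (real k * ph))
      \<le> exp (- (?p k * (1 - ?p k) * (1 - cos (real k * ph))))"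
      by (intro two_point_char_norm occ_nonneg occ_le_1)
    also have "\<dots> \<le> 1" using occ_nonneg[of t k] occ_le_1[of t k] by simp
    finally show "cmod (?z k) \<le> 1" by (simp add: norm_mult)
    show "cmod (?w k) \<le> 1" using vnn[of k] by simp
  qed
  moreover have "(\<Sum>k=1..n. cmod (?z k - ?w k)) \<le> 432 * ph ^ 3 / t ^ 4"
  proof -
    have "(\<Sum>k=1..n. cmod (?z k - ?w k)) \<le> (\<Sum>k=1..n. ?p k * \<bar>real k * ph\<bar> ^ 3)"
      by (intro sum_mono two_point_char_gauss occ_nonneg occ_le_1)
    also have "\<dots> \<le> (\<Sum>k=1..n. exp (- t * real k) * \<bar>real k * ph\<bar> ^ 3)"
      by (intro sum_mono mult_right_mono occ_le_exp) auto
    also have "\<dots> = ph ^ 3 * (\<Sum>k=1..n. real k ^ 3 * exp (- t * real k))"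
      using ph by (simp add: sum_distrib_left power_mult_distrib mult_ac)
    also have "\<dots> \<le> ph ^ 3 * (2 * (2 * real 3) ^ 3 / t ^ Suc 3)"
      using ph by (intro mult_left_mono sum_power_exp_le t) auto
    finally show ?thesis by (simp add: mult.commute)
  qed
  moreover have "(\<Prod>k=1..n. ?w k) = of_real (exp (- (\<Sum>k=1..n. ?v k)))"
    by (simp add: exp_sum sum_negf[symmetric] flip: of_real_prod)
  moreover have "(\<Sum>k=1..n. ?v k) \<le> 16 * (ph\<^sup>2 / t ^ 3)"
  proof -
    have "(\<Sum>k=1..n. ?v k) \<le> (\<Sum>k=1..n. (real k * ph)\<^sup>2 * (exp (- t * real k) * 1) / 2)"
      using occ_nonneg occ_le_1 by (intro sum_mono divide_right_mono mult_left_mono mult_mono occ_le_exp) auto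
    also have "\<dots> = ph\<^sup>2 / 2 * (\<Sum>k=1..n. real k ^ 2 * exp (- t * real k))"
      by (simp add: sum_distrib_left power_mult_distrib mult_ac)
    also have "\<dots> \<le> ph\<^sup>2 / 2 * (2 * (2 * real 2) ^ 2 / t ^ Suc 2)"
      by (intro mult_left_mono sum_power_exp_le t) auto
    also have "\<dots> = 16 * (ph\<^sup>2 / t ^ 3)" by (simp add: eval_nat_numeral)
    finally show ?thesis .
  qed
  ultimately have *: "cmod (charf n t ph * cis (- (real n * ph)) - of_real (exp (- (\<Sum>k=1..n. ?v k)))) \<le> 432 * ph ^ 3 / t ^ 4"
    and **: "exp (- (16 * (ph\<^sup>2 / t ^ 3))) \<le> exp (- (\<Sum>k=1..n. ?v k))" by auto
  have "- Re (charf n t ph * cis (- (real n * ph)) - of_real (exp (- (\<Sum>k=1..n. ?v k)))) \<le> 432 * ph ^ 3 / t ^ 4"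
    using order_trans[OF abs_Re_le_cmod *] by (simp only: abs_le_iff)
  then show ?thesis using ** unfolding minus_complex.sel Re_complex_of_real by linarith
qed

text \<open>The Fourier integral is cut at \<open>s = t powr (3/2)\<close>, the reciprocal of the
  standard deviation up to constants, and at a fixed multiple \<open>b = B * s\<close>. Up to
  \<open>s\<close> the Gaussian factor is at least \<open>exp (-16)\<close>; between
  \<open>s\<close> and \<open>b\<close> it is positive, so only the error of
  \<open>charf_gauss\<close> is lost; beyond \<open>b\<close> the decay bound controls everything.
  The two losses are each at most a quarter of the gain.\<close>

lemma law_lower_bound:
  obtains c t0 :: real where "c > 0" "t0 > 0"
    "\<And>n t. 0 < t \<Longrightarrow> t \<le> t0 \<Longrightarrow> 1 / t \<le> real n \<Longrightarrow> (\<Sum>k=1..n. real k * occ t k) = real n \<Longrightarrow>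
       law n t n \<ge> c * (t * sqrt t)"
proof -
  obtain K where K: "K > 0"
    "\<And>n t ph. 0 < t \<Longrightarrow> t \<le> 1 / 4 \<Longrightarrow> 1 / t \<le> real n \<Longrightarrow> 0 \<le> ph \<Longrightarrow> ph \<le> pi \<Longrightarrow>
       cmod (charf n t ph) \<le> K / (1 + ph\<^sup>2 / t ^ 3)\<^sup>2"
    using charf_decay by blast
  define e where "e = exp (-16 :: real)"
  have e: "e > 0" by (simp add: e_def)
  \<comment> \<open>The tail beyond \<open>b\<close> costs \<open>K * s / (3 * B ^ 3)\<close>; this
    choice makes it at most \<open>e / 4 * s\<close>.\<close>
  define B where "B = max 1 (4 * K / (3 * e))"
  have B: "B \<ge> 1" "K / (3 * B ^ 3) \<le> e / 4"
  proof -
    show B1: "B \<ge> 1" by (simp add: B_def)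
    have "4 * K / (3 * e) \<le> B" by (simp add: B_def)
    also have "B \<le> B ^ 3" using B1 power_increasing[of 1 3 B] by simp
    finally show "K / (3 * B ^ 3) \<le> e / 4" using e B1 by (simp add: field_simps)
  qed
  \<comment> \<open>The entry \<open>1 / B\<close> keeps \<open>b\<close> below \<open>pi\<close>.
    The last one, with 1728 = 4 * 432, makes the error of \<open>charf_gauss\<close>, accumulated
    over the interval up to \<open>b\<close>, at most \<open>e / 4 * s\<close>.\<close>
  define t0 where "t0 = min (min (1 / 4) (1 / B)) ((e / (1728 * B ^ 4))\<^sup>2)"
  have t0: "t0 > 0" "t0 \<le> 1 / 4" "t0 \<le> 1 / B" "t0 \<le> (e / (1728 * B ^ 4))\<^sup>2"
    using B e by (auto simp: t0_def)
  show thesis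
  proof
    show "e / (2 * pi) > 0" "t0 > 0" using e t0 by auto
    fix n and t :: real
    assume t: "0 < t" "t \<le> t0" and n: "1 / t \<le> real n" and mean: "(\<Sum>k=1..n. real k * occ t k) = real n"
    define s where "s = t * sqrt t"
    define b where "b = B * s"
    have t4: "t \<le> 1 / 4" using t t0 by simp
    have s: "s > 0" "s\<^sup>2 = t ^ 3" using t by (auto simp: s_def power_mult_distrib power3_eq_cube power2_eq_square)
    have "s \<le> t" using t t4 by (simp add: s_def mult_le_cancel_left1 real_sqrt_le_1_iff)
    have sb: "s \<le> b" using B s by (simp add: b_def)
    have bpi: "b \<le> pi"
    proof -
      have "b \<le> B * t" using B \<open>s \<le> t\<close> by (simp add: b_def)
      also have "\<dots> \<le> B * t0" using t B by (intro mult_left_mono) auto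
      also have "\<dots> \<le> 1" using t0(3) B by (simp add: field_simps)
      finally show ?thesis using pi_gt3 by simp
    qed
    let ?f = "\<lambda>ph. Re (charf n t ph * cis (- (real n * ph)))"
    have f: "(?f has_integral (pi * law n t n)) {0..pi}" by (intro law_fourier) auto
    have int: "?f integrable_on {x..y}" if "0 \<le> x" "y \<le> pi" for x y
    proof -
      have "?f integrable_on {0..pi}" using f by (rule has_integral_integrable)
      then show ?thesis by (rule integrable_on_subinterval) (use that in auto)
    qed
    have split: "pi * law n t n = integral {0..s} ?f + integral {s..b} ?f + integral {b..pi} ?f"
    proof -
      have "pi * law n t n = integral {0..pi} ?f" using f by (simp add: integral_unique)
      also have "\<dots> = integral {0..b} ?f + integral {b..pi} ?f"
        using s sb bpi int by (intro Henstock_Kurzweil_Integration.integral_combine[symmetric]) auto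
      also have "integral {0..b} ?f = integral {0..s} ?f + integral {s..b} ?f"
        using s sb bpi int by (intro Henstock_Kurzweil_Integration.integral_combine[symmetric]) auto
      finally show ?thesis .
    qed
    define E where "E = 432 * b ^ 3 / t ^ 4"
    have g: "?f ph \<ge> exp (- (16 * (ph\<^sup>2 / t ^ 3))) - E" if "0 \<le> ph" "ph \<le> b" for ph
    proof -
      have "432 * ph ^ 3 / t ^ 4 \<le> E" unfolding E_def
        using that t by (intro divide_right_mono mult_left_mono power_mono) auto
      then show ?thesis using charf_gauss[OF t(1) that(1) mean] by linarith
    qed
    have E0: "E \<ge> 0" using t s sb by (simp add: E_def)
    have 1: "integral {0..s} ?f \<ge> (e - E) * s"
    proof -
      have c: "((\<lambda>_. e - E) has_integral (e - E) * s) {0..s}"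
        using has_integral_const_real[of "e - E" 0 s] s by (simp add: mult.commute)
      show ?thesis unfolding integral_unique[OF c, symmetric]
      proof (rule integral_le)
        fix ph assume ph: "ph \<in> {0..s}"
        have "ph\<^sup>2 \<le> s\<^sup>2" using ph by (intro power_mono) auto
        then have "ph\<^sup>2 / t ^ 3 \<le> 1" using s t by (simp add: field_simps)
        then have "e \<le> exp (- (16 * (ph\<^sup>2 / t ^ 3)))" by (simp add: e_def)
        then show "e - E \<le> ?f ph" using g[of ph] ph sb by auto
      qed (use has_integral_integrable[OF c] int[of 0 s] s sb bpi in auto)
    qed
    have 2: "integral {s..b} ?f \<ge> (- E) * (b - s)"
    proof -
      have c: "((\<lambda>_. - E) has_integral (- E) * (b - s)) {s..b}"
        using has_integral_const_real[of "- E" s b] sb by (simp add: mult.commute)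
      show ?thesis unfolding integral_unique[OF c, symmetric]
      proof (rule integral_le)
        fix ph assume ph: "ph \<in> {s..b}"
        then have "exp (- (16 * (ph\<^sup>2 / t ^ 3))) - E \<le> ?f ph" using s by (intro g) auto
        then show "- E \<le> ?f ph" using exp_gt_zero[of "- (16 * (ph\<^sup>2 / t ^ 3))"] by linarith
      qed (use has_integral_integrable[OF c] int[of s b] s sb bpi in auto)
    qed
    have 3: "integral {b..pi} ?f \<ge> - (K * s / (3 * B ^ 3))"
    proof -
      have b0: "b > 0" using s sb by simp
      have h: "((\<lambda>ph. K * t ^ 6 * (1 / ph ^ 4)) has_integral (K * t ^ 6 * (1 / (3 * b ^ 3) - 1 / (3 * pi ^ 3)))) {b..pi}"
        using b0 bpi by (intro has_integral_mult_right has_integral_inverse_fourth) auto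
      have "norm (integral {b..pi} ?f) \<le> integral {b..pi} (\<lambda>ph. K * t ^ 6 * (1 / ph ^ 4))"
      proof (rule integral_norm_bound_integral)
        fix ph assume ph: "ph \<in> {b..pi}"
        then have th: "ph > 0" using b0 by auto
        have "norm (?f ph) \<le> cmod (charf n t ph)"
          by (metis abs_Re_le_cmod mult.right_neutral norm_cis norm_mult real_norm_def)
        also have "\<dots> \<le> K / (1 + ph\<^sup>2 / t ^ 3)\<^sup>2" using ph th t t4 n by (intro K(2)) auto
        also have "\<dots> \<le> K / (ph\<^sup>2 / t ^ 3)\<^sup>2"
          using K(1) th t by (intro divide_left_mono power_mono mult_pos_pos zero_less_power add_pos_pos) auto
        also have "\<dots> = K * t ^ 6 * (1 / ph ^ 4)" by (simp add: power_divide flip: power_mult)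
        finally show "norm (?f ph) \<le> K * t ^ 6 * (1 / ph ^ 4)" .
      qed (use has_integral_integrable[OF h] int[of b pi] b0 bpi in auto)
      also have "\<dots> \<le> K * t ^ 6 * (1 / (3 * b ^ 3))"
        unfolding integral_unique[OF h] using K(1) t by (intro mult_left_mono) auto
      also have "\<dots> = K * s / (3 * B ^ 3)"
      proof -
        have "t ^ 6 = (s\<^sup>2)\<^sup>2" unfolding s(2) by (simp flip: power_mult)
        then have "K * t ^ 6 * (1 / (3 * b ^ 3)) = K * (s ^ 4 / s ^ 3) / (3 * B ^ 3)"
          by (simp add: b_def power_mult_distrib flip: power_mult)
        also have "s ^ 4 / s ^ 3 = s" using s(1) by (simp add: power_numeral_reduce)
        finally show ?thesis .
      qed
      finally show ?thesis by (simp add: abs_le_iff)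
    qed
    have "E * b \<le> e / 4 * s"
    proof -
      have "b ^ 4 = B ^ 4 * (s\<^sup>2 * s * s)" by (simp add: b_def power_mult_distrib power_numeral_reduce)
      also have "s\<^sup>2 * s * s = t ^ 4 * (sqrt t * s)"
        unfolding s(2) by (simp add: s_def power_numeral_reduce)
      finally have "E * b = 432 * B ^ 4 * sqrt t * s"
        using t by (simp add: E_def power_numeral_reduce field_simps)
      moreover have "sqrt t \<le> e / (1728 * B ^ 4)"
        using t t0 e B by (intro real_le_lsqrt) auto
      then have "432 * B ^ 4 * sqrt t \<le> e / 4" using B by (simp add: field_simps)
      ultimately show ?thesis using s by (metis less_eq_real_def mult_right_mono)
    qed
    moreover have "K * s / (3 * B ^ 3) \<le> e / 4 * s"
      using mult_right_mono[OF B(2), of s] s by simp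
    moreover have "(e - E) * s + (- E) * (b - s) = e * s - E * b" by (simp add: algebra_simps)
    ultimately have "pi * law n t n \<ge> e * s - e / 4 * s - e / 4 * s"
      using split 1 2 3 by linarith
    then show "law n t n \<ge> e / (2 * pi) * (t * sqrt t)"
      by (simp add: s_def field_simps)
  qed
qed

section \<open>Ratios of partition numbers\<close>

text \<open>The count at \<open>n - m\<close>, relative to the number of distinct partitions of \<open>n\<close>; the case
  distinction avoids truncated subtraction.\<close>

definition count_ratio :: "(nat \<Rightarrow> nat) \<Rightarrow> nat \<Rightarrow> nat \<Rightarrow> real" where
  "count_ratio F n m = (if m \<le> n then real (F (n - m)) / real (dcount {} n) else 0)"

text \<open>Intermediate value theorem for the mean as a function of \<open>t\<close>: at 0 each
  part has probability 1/2 and the mean exceeds \<open>n\<close>; at \<open>2 / sqrt n\<close> it is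
  at most \<open>4 / t^2 = n\<close>. The lower bound for \<open>t\<close> is a separate
  argument.\<close>

lemma exists_saddle:
  assumes n: "n \<ge> 36"
  obtains t where "t \<ge> 1 / (6 * sqrt n)" "t \<le> 2 / sqrt n" "(\<Sum>k=1..n. real k * occ t k) = real n"
proof -
  define g where "g t = (\<Sum>k=1..n. real k * occ t k)" for t
  have n0: "real n > 0" using n by simp
  have g0: "g 0 \<ge> real n"
  proof -
    have "g 0 = (\<Sum>k=1..n. real k) / 2" by (simp add: g_def occ_def sum_divide_distrib)
    also have "(\<Sum>k=1..n. real k) = real n * (real n + 1) / 2"
      by (induction n) (auto simp: field_simps)
    finally have "g 0 = real n * ((real n + 1) / 4)" by simp
    moreover have "real n * 1 \<le> real n * ((real n + 1) / 4)"
      using n by (intro mult_left_mono) auto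
    ultimately show ?thesis by linarith
  qed
  have g1: "g (2 / sqrt n) \<le> real n"
  proof -
    have "g (2 / sqrt n) \<le> (\<Sum>k=1..n. real k ^ 1 * exp (- (2 / sqrt n) * real k))"
      unfolding g_def power_one_right by (intro sum_mono mult_left_mono occ_le_exp) auto
    also have "\<dots> \<le> 2 * (2 * real 1) ^ 1 / (2 / sqrt n) ^ Suc 1"
      using n0 by (intro sum_power_exp_le) auto
    also have "\<dots> = real n" using n0 by (simp add: power2_eq_square[symmetric] power_divide)
    finally show ?thesis .
  qed
  have cont: "isCont g t" for t
    unfolding g_def occ_def by (intro continuous_intros) (use one_plus_exp_pos in \<open>auto simp: less_imp_neq[symmetric]\<close>)
  have "\<exists>t. 0 \<le> t \<and> t \<le> 2 / sqrt n \<and> g t = real n"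
    by (rule IVT2) (use g0 g1 cont in auto)
  then obtain t where t: "0 \<le> t" "t \<le> 2 / sqrt n" "g t = real n" by blast
  \<comment> \<open>If \<open>t * K \<le> 1\<close>, all parts up to \<open>K\<close> would have
    probability at least 1/12, forcing a mean of at least
    \<open>K * (K + 1) / 24 \<ge> 25 * n / 24\<close>. For \<open>n \<ge> 36\<close>, rounding up
    keeps \<open>K\<close> below \<open>6 * sqrt n\<close>, hence below \<open>n\<close>.\<close>
  define K where "K = nat \<lceil>5 * sqrt n\<rceil>"
  have sq6: "sqrt n \<ge> 6" using n real_sqrt_le_mono[of 36 "real n"] by simp
  have K: "real K \<ge> 5 * sqrt n" "real K \<le> 6 * sqrt n"
    using sq6 unfolding K_def by linarith+
  have "6 * sqrt n \<le> sqrt n * sqrt n" using sq6 by (intro mult_right_mono) auto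
  then have Kn: "K \<le> n" using K n0 by simp
  have "t * real K > 1"
  proof (rule ccontr)
    assume "\<not> t * real K > 1"
    then have tK: "t * real K \<le> 1" by simp
    have "real n < real K * (real K + 1) / 24"
    proof -
      have "25 * real n = (5 * sqrt n) * (5 * sqrt n)" using n0 by simp
      also have "\<dots> \<le> real K * (real K + 1)" using K sq6 by (intro mult_mono) auto
      finally show ?thesis using n0 by simp
    qed
    also have "\<dots> = (\<Sum>k=1..K. real k * (1 / 12))"
      by (induction K) (auto simp: field_simps)
    also have "\<dots> \<le> (\<Sum>k=1..K. real k * occ t k)"
    proof (intro sum_mono mult_left_mono)
      fix k assume "k \<in> {1..K}"
      then have "t * real k \<le> t * real K" using t by (intro mult_left_mono) auto
      then have "1 / 12 \<le> occ t k * (1 - occ t k)" using t tK by (intro occ_var_ge) auto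
      also have "\<dots> \<le> occ t k * 1" using occ_nonneg[of t k] by (intro mult_left_mono) auto
      finally show "1 / 12 \<le> occ t k" by simp
    qed auto
    also have "\<dots> \<le> g t" unfolding g_def
      using Kn occ_nonneg by (intro sum_mono2) auto
    finally show False using t by simp
  qed
  also have "t * real K \<le> t * (6 * sqrt n)" using t K by (intro mult_left_mono) auto
  finally have "t \<ge> 1 / (6 * sqrt n)" using n0 by (simp add: field_simps)
  then show thesis using that t by (simp add: g_def)
qed

definition saddle :: "nat \<Rightarrow> real" where
  "saddle n = (SOME t. t \<ge> 1 / (6 * sqrt n) \<and> t \<le> 2 / sqrt n \<and> (\<Sum>k=1..n. real k * occ t k) = real n)"

lemma saddle:
  assumes "n \<ge> 36"
  shows "saddle n \<ge> 1 / (6 * sqrt n)" "saddle n \<le> 2 / sqrt n" "(\<Sum>k=1..n. real k * occ (saddle n) k) = real n"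
  using someI_ex[of "\<lambda>t. t \<ge> 1 / (6 * sqrt n) \<and> t \<le> 2 / sqrt n \<and> (\<Sum>k=1..n. real k * occ t k) = real n"]
    exists_saddle[OF assms] unfolding saddle_def by blast+

lemma saddle_pos: "n \<ge> 36 \<Longrightarrow> saddle n > 0"
  by (rule less_le_trans[OF _ saddle(1)]) auto

lemma saddle_pos_ev: "\<forall>\<^sub>F n in sequentially. saddle n > 0"
  using eventually_ge_at_top[of 36] by eventually_elim (rule saddle_pos)

lemma saddle_tendsto: "saddle \<longlonglongrightarrow> 0"
proof (rule tendsto_sandwich[of "\<lambda>_. 0" _ _ "\<lambda>n. 2 / sqrt (real n)"])
  show "\<forall>\<^sub>F n in sequentially. 0 \<le> saddle n" using saddle_pos_ev by eventually_elim simp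
  show "\<forall>\<^sub>F n in sequentially. saddle n \<le> 2 / sqrt (real n)"
    using eventually_ge_at_top[of 36] by eventually_elim (rule saddle)
  show "(\<lambda>n. 2 / sqrt (real n)) \<longlonglongrightarrow> 0" 
    by (intro tendsto_divide_0[OF tendsto_const] filterlim_at_top_imp_at_infinity
          filterlim_compose[OF sqrt_at_top filterlim_real_sequentially])
qed auto

lemma inverse_saddle_le:
  assumes "n \<ge> 36"
  shows "1 / saddle n \<le> real n" "1 / (36 * (saddle n)\<^sup>2) \<le> real n"
proof -
  have sq6: "sqrt n \<ge> 6" using assms real_sqrt_le_mono[of 36 "real n"] by simp
  have p: "saddle n > 0" by (rule saddle_pos[OF assms])
  have a: "1 / saddle n \<le> 6 * sqrt n"
  proof -
    have "1 / saddle n \<le> 1 / (1 / (6 * sqrt n))"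
      using saddle(1)[OF assms] p assms by (intro divide_left_mono mult_pos_pos) auto
    then show ?thesis by simp
  qed
  also have "6 * sqrt n \<le> sqrt n * sqrt n" using sq6 by (intro mult_right_mono) auto
  finally show "1 / saddle n \<le> real n" by simp
  have "(1 / saddle n)\<^sup>2 \<le> (6 * sqrt n)\<^sup>2" using a p by (intro power_mono) auto
  then have "1 / (saddle n)\<^sup>2 \<le> 36 * real n" by (simp add: power_mult_distrib power_divide)
  then show "1 / (36 * (saddle n)\<^sup>2) \<le> real n" using p by (simp add: field_simps)
qed

abbreviation ratio_estimate :: "real \<Rightarrow> bool" where
  "ratio_estimate C \<equiv> \<forall>\<^sub>F n in sequentially. \<forall>m. \<bar>count_ratio (dcount {}) n m - exp (- (saddle n * real m))\<bar>
        \<le> C * sqrt (saddle n) * exp (- (saddle n * real m) / 2)"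

text \<open>For \<open>m \<le> n\<close> the count ratio is exactly \<open>exp (- t m)\<close> times
  a quotient of two values of \<open>law\<close>. The normalisation cancels there, and the quotient
  differs from 1 by at most the Lipschitz bound over the lower bound at \<open>n\<close>.\<close>

theorem dcount_ratio:
  obtains C where "C > 0"
    "ratio_estimate C"
proof -
  obtain C where C: "C > 0"
    "\<And>n t l l'. 0 < t \<Longrightarrow> t \<le> 1 / 4 \<Longrightarrow> 1 / t \<le> real n \<Longrightarrow> l \<le> n \<Longrightarrow> l' \<le> n \<Longrightarrow>
       \<bar>law n t l - law n t l'\<bar> \<le> C * \<bar>real l - real l'\<bar> * t ^ 3"
    using law_lipschitz by blast
  obtain c t0 where c: "c > 0" "t0 > 0"
    "\<And>n t. 0 < t \<Longrightarrow> t \<le> t0 \<Longrightarrow> 1 / t \<le> real n \<Longrightarrow> (\<Sum>k=1..n. real k * occ t k) = real n \<Longrightarrow>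
       law n t n \<ge> c * (t * sqrt t)"
    using law_lower_bound by blast
  \<comment> \<open>The first entry comes from \<open>t * m \<le> 2 * exp (t * m / 2)\<close>; the
    second, 72 = 2 * 36, settles the case \<open>m > n\<close>.\<close>
  define D where "D = max (2 * C / c) 72"
  show thesis
  proof
    show "D > 0" by (simp add: D_def)
    have "\<forall>\<^sub>F n in sequentially. saddle n < min (1 / 4) t0"
      using c by (intro order_tendstoD(2)[OF saddle_tendsto]) auto
    then show "ratio_estimate D"
      using eventually_ge_at_top[of 36]
    proof eventually_elim
      case (elim n)
      define t where "t = saddle n"
      have t: "t > 0" "t \<le> 1 / 4" "t \<le> t0" "1 / t \<le> real n" "1 / (36 * t\<^sup>2) \<le> real n"
        "(\<Sum>k=1..n. real k * occ t k) = real n"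
        using elim saddle_pos[of n] saddle(3)[of n] inverse_saddle_le[of n] by (auto simp: t_def)
      have P: "law n t n \<ge> c * (t * sqrt t)" by (intro c t)
      have P0: "law n t n > 0" by (rule less_le_trans[OF _ P]) (use c t in auto)
      have "\<bar>count_ratio (dcount {}) n m - exp (- (t * real m))\<bar> \<le> D * sqrt t * exp (- (t * real m) / 2)" for m
      proof (cases "m \<le> n")
        case True
        have z: "zpart n t > 0" by (rule zpart_pos)
        have r: "count_ratio (dcount {}) n m = law n t (n - m) / law n t n * exp (- (t * real m))"
        proof -
          have "exp (- t * real (n - m)) * exp (- (t * real m)) = exp (- t * real n)"
            using True by (simp add: exp_add[symmetric] of_nat_diff algebra_simps)
          then have "dcount {} (n - m) * exp (- t * real (n - m)) * exp (- (t * real m)) = dcount {} (n - m) * exp (- t * real n)"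
            by simp
          then show ?thesis using z dcount_pos[of n] True
            by (auto simp: count_ratio_def law_def field_simps)
        qed
        have "\<bar>law n t (n - m) - law n t n\<bar> \<le> C * \<bar>real (n - m) - real n\<bar> * t ^ 3"
          by (intro C t) auto
        also have "\<bar>real (n - m) - real n\<bar> = real m" using True by (simp add: of_nat_diff)
        finally have L: "\<bar>law n t (n - m) - law n t n\<bar> \<le> C * real m * t ^ 3" .
        have "\<bar>law n t (n - m) / law n t n - 1\<bar> = \<bar>law n t (n - m) - law n t n\<bar> / law n t n"
          using P0 by (simp add: field_simps abs_divide)
        also have "\<dots> \<le> (C * real m * t ^ 3) / (c * (t * sqrt t))"
          using L P c t C by (intro frac_le) auto
        also have "\<dots> = C / c * (t * real m) * sqrt t"
        proof -
          have "t ^ 3 = (t * sqrt t) * (t * sqrt t)" using t by (simp add: power3_eq_cube mult_ac)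
          then have "t ^ 3 / (t * sqrt t) = t * sqrt t" using t by simp
          moreover have "(C * real m * t ^ 3) / (c * (t * sqrt t)) = C / c * real m * (t ^ 3 / (t * sqrt t))"
            by simp
          ultimately show ?thesis by (simp only: mult_ac)
        qed
        also have "\<dots> \<le> C / c * (2 * exp (t * real m / 2)) * sqrt t"
          using power_le_exp[of "t * real m / 2" 1] t C c by (intro mult_right_mono mult_left_mono) auto
        also have "\<dots> = 2 * C / c * sqrt t * exp (t * real m / 2)" by simp
        finally have A: "\<bar>law n t (n - m) / law n t n - 1\<bar> \<le> 2 * C / c * sqrt t * exp (t * real m / 2)" .
        have "\<bar>count_ratio (dcount {}) n m - exp (- (t * real m))\<bar> = \<bar>law n t (n - m) / law n t n - 1\<bar> * exp (- (t * real m))"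
        proof -
          have "count_ratio (dcount {}) n m - exp (- (t * real m)) = (law n t (n - m) / law n t n - 1) * exp (- (t * real m))"
            by (simp add: r left_diff_distrib)
          then show ?thesis by (simp add: abs_mult)
        qed
        also have "\<dots> \<le> 2 * C / c * sqrt t * exp (t * real m / 2) * exp (- (t * real m))"
          by (intro mult_right_mono A) auto
        also have "\<dots> = 2 * C / c * sqrt t * exp (- (t * real m) / 2)"
          by (simp add: mult.assoc exp_add[symmetric])
        also have "\<dots> \<le> D * sqrt t * exp (- (t * real m) / 2)"
          using t by (intro mult_right_mono) (auto simp: D_def)
        finally show ?thesis .
      next
        case False
        \<comment> \<open>For \<open>m > n\<close> the count is 0, and the claim is that the
          exponential itself is below the error. This holds because \<open>n\<close> is at least of
          order \<open>1 / t^2\<close>, so that \<open>exp (- t m / 2)\<close> is of order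
          \<open>t\<close>.\<close>
        have tm: "t * real m \<ge> 1 / (36 * t)"
        proof -
          have "1 / (36 * t) = t * (1 / (36 * t\<^sup>2))" using t by (simp add: power2_eq_square)
          also have "\<dots> \<le> t * real m" using False t by (intro mult_left_mono) auto
          finally show ?thesis .
        qed
        have tm0: "t * real m > 0" by (rule less_le_trans[OF _ tm]) (use t in auto)
        have "t * real m / 2 \<le> exp (t * real m / 2)"
          using exp_ge_add_one_self[of "t * real m / 2"] by linarith
        then have "exp (- (t * real m) / 2) \<le> 2 / (t * real m)"
          using tm0 by (simp add: exp_minus field_simps)
        also have "\<dots> \<le> 2 / (1 / (36 * t))" using tm t by (intro divide_left_mono mult_pos_pos[OF tm0]) auto
        also have "\<dots> = 72 * (sqrt t * sqrt t)" using t by simp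
        also have "\<dots> \<le> D * (sqrt t * 1)" using t by (intro mult_mono mult_left_mono) (auto simp: D_def real_sqrt_le_1_iff)
        finally have *: "exp (- (t * real m) / 2) \<le> D * sqrt t" by simp
        have "\<bar>count_ratio (dcount {}) n m - exp (- (t * real m))\<bar> = exp (- (t * real m) / 2) * exp (- (t * real m) / 2)"
          using False by (simp add: count_ratio_def exp_add[symmetric])
        also have "\<dots> \<le> D * sqrt t * exp (- (t * real m) / 2)" by (intro mult_right_mono *) auto
        finally show ?thesis .
      qed
      then show ?case by (simp add: t_def)
    qed
  qed
qed

section \<open>Prescribed multiplicities\<close>

text \<open>Meant for \<open>0 \<notin> A\<close>. Otherwise zeros could be added freely, and
  \<open>card\<close> would return 0 for the infinite set.\<close>

definition mcount :: "nat set \<Rightarrow> nat \<Rightarrow> nat" where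
  "mcount A N = card {M. set_mset M \<subseteq> A \<and> \<Sum>\<^sub># M = N}"

lemma size_le_sum_mset:
  fixes M :: "nat multiset"
  shows "0 \<notin># M \<Longrightarrow> size M \<le> \<Sum>\<^sub># M"
  by (induction M) auto

lemma finite_multisets_sum:
  assumes "0 \<notin> (A :: nat set)"
  shows "finite {M. set_mset M \<subseteq> A \<and> \<Sum>\<^sub># M = N}"
proof (rule finite_subset)
  show "{M. set_mset M \<subseteq> A \<and> \<Sum>\<^sub># M = N} \<subseteq> mset ` {xs. set xs \<subseteq> {..N} \<and> length xs \<le> N}"
  proof
    fix M assume M: "M \<in> {M. set_mset M \<subseteq> A \<and> \<Sum>\<^sub># M = N}"
    obtain xs where xs: "mset xs = M" using ex_mset by blast
    have "set xs \<subseteq> {..N}"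
    proof
      fix x assume "x \<in> set xs"
      then have "x \<in># M" using xs by auto
      then show "x \<in> {..N}" using M sum_mset.remove[of x M] by auto
    qed
    moreover have "0 \<notin># M" using M assms by auto
    then have "length xs \<le> N" using M size_le_sum_mset[of M] xs by auto
    ultimately show "M \<in> mset ` {xs. set xs \<subseteq> {..N} \<and> length xs \<le> N}" using xs by auto
  qed
  show "finite (mset ` {xs. set xs \<subseteq> {..N} \<and> length xs \<le> N})"
    by (intro finite_imageI finite_lists_length_le) auto
qed

text \<open>\<open>T \<union> R\<close> is a window in which exactly the elements of
  \<open>T\<close> are present. Deleting them is a bijection onto the sets that avoid the whole
  window.\<close>

lemma card_sets_fixed_part:
  fixes T R :: "nat set"
  assumes T: "finite T" "0 \<notin> T" "T \<inter> R = {}"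
  shows "card {S. finite S \<and> 0 \<notin> S \<and> \<Sum>S = N \<and> S \<inter> (T \<union> R) = T} =
     (if \<Sum>T \<le> N then dcount (T \<union> R) (N - \<Sum>T) else 0)"
    (is "card ?B = _")
proof (cases "\<Sum>T \<le> N")
  case True
  let ?A = "avoiding_sets (T \<union> R) (N - \<Sum>T)"
  have "bij_betw (\<lambda>S. S \<union> T) ?A
          ?B"
  proof (rule bij_betwI[where g = "\<lambda>S. S - T"])
    show "(\<lambda>S. S \<union> T) \<in> ?A \<rightarrow>
          ?B"
    proof safe
      fix S :: "nat set" assume S: "finite S" "0 \<notin> S" "S \<inter> (T \<union> R) = {}" "\<Sum>S = N - \<Sum>T"
      then have "\<Sum>(S \<union> T) = \<Sum>S + \<Sum>T" using T by (intro sum.union_disjoint) auto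
      then show "\<Sum>(S \<union> T) = N" using S True by simp
    qed (use T in auto)
    show "(\<lambda>S. S - T) \<in> ?B \<rightarrow>
          ?A"
    proof (intro funcsetI CollectI conjI)
      fix S assume S: "S \<in> ?B"
      then have "T \<subseteq> S" by auto
      then have "\<Sum>(S - T) = \<Sum>S - \<Sum>T" using S T by (intro sum_diff_nat) auto
      then show "\<Sum>(S - T) = N - \<Sum>T" using S by simp
      show "(S - T) \<inter> (T \<union> R) = {}" using S by blast
    qed (use T in auto)
  qed (use T in auto)
  then show ?thesis using True by (simp add: dcount_def bij_betw_same_card)
next
  case False
  have "?B = {}"
  proof safe
    fix S :: "nat set" assume S: "finite S" "N = \<Sum>S" "S \<inter> (T \<union> R) = T"
    then have "\<Sum>T \<le> \<Sum>S" by (intro sum_mono2) auto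
    then show "S \<in> {}" using False S by simp
  qed
  then show ?thesis using False by (simp only: card.empty if_False)
qed

text \<open>Case distinction on whether \<open>b\<close> is a part; if it is, removing it leaves a
  set in which \<open>b\<close> is forbidden as well.\<close>

lemma dcount_insert:
  assumes "b \<notin> R" "b > 0"
  shows "dcount R N = dcount (insert b R) N + (if b \<le> N then dcount (insert b R) (N - b) else 0)"
proof -
  let ?D = "avoiding_sets R N"
  let ?A = "avoiding_sets (insert b R) N"
  let ?B = "{S. finite S \<and> 0 \<notin> S \<and> \<Sum>S = N \<and> S \<inter> ({b} \<union> R) = {b}}"
  have "(S \<inter> ({b} \<union> R) = {b}) = (b \<in> S \<and> S \<inter> R = {})" for S
    using assms(1) by (auto simp: set_eq_iff)
  moreover have "(S \<inter> insert b R = {}) = (b \<notin> S \<and> S \<inter> R = {})" for S by blast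
  ultimately have eq: "?D = ?A \<union> ?B" by (simp only:) blast
  have "card ?D = card ?A + card ?B"
    unfolding eq
  proof (rule card_Un_disjoint)
    show "finite ?A" by (rule finite_dcount_sets)
    show "finite ?B" by (rule finite_subset[OF _ finite_dcount_sets[of "{}" N]]) auto
  qed auto
  then show ?thesis
    using card_sets_fixed_part[of "{b}" R N] assms by (simp add: dcount_def)
qed

text \<open>Subtracting \<open>K\<close> removes every copy of the elements of \<open>R\<close>,
  whose multiplicities are exact, but may leave further copies of the others. The mixture is needed
  because a row of length \<open>a\<close> with \<open>r\<close> equal rows below it only forces
  more than \<open>r\<close> copies of \<open>a\<close>, while the smaller parts of its window have
  prescribed multiplicities.\<close>

lemma card_multisets_fixed_part:
  fixes K :: "nat multiset"
  assumes K: "set_mset K \<subseteq> A"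
  shows "card {M. set_mset M \<subseteq> A \<and> \<Sum>\<^sub># M = N \<and> K \<subseteq># M \<and> (\<forall>b\<in>R. count M b = count K b)} =
     (if \<Sum>\<^sub># K \<le> N then mcount (A - R) (N - \<Sum>\<^sub># K) else 0)"
    (is "card ?B = _")
proof (cases "\<Sum>\<^sub># K \<le> N")
  case True
  let ?A = "{M. set_mset M \<subseteq> A - R \<and> \<Sum>\<^sub># M = N - \<Sum>\<^sub># K}"
  have "bij_betw (\<lambda>M. M + K) ?A
     ?B"
  proof (rule bij_betwI[where g = "\<lambda>M. M - K"])
    show "(\<lambda>M. M + K) \<in> ?A \<rightarrow>
     ?B"
      using True K by (auto simp: count_eq_zero_iff)
    show "(\<lambda>M. M - K) \<in> ?B
      \<rightarrow> ?A"
    proof (intro funcsetI CollectI conjI)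
      fix M assume M: "M \<in> ?B"
      then obtain L where L: "M = K + L" by (auto simp: subset_mset.le_iff_add)
      show "\<Sum>\<^sub># (M - K) = N - \<Sum>\<^sub># K" using M by (auto simp: L)
      show "set_mset (M - K) \<subseteq> A - R"
      proof
        fix x assume "x \<in># M - K"
        then have x: "x \<in># L" by (simp add: L)
        have "x \<notin> R"
        proof
          assume "x \<in> R"
          then have "count M x = count K x" using M by auto
          then have "count L x = 0" by (simp add: L)
          then show False using x by (simp add: count_eq_zero_iff)
        qed
        then show "x \<in> A - R" using M x by (auto simp: L)
      qed
    qed
  qed auto
  then show ?thesis using True by (simp add: mcount_def bij_betw_same_card)
next
  case False
  have "?B = {}"
    using False by (auto simp: subset_mset.le_iff_add)
  then show ?thesis using False by (simp only: card.empty if_False)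
qed

text \<open>Either \<open>b\<close> does not occur, or one copy of it is removed. Unlike in
  \<open>dcount_insert\<close>, the part remains admissible after the removal, so the excluded count
  is an explicit difference.\<close>

lemma mcount_remove:
  assumes "b \<in> A" "0 \<notin> A"
  shows "mcount A N = mcount (A - {b}) N + (if b \<le> N then mcount A (N - b) else 0)"
proof -
  let ?D = "{M. set_mset M \<subseteq> A \<and> \<Sum>\<^sub># M = N}"
  let ?A = "{M. set_mset M \<subseteq> A - {b} \<and> \<Sum>\<^sub># M = N}"
  let ?B = "{M. set_mset M \<subseteq> A \<and> \<Sum>\<^sub># M = N \<and> {#b#} \<subseteq># M \<and> (\<forall>x\<in>{}. count M x = count {#b#} x)}"
  have eq: "?D = ?A \<union> ?B" using assms by auto
  have "card ?D = card ?A + card ?B"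
    unfolding eq
  proof (rule card_Un_disjoint)
    show "finite ?A" using assms by (intro finite_multisets_sum) auto
    show "finite ?B" by (rule finite_subset[OF _ finite_multisets_sum[OF assms(2), of N]]) auto
  qed auto
  then show ?thesis
    using card_multisets_fixed_part[of "{#b#}" A N "{}"] assms by (simp add: mcount_def)
qed

section \<open>Euler's theorem on odd and distinct parts, by formal power series\<close>

lemma fps_mcount:
  assumes "finite A" "0 \<notin> A"
  shows "Abs_fps (\<lambda>N. int (mcount A N)) * (\<Prod>b\<in>A. 1 - fps_X ^ b) = 1"
  using assms
proof (induction A rule: finite_induct)
  case empty
  have "{M. set_mset M \<subseteq> {} \<and> \<Sum>\<^sub># M = N} = (if N = 0 then {{#}} else {})" for N :: nat by auto
  then have "mcount {} N = (if N = 0 then 1 else 0)" for N by (simp add: mcount_def)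
  then show ?case by (simp add: fps_eq_iff)
next
  case (insert b A)
  have ins: "insert b A - {b} = A" using insert by auto
  let ?F = "Abs_fps (\<lambda>N. int (mcount (insert b A) N))"
  have "?F = Abs_fps (\<lambda>N. int (mcount A N)) + fps_X ^ b * ?F"
  proof (rule fps_ext)
    fix N
    show "fps_nth ?F N = fps_nth (Abs_fps (\<lambda>N. int (mcount A N)) + fps_X ^ b * ?F) N"
      using mcount_remove[of b "insert b A" N] insert.prems by (simp add: fps_X_power_mult_nth ins)
  qed
  then have "?F * (1 - fps_X ^ b) = Abs_fps (\<lambda>N. int (mcount A N))" by (simp add: algebra_simps)
  then show ?case using insert by (simp add: mult.assoc[symmetric])
qed

text \<open>Avoiding \<open>- A\<close> means that all parts lie in \<open>A\<close>.\<close>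

lemma fps_dcount:
  assumes "finite A" "0 \<notin> A"
  shows "Abs_fps (\<lambda>N. int (dcount (- A) N)) = (\<Prod>b\<in>A. 1 + fps_X ^ b)"
  using assms
proof (induction A rule: finite_induct)
  case empty
  have "avoiding_sets (- {}) N = (if N = 0 then {{}} else {})" for N :: nat by auto
  then have "dcount (- {}) N = (if N = 0 then 1 else 0)" for N unfolding dcount_def by simp
  then show ?case by (simp add: fps_eq_iff)
next
  case (insert b A)
  have ins: "insert b (- insert b A) = - A" using insert by auto
  have "Abs_fps (\<lambda>N. int (dcount (- insert b A) N)) = (1 + fps_X ^ b) * Abs_fps (\<lambda>N. int (dcount (- A) N))"
  proof (rule fps_ext)
    fix N
    show "fps_nth (Abs_fps (\<lambda>N. int (dcount (- insert b A) N))) N = fps_nth ((1 + fps_X ^ b) * Abs_fps (\<lambda>N. int (dcount (- A) N))) N"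
      using dcount_insert[of b "- insert b A" N] insert.prems unfolding ins
      by (auto simp: fps_X_power_mult_nth distrib_right)
  qed
  then show ?case using insert by simp
qed

text \<open>Factors with exponents above \<open>n\<close> leave the coefficients up to
  \<open>n\<close> unchanged; this makes the finite truncation of Euler's product identity exact at
  \<open>n\<close>.\<close>

lemma fps_prod_one_minus_high:
  assumes "finite H" "\<And>c. c \<in> H \<Longrightarrow> c > n"
  shows "\<exists>Y. (\<Prod>c\<in>H. 1 - fps_X ^ c) = 1 + fps_X ^ Suc n * (Y :: int fps)"
  using assms
proof (induction H rule: finite_induct)
  case empty
  then show ?case by (intro exI[of _ 0]) simp
next
  case (insert c H)
  then obtain Y :: "int fps" where Y: "(\<Prod>c\<in>H. 1 - fps_X ^ c) = 1 + fps_X ^ Suc n * Y" by auto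
  obtain d where d: "c = Suc n + d" using insert.prems[of c] less_imp_Suc_add by fastforce
  have "(\<Prod>c\<in>insert c H. 1 - fps_X ^ c) = (1 - fps_X ^ Suc n * fps_X ^ d) * (1 + fps_X ^ Suc n * Y)"
    using insert.hyps Y by (simp add: d power_add)
  also have "\<dots> = 1 + fps_X ^ Suc n * (Y - fps_X ^ d * (1 + fps_X ^ Suc n * Y))"
    by (simp add: algebra_simps)
  finally show ?case by blast
qed

text \<open>Euler's argument with parts up to \<open>n\<close>: multiplying each
  \<open>1 + X^k\<close> by \<open>1 - X^k\<close> gives the product of \<open>1 - X^(2k)\<close>.
  The doubled numbers consist of the even numbers \<open>E\<close> up to \<open>n\<close> and of
  numbers \<open>H\<close> beyond \<open>n\<close>; cancelling \<open>E\<close> leaves the product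
  for distinct parts times that over the odd numbers \<open>B\<close> equal to the product over
  \<open>H\<close>, which is 1 up to order \<open>n\<close>.\<close>

lemma euler_odd_distinct: "mcount {k. odd k} n = dcount {} n"
proof -
  define A where "A = {1..n}"
  define B where "B = {k\<in>A. odd k}"
  define E where "E = {k\<in>A. even k}"
  define H where "H = {k\<in>(\<lambda>k. 2 * k) ` A. k > n}"
  let ?P = "\<lambda>S. (\<Prod>b\<in>S. 1 - fps_X ^ b) :: int fps"
  have fin: "finite A" "finite B" "finite E" "finite H" by (auto simp: A_def B_def E_def H_def)
  have z: "0 \<notin> A" "0 \<notin> B" "0 \<notin> E" by (auto simp: A_def B_def E_def)
  have AB: "?P A = ?P B * ?P E"
    using fin by (subst prod.union_disjoint[symmetric]) (auto simp: B_def E_def intro!: prod.cong)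
  have sq: "(1 + z) * (1 - z) = 1 - z * z" for z :: "int fps" by (simp add: algebra_simps)
  have "(\<Prod>k\<in>A. 1 + fps_X ^ k) * ?P A = (\<Prod>k\<in>A. 1 - fps_X ^ (2 * k))"
    unfolding prod.distrib[symmetric] mult_2 power_add sq ..
  also have "\<dots> = ?P ((\<lambda>k. 2 * k) ` A)"
    by (subst prod.reindex) (auto simp: inj_on_def)
  also have "(\<lambda>k. 2 * k) ` A = E \<union> H"
  proof
    show "(\<lambda>k. 2 * k) ` A \<subseteq> E \<union> H" by (auto simp: A_def E_def H_def)
    have "k \<in> (\<lambda>k. 2 * k) ` A" if "k \<in> E" for k
    proof -
      have "even k" using that by (simp add: E_def)
      then obtain j where "k = 2 * j" by (rule evenE)
      then show ?thesis using that by (auto simp: E_def A_def)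
    qed
    then show "E \<union> H \<subseteq> (\<lambda>k. 2 * k) ` A" by (auto simp: H_def)
  qed
  also have "?P (E \<union> H) = ?P E * ?P H"
    using fin by (subst prod.union_disjoint) (auto simp: E_def H_def A_def)
  finally have "(\<Prod>k\<in>A. 1 + fps_X ^ k) * ?P B * ?P E = ?P H * ?P E"
    by (simp add: AB mult_ac)
  moreover have "?P E \<noteq> 0" using fps_mcount[OF fin(3) z(3)] by auto
  ultimately have *: "(\<Prod>k\<in>A. 1 + fps_X ^ k) * ?P B = ?P H" by simp
  obtain Y where Y: "?P H = 1 + fps_X ^ Suc n * Y"
    using fps_prod_one_minus_high[OF fin(4), of n] by (auto simp: H_def)
  let ?M = "Abs_fps (\<lambda>N. int (mcount B N))"
  have "(\<Prod>k\<in>A. 1 + fps_X ^ k) = (\<Prod>k\<in>A. 1 + fps_X ^ k) * (?M * ?P B)"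
    by (simp add: fps_mcount[OF fin(2) z(2)])
  also have "\<dots> = ?M * ?P H" unfolding *[symmetric] by (simp add: mult_ac)
  also have "\<dots> = ?M + fps_X ^ Suc n * (?M * Y)" unfolding Y by (simp add: algebra_simps)
  finally have "Abs_fps (\<lambda>N. int (dcount (- A) N)) = ?M + fps_X ^ Suc n * (?M * Y)"
    by (simp add: fps_dcount[OF fin(1) z(1)])
  then have "fps_nth (Abs_fps (\<lambda>N. int (dcount (- A) N))) n = fps_nth (?M + fps_X ^ Suc n * (?M * Y)) n"
    by (rule arg_cong)
  then have "dcount (- A) n = mcount B n" by (simp add: fps_X_power_mult_nth del: power_Suc)
  moreover have "dcount (- A) n = dcount {} n"
  proof -
    have "avoiding_sets (- A) n = avoiding_sets {} n"
      using dcount_sets_subset[of "{}" n] by (auto simp: A_def)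
    then show ?thesis unfolding dcount_def by simp
  qed
  moreover have "mcount B n = mcount {k. odd k} n"
  proof -
    have "x \<in> B" if "set_mset M \<subseteq> {k. odd k}" "\<Sum>\<^sub># M = n" "x \<in># M" for M x
    proof -
      have "x \<le> n" using that sum_mset.remove[of x M] by auto
      then show "x \<in> B" using that by (auto simp: B_def A_def intro: odd_pos Suc_leI)
    qed
    moreover have "B \<subseteq> {k. odd k}" by (auto simp: B_def)
    ultimately have "{M. set_mset M \<subseteq> B \<and> \<Sum>\<^sub># M = n} = {M. set_mset M \<subseteq> {k. odd k} \<and> \<Sum>\<^sub># M = n}"
      by blast
    then show ?thesis unfolding mcount_def by simp
  qed
  ultimately show ?thesis by simp
qed

text \<open>Solving \<open>u m = v m - u (m + b)\<close> downwards from \<open>m > n\<close> multiplies the main term by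
  \<open>1 / (1 + exp (- t b))\<close>, while the errors add up to a geometric series.\<close>

lemma approx_divide_one_plus:
  fixes u v :: "nat \<Rightarrow> real"
  assumes t: "t > 0" and b: "b > 0" and \<kappa>: "\<kappa> \<ge> 0"
    and v: "\<And>m. \<bar>v m - \<kappa> * exp (- (t * real m))\<bar> \<le> E * exp (- (t * real m) / 2)"
    and uv: "\<And>m. u m + u (m + b) = v m"
    and z: "\<And>m. m > n \<Longrightarrow> u m = 0"
  shows "\<bar>u m - \<kappa> / (1 + exp (- (t * real b))) * exp (- (t * real m))\<bar>
     \<le> E / (1 - exp (- (t * real b) / 2)) * exp (- (t * real m) / 2)"
proof (induction "Suc n - m" arbitrary: m rule: less_induct)
  case less
  define q where "q = exp (- (t * real b) / 2)"
  define \<kappa>' where "\<kappa>' = \<kappa> / (1 + exp (- (t * real b)))"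
  define E' where "E' = E / (1 - q)"
  have q: "0 < q" "q < 1" using t b by (auto simp: q_def)
  have \<kappa>': "\<kappa>' * (1 + exp (- (t * real b))) = \<kappa>" "0 \<le> \<kappa>'" "\<kappa>' \<le> \<kappa>"
    using \<kappa> one_plus_exp_pos[of "- (t * real b)"] by (auto simp: \<kappa>'_def field_simps)
  have "0 \<le> E * exp (- (t * real 0) / 2)" using v[of 0] by (rule order_trans[OF abs_ge_zero])
  then have E: "E \<ge> 0" by simp
  have E': "E \<le> E'" "E + E' * q = E'" using E q by (auto simp: E'_def field_simps)
  show ?case
    unfolding \<kappa>'_def[symmetric] q_def[symmetric] E'_def[symmetric]
  proof (cases "m \<le> n")
    \<comment> \<open>Beyond \<open>n\<close> both \<open>u m\<close> and \<open>u (m + b)\<close>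
      vanish, hence also \<open>v m\<close>. The hypothesis on \<open>v\<close> then says that the
      main term is itself below the error, which starts the induction.\<close>
    case False
    then have "v m = 0" using z uv[of m] by simp
    have "\<bar>u m - \<kappa>' * exp (- (t * real m))\<bar> = \<kappa>' * exp (- (t * real m))" using z False \<kappa>' by (simp add: abs_mult)
    also have "\<dots> \<le> \<kappa> * exp (- (t * real m))" using \<kappa>' by (intro mult_right_mono) auto
    also have "\<dots> \<le> E * exp (- (t * real m) / 2)" using v[of m] \<open>v m = 0\<close> \<kappa> by (simp add: abs_mult)
    also have "\<dots> \<le> E' * exp (- (t * real m) / 2)" using E' by (intro mult_right_mono) auto
    finally show "\<bar>u m - \<kappa>' * exp (- (t * real m))\<bar> \<le> E' * exp (- (t * real m) / 2)" .
  next
    case True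
    have IH: "\<bar>u (m + b) - \<kappa>' * exp (- (t * real (m + b)))\<bar> \<le> E' * exp (- (t * real (m + b)) / 2)"
      using less[of "m + b"] True b unfolding \<kappa>'_def E'_def q_def by simp
    have e1: "exp (- (t * real (m + b))) = exp (- (t * real b)) * exp (- (t * real m))"
      by (simp add: exp_add[symmetric] algebra_simps)
    have e2: "exp (- (t * real (m + b)) / 2) = q * exp (- (t * real m) / 2)"
      unfolding q_def exp_add[symmetric] by (simp add: field_simps)
    have "u m - \<kappa>' * exp (- (t * real m)) = (v m - \<kappa> * exp (- (t * real m))) - (u (m + b) - \<kappa>' * exp (- (t * real (m + b))))"
      unfolding e1 \<kappa>'(1)[symmetric] uv[symmetric] by (simp add: algebra_simps)
    then have "\<bar>u m - \<kappa>' * exp (- (t * real m))\<bar> \<le> E * exp (- (t * real m) / 2) + E' * exp (- (t * real (m + b)) / 2)"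
      using v[of m] IH by linarith
    also have "\<dots> = (E + E' * q) * exp (- (t * real m) / 2)" unfolding e2 by (simp add: algebra_simps)
    finally show "\<bar>u m - \<kappa>' * exp (- (t * real m))\<bar> \<le> E' * exp (- (t * real m) / 2)" unfolding E' .
  qed
qed

text \<open>The forbidden parts are added one at a time, each by solving the recursion
  \<open>dcount_insert\<close>. The denominators of the error stay away from 0 as long as the parts
  in \<open>R\<close> are of order \<open>1 / t\<close>.\<close>

lemma count_ratio_dcount_approx:
  assumes t: "t > 0" and R: "finite R" "0 \<notin> R"
    and base: "\<And>m. \<bar>count_ratio (dcount {}) n m - exp (- (t * real m))\<bar> \<le> E * exp (- (t * real m) / 2)"
  shows "\<bar>count_ratio (dcount R) n m - 1 / (\<Prod>b\<in>R. 1 + exp (- (t * real b))) * exp (- (t * real m))\<bar>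
     \<le> E / (\<Prod>b\<in>R. 1 - exp (- (t * real b) / 2)) * exp (- (t * real m) / 2)"
  using R
proof (induction R arbitrary: m rule: finite_induct)
  case empty
  then show ?case using base[of m] by simp
next
  case (insert b R)
  have "count_ratio (dcount (insert b R)) n m + count_ratio (dcount (insert b R)) n (m + b) = count_ratio (dcount R) n m" for m
  proof (cases "m \<le> n")
    case True
    then have *: "b \<le> n - m \<longleftrightarrow> m + b \<le> n" by auto
    show ?thesis using dcount_insert[of b R "n - m"] insert True
      by (auto simp: count_ratio_def * add_divide_distrib)
  qed (auto simp: count_ratio_def)
  then have "\<bar>count_ratio (dcount (insert b R)) n m - 1 / (\<Prod>b\<in>R. 1 + exp (- (t * real b))) / (1 + exp (- (t * real b))) * exp (- (t * real m))\<bar>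
     \<le> E / (\<Prod>b\<in>R. 1 - exp (- (t * real b) / 2)) / (1 - exp (- (t * real b) / 2)) * exp (- (t * real m) / 2)"
    using insert t
    by (intro approx_divide_one_plus[where v = "count_ratio (dcount R) n" and n = n])
       (auto simp: count_ratio_def intro!: prod_nonneg add_nonneg_nonneg)
  then show ?case using insert by (simp add: mult.commute)
qed

text \<open>Excluding a part is a mere difference by \<open>mcount_remove\<close>: the main term
  gains the factor \<open>1 - exp (- t b)\<close> and the error at most doubles. The empty case is
  Euler's theorem, which brings in the same normalisation as for distinct parts.\<close>

lemma count_ratio_mcount_approx:
  assumes t: "t > 0" and R: "finite R" "R \<subseteq> {k. odd k}"
    and base: "\<And>m. \<bar>count_ratio (dcount {}) n m - exp (- (t * real m))\<bar> \<le> E * exp (- (t * real m) / 2)"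
  shows "\<bar>count_ratio (mcount ({k. odd k} - R)) n m - (\<Prod>b\<in>R. 1 - exp (- (t * real b))) * exp (- (t * real m))\<bar>
     \<le> 2 ^ card R * E * exp (- (t * real m) / 2)"
  using R
proof (induction R arbitrary: m rule: finite_induct)
  case empty
  have "count_ratio (mcount {k. odd k}) n m = count_ratio (dcount {}) n m" by (simp add: count_ratio_def euler_odd_distinct)
  then show ?case using base[of m] by simp
next
  case (insert b R)
  let ?P = "\<Prod>b\<in>R. 1 - exp (- (t * real b))"
  let ?u = "count_ratio (mcount ({k. odd k} - insert b R)) n"
  let ?v = "count_ratio (mcount ({k. odd k} - R)) n"
  have "0 \<le> E * exp (- (t * real 0) / 2)" using base[of 0] by (rule order_trans[OF abs_ge_zero])
  then have E: "E \<ge> 0" by simp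
  have uv: "?u m = ?v m - ?v (m + b)" for m
  proof (cases "m \<le> n")
    case True
    then have *: "b \<le> n - m \<longleftrightarrow> m + b \<le> n" by auto
    have "{k. odd k} - insert b R = {k. odd k} - R - {b}" by auto
    then show ?thesis using mcount_remove[of b "{k. odd k} - R" "n - m"] insert True
      by (auto simp: count_ratio_def * add_divide_distrib)
  qed (auto simp: count_ratio_def)
  have e1: "exp (- (t * real (m + b))) = exp (- (t * real b)) * exp (- (t * real m))"
    by (simp add: exp_add[symmetric] algebra_simps)
  have "exp (- (t * real (m + b)) / 2) \<le> exp (- (t * real m) / 2)" using t by simp
  then have le: "2 ^ card R * E * exp (- (t * real (m + b)) / 2) \<le> 2 ^ card R * E * exp (- (t * real m) / 2)"
    using E by (intro mult_left_mono) auto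
  have "?u m - (1 - exp (- (t * real b))) * ?P * exp (- (t * real m))
    = (?v m - ?P * exp (- (t * real m))) - (?v (m + b) - ?P * exp (- (t * real (m + b))))"
    unfolding uv e1 by (simp add: algebra_simps)
  moreover have "\<bar>?v m - ?P * exp (- (t * real m))\<bar> \<le> 2 ^ card R * E * exp (- (t * real m) / 2)"
    "\<bar>?v (m + b) - ?P * exp (- (t * real (m + b)))\<bar> \<le> 2 ^ card R * E * exp (- (t * real (m + b)) / 2)"
    using insert by blast+
  ultimately have "\<bar>?u m - (1 - exp (- (t * real b))) * ?P * exp (- (t * real m))\<bar> \<le> 2 * (2 ^ card R * E * exp (- (t * real m) / 2))"
    using le by linarith
  then show ?case using insert by simp
qed

section \<open>Riemann sums\<close>

lemma integrable_exp_Ici: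
  assumes "(c::real) > 0"
  shows "integrable lborel (\<lambda>x. indicator {0..} x * exp (- (c * x)))"
proof (rule integrableI_nonneg)
  have "(\<integral>\<^sup>+x. ennreal (exp (- (c * x))) * indicator {0..} x \<partial>lborel) = ennreal (0 - - exp (- (c * 0)) / c)"
  proof (rule nn_integral_FTC_atLeast)
    fix x :: real
    show "DERIV (\<lambda>x. - exp (- (c * x)) / c) x :> exp (- (c * x))"
      using assms by (auto intro!: derivative_eq_intros)
    have "((\<lambda>x. exp (- (c * x))) \<longlongrightarrow> 0) at_top"
      using assms
      by (intro filterlim_compose[OF exp_at_bot] filterlim_compose[OF filterlim_uminus_at_bot_at_top]
            filterlim_tendsto_pos_mult_at_top[OF tendsto_const]) (auto simp: filterlim_ident)
    then show "((\<lambda>x. - exp (- (c * x)) / c) \<longlongrightarrow> 0) at_top"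
      using tendsto_divide[OF tendsto_minus, of "\<lambda>x. exp (- (c * x))" 0 at_top "\<lambda>_. c" c] assms by simp
  qed auto
  then show "(\<integral>\<^sup>+x. ennreal (indicator {0..} x * exp (- (c * x))) \<partial>lborel) < \<infinity>"
    by (simp add: ennreal_mult' ennreal_indicator mult.commute)
qed auto

lemma integral_floor_step:
  assumes "(t::real) > 0"
  shows "has_bochner_integral lborel (\<lambda>x. indicator {0..} x * (if nat \<lfloor>x / t\<rfloor> \<le> n then g (nat \<lfloor>x / t\<rfloor>) else 0 :: real)) (t * (\<Sum>i\<le>n. g i))"
proof -
  have eq: "indicator {0..} x * (if nat \<lfloor>x / t\<rfloor> \<le> n then g (nat \<lfloor>x / t\<rfloor>) else 0)
    = (\<Sum>i\<le>n. g i * indicator {real i * t..<(real i + 1) * t} x)" for x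
  proof (cases "x \<ge> 0")
    case True
    have "indicator {real i * t..<(real i + 1) * t} x = (if i = nat \<lfloor>x / t\<rfloor> then 1 else 0 :: real)" for i
    proof -
      have "x \<in> {real i * t..<(real i + 1) * t} \<longleftrightarrow> real i \<le> x / t \<and> x / t < real i + 1"
        using assms by (simp add: field_simps)
      also have "\<dots> \<longleftrightarrow> \<lfloor>x / t\<rfloor> = int i" by (auto simp: floor_eq_iff)
      also have "\<dots> \<longleftrightarrow> i = nat \<lfloor>x / t\<rfloor>" using True assms by auto
      finally show ?thesis by (simp add: indicator_def)
    qed
    then show ?thesis using True by (simp add: if_distrib[of "\<lambda>z. _ * z"] sum.delta' cong: if_cong)
  next
    case False
    have "x \<notin> {real i * t..<(real i + 1) * t}" for i
      using False assms mult_nonneg_nonneg[of "real i" t] by (auto simp del: mult_nonneg_nonneg)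
    then show ?thesis using False by simp
  qed
  have "has_bochner_integral lborel (\<lambda>x. \<Sum>i\<le>n. g i * indicator {real i * t..<(real i + 1) * t} x)
     (\<Sum>i\<le>n. g i * measure lborel {real i * t..<(real i + 1) * t})"
    using assms by (intro has_bochner_integral_sum has_bochner_integral_mult_right has_bochner_integral_real_indicator)
        (auto simp: emeasure_lborel_Ico mult_right_mono)
  also have "(\<Sum>i\<le>n. g i * measure lborel {real i * t..<(real i + 1) * t}) = t * (\<Sum>i\<le>n. g i)"
    using assms by (simp add: sum_distrib_left measure_lborel_Ico mult_right_mono algebra_simps)
  finally show ?thesis by (simp add: eq)
qed

text \<open>The sum is the integral of a step function of mesh \<open>t n\<close>, and dominated
  convergence does the rest. The limit is asked for \<open>x > 0\<close> only, since the error
  bounds for windows degenerate at 0.\<close>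

lemma riemann_limit:
  fixes t :: "nat \<Rightarrow> real" and g :: "nat \<Rightarrow> nat \<Rightarrow> real"
  assumes t: "t \<longlonglongrightarrow> 0" "\<forall>\<^sub>F n in sequentially. t n > 0" and c: "c > 0"
    and bound: "\<forall>\<^sub>F n in sequentially. \<forall>i. \<bar>g n i\<bar> \<le> C * exp (- (c * (t n * real i)))"
    and supp: "\<And>n i. i > n \<Longrightarrow> g n i = 0"
    and lim: "\<And>x. x > 0 \<Longrightarrow> (\<lambda>n. g n (nat \<lfloor>x / t n\<rfloor>)) \<longlonglongrightarrow> f x"
    and f: "f \<in> borel_measurable borel"
  shows "f integrable_on {0..}" "(\<lambda>n. t n * (\<Sum>i\<le>n. g n i)) \<longlonglongrightarrow> integral {0..} f"
proof -
  define good where "good n \<longleftrightarrow> 0 < t n \<and> t n \<le> 1 \<and> (\<forall>i. \<bar>g n i\<bar> \<le> C * exp (- (c * (t n * real i))))" for n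
  have "\<forall>\<^sub>F n in sequentially. t n < 1" using t(1) by (rule order_tendstoD) simp
  then have good: "\<forall>\<^sub>F n in sequentially. good n"
    using t(2) bound by eventually_elim (auto simp: good_def)
  then obtain n0 where "good n0" by (auto simp: eventually_sequentially)
  then have C: "C \<ge> 0" unfolding good_def by (auto dest: spec[of _ 0])
  \<comment> \<open>Set to 0 for the finitely many bad \<open>n\<close>, because the domination has
    to hold for every \<open>n\<close>.\<close>
  define s where "s n x = (if good n then indicator {0..} x * (if nat \<lfloor>x / t n\<rfloor> \<le> n then g n (nat \<lfloor>x / t n\<rfloor>) else 0) else 0)" for n x
  \<comment> \<open>Rounding \<open>x\<close> down to a multiple of \<open>t n \<le> 1\<close>
    changes it by at most 1, whence the factor \<open>exp c\<close>.\<close>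
  define w where "w x = C * exp c * (indicator {0..} x * exp (- (c * x)))" for x :: real
  have s_int: "has_bochner_integral lborel (s n) (t n * (\<Sum>i\<le>n. g n i))" if "good n" for n
    unfolding s_def using that integral_floor_step[of "t n" n "g n"] by (simp add: good_def)
  have meas: "s n \<in> borel_measurable lborel" for n
  proof (cases "good n")
    case True
    then show ?thesis using s_int has_bochner_integral_iff borel_measurable_integrable by blast
  next
    case False
    then show ?thesis unfolding s_def by simp
  qed
  have meas_f: "(\<lambda>x. indicator {0..} x * f x) \<in> borel_measurable lborel" using f by measurable
  have w: "integrable lborel w" unfolding w_def using integrable_exp_Ici[OF c] by simp
  have bnd: "AE x in lborel. norm (s n x) \<le> w x" for n
  proof (intro AE_I2)
    fix x
    show "norm (s n x) \<le> w x"
    proof (cases "good n \<and> x \<ge> 0")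
      case True
      then have gn: "0 < t n" "t n \<le> 1" "\<And>i. \<bar>g n i\<bar> \<le> C * exp (- (c * (t n * real i)))" and x: "x \<ge> 0"
        by (auto simp: good_def)
      define i where "i = nat \<lfloor>x / t n\<rfloor>"
      have "x / t n \<ge> 0" using x gn by simp
      then have "real i \<ge> x / t n - 1" unfolding i_def by linarith
      then have "t n * real i \<ge> t n * (x / t n - 1)" using gn by (intro mult_left_mono) auto
      then have "t n * real i \<ge> x - 1" using gn by (simp add: right_diff_distrib)
      then have "c * (t n * real i) \<ge> c * (x - 1)" using c by (intro mult_left_mono) auto
      then have e: "exp (- (c * (t n * real i))) \<le> exp c * exp (- (c * x))"
        by (simp add: exp_add[symmetric] algebra_simps)
      have "norm (s n x) \<le> \<bar>g n i\<bar>" using True by (simp add: s_def i_def)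
      also have "\<dots> \<le> C * exp (- (c * (t n * real i)))" by (rule gn)
      also have "\<dots> \<le> C * (exp c * exp (- (c * x)))" using e C by (intro mult_left_mono) auto
      finally show ?thesis using x by (simp add: w_def)
    qed (use C in \<open>auto simp: s_def w_def\<close>)
  qed
  have conv: "AE x in lborel. (\<lambda>n. s n x) \<longlonglongrightarrow> indicator {0..} x * f x"
  proof (rule AE_mp[OF AE_lborel_singleton[of 0]], intro AE_I2 impI)
    fix x :: real assume x: "x \<noteq> 0"
    show "(\<lambda>n. s n x) \<longlonglongrightarrow> indicator {0..} x * f x"
    proof (cases "x > 0")
      case True
      have "\<forall>\<^sub>F n in sequentially. s n x = g n (nat \<lfloor>x / t n\<rfloor>)"
        using good by eventually_elim (use True supp in \<open>auto simp: s_def\<close>)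
      then show ?thesis using lim[OF True] True by (simp add: tendsto_cong)
    next
      case False
      then have "x < 0" using x by simp
      then have "s n x = 0" for n by (auto simp: s_def indicator_def)
      then show ?thesis using \<open>x < 0\<close> by (simp add: indicator_def)
    qed
  qed
  have int_f: "integrable lborel (\<lambda>x. indicator {0..} x * f x)"
    by (rule integrable_dominated_convergence[OF meas_f meas w conv bnd])
  then have "set_integrable lborel {0..} f" by (simp add: set_integrable_def)
  note F = set_borel_integral_eq_integral[OF this]
  show "f integrable_on {0..}" by (rule F)
  have "(\<lambda>n. integral\<^sup>L lborel (s n)) \<longlonglongrightarrow> integral\<^sup>L lborel (\<lambda>x. indicator {0..} x * f x)"
    by (rule integral_dominated_convergence[OF meas_f meas w conv bnd])
  also have "integral\<^sup>L lborel (\<lambda>x. indicator {0..} x * f x) = integral {0..} f"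
    using F(2) by (simp add: set_lebesgue_integral_def)
  finally have "(\<lambda>n. integral\<^sup>L lborel (s n)) \<longlonglongrightarrow> integral {0..} f" .
  moreover have "\<forall>\<^sub>F n in sequentially. integral\<^sup>L lborel (s n) = t n * (\<Sum>i\<le>n. g n i)"
    using good by eventually_elim (use s_int has_bochner_integral_integral_eq in blast)
  ultimately show "(\<lambda>n. t n * (\<Sum>i\<le>n. g n i)) \<longlonglongrightarrow> integral {0..} f"
    by (simp add: tendsto_cong)
qed

lemma tendsto_mult_floor:
  fixes t :: "nat \<Rightarrow> real"
  assumes t: "t \<longlonglongrightarrow> 0" "\<forall>\<^sub>F n in sequentially. t n > 0" and x: "x > 0"
  shows "(\<lambda>n. t n * real (nat \<lfloor>x / t n\<rfloor>)) \<longlonglongrightarrow> x"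
proof (rule tendsto_sandwich[of "\<lambda>n. x - t n" _ _ "\<lambda>_. x"])
  show "\<forall>\<^sub>F n in sequentially. x - t n \<le> t n * real (nat \<lfloor>x / t n\<rfloor>)"
    using t(2)
  proof eventually_elim
    case (elim n)
    have "x / t n \<ge> 0" using x elim by simp
    then have "real (nat \<lfloor>x / t n\<rfloor>) \<ge> x / t n - 1" by linarith
    then have "t n * real (nat \<lfloor>x / t n\<rfloor>) \<ge> t n * (x / t n - 1)" using elim by (intro mult_left_mono) auto
    then show ?case using elim by (simp add: right_diff_distrib)
  qed
  show "\<forall>\<^sub>F n in sequentially. t n * real (nat \<lfloor>x / t n\<rfloor>) \<le> x"
    using t(2)
  proof eventually_elim
    case (elim n)
    have "x / t n \<ge> 0" using x elim by simp
    then have "real (nat \<lfloor>x / t n\<rfloor>) \<le> x / t n" by linarith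
    then have "t n * real (nat \<lfloor>x / t n\<rfloor>) \<le> t n * (x / t n)" using elim by (intro mult_left_mono) auto
    then show ?case using elim by simp
  qed
  show "(\<lambda>n. x - t n) \<longlonglongrightarrow> x" using tendsto_diff[OF tendsto_const t(1), of x] by simp
qed auto

lemma filterlim_nat_floor:
  fixes t :: "nat \<Rightarrow> real"
  assumes t: "t \<longlonglongrightarrow> 0" "\<forall>\<^sub>F n in sequentially. t n > 0" and x: "x > 0"
  shows "\<forall>\<^sub>F n in sequentially. nat \<lfloor>x / t n\<rfloor> \<ge> w"
proof -
  have "\<forall>\<^sub>F n in sequentially. t n < x / (real w + 1)"
    using t(1) x by (intro order_tendstoD) auto
  then show ?thesis using t(2)
  proof eventually_elim
    case (elim n)
    then have "real w + 1 < x / t n" using x by (simp add: field_simps)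
    then show ?case by linarith
  qed
qed

lemma tendsto_mult_nat_diff:
  fixes t :: "nat \<Rightarrow> real" and a :: "nat \<Rightarrow> nat"
  assumes t: "t \<longlonglongrightarrow> 0" and a: "(\<lambda>n. t n * real (a n)) \<longlonglongrightarrow> x" and ge: "\<forall>\<^sub>F n in sequentially. a n \<ge> i"
  shows "(\<lambda>n. t n * real (a n - i)) \<longlonglongrightarrow> x"
proof -
  have "(\<lambda>n. t n * real (a n) - t n * real i) \<longlonglongrightarrow> x - 0 * real i"
    by (intro tendsto_intros t a)
  moreover have "\<forall>\<^sub>F n in sequentially. t n * real (a n) - t n * real i = t n * real (a n - i)"
    using ge by eventually_elim (simp add: of_nat_diff right_diff_distrib)
  ultimately show ?thesis by (simp add: tendsto_cong)
qed

section \<open>Limits of the sums over windows\<close>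

lemma dcount_le: "dcount R N \<le> dcount {} N"
  unfolding dcount_def by (rule card_mono[OF finite_dcount_sets]) auto

lemma mcount_mono: "A \<subseteq> B \<Longrightarrow> 0 \<notin> B \<Longrightarrow> mcount A N \<le> mcount B N"
  unfolding mcount_def by (rule card_mono[OF finite_multisets_sum]) auto

lemma count_ratio_nonneg: "count_ratio F n m \<ge> 0"
  by (simp add: count_ratio_def)

lemma count_ratio_mono: "(\<And>N. F N \<le> G N) \<Longrightarrow> count_ratio F n m \<le> count_ratio G n m"
  by (auto simp: count_ratio_def intro!: divide_right_mono)

text \<open>Provides the domination required by \<open>riemann_limit\<close>; the rate 1/2 is that
  of the error term in \<open>dcount_ratio\<close>.\<close>

lemma count_ratio_dcount_bound:
  obtains C where "C > 0" "\<forall>\<^sub>F n in sequentially. \<forall>m. count_ratio (dcount {}) n m \<le> C * exp (- (1 / 2 * (saddle n * real m)))"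
proof -
  obtain C where C: "C > 0"
    "ratio_estimate C"
    using dcount_ratio by blast
  show thesis
  proof
    show "C + 1 > 0" using C by simp
    have "\<forall>\<^sub>F n in sequentially. saddle n < 1" by (rule order_tendstoD(2)[OF saddle_tendsto]) simp
    then show "\<forall>\<^sub>F n in sequentially. \<forall>m. count_ratio (dcount {}) n m \<le> (C + 1) * exp (- (1 / 2 * (saddle n * real m)))"
      using C(2) saddle_pos_ev
    proof eventually_elim
      case (elim n)
      show ?case
      proof
        fix m
        let ?e = "exp (- (saddle n * real m) / 2)"
        have "count_ratio (dcount {}) n m \<le> exp (- (saddle n * real m)) + C * sqrt (saddle n) * ?e"
          using elim(2) by (auto simp: abs_le_iff algebra_simps dest: spec[of _ m])
        also have "\<dots> \<le> ?e + C * 1 * ?e"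
          using elim C by (intro add_mono mult_right_mono mult_left_mono) auto
        finally show "count_ratio (dcount {}) n m \<le> (C + 1) * exp (- (1 / 2 * (saddle n * real m)))"
          by (simp add: algebra_simps)
      qed
    qed
  qed
qed

text \<open>Indices of order \<open>1 / saddle n\<close> are eventually below \<open>n\<close>,
  which is at least of order \<open>1 / (saddle n)^2\<close>. So the cut-off at \<open>n\<close>
  does not affect pointwise limits.\<close>

lemma eventually_le_self:
  assumes "(\<lambda>n. saddle n * real (a n)) \<longlonglongrightarrow> x"
  shows "\<forall>\<^sub>F n in sequentially. a n \<le> n"
proof -
  have "(\<lambda>n. 36 * (saddle n * real (a n)) * saddle n) \<longlonglongrightarrow> 36 * x * 0"
    by (intro tendsto_intros assms saddle_tendsto)
  then have "\<forall>\<^sub>F n in sequentially. 36 * (saddle n * real (a n)) * saddle n < 1"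
    by (rule order_tendstoD(2)) simp
  then show ?thesis using saddle_pos_ev eventually_ge_at_top[of 36]
  proof eventually_elim
    case (elim n)
    have "real (a n) \<le> 1 / (36 * (saddle n)\<^sup>2)"
      using elim by (simp add: field_simps power2_eq_square)
    also have "\<dots> \<le> real n" using elim by (intro inverse_saddle_le)
    finally show ?case by simp
  qed
qed

text \<open>The window consists of \<open>a, a - 1, ..., a - w + 1\<close>, and \<open>J\<close>
  holds the offsets of the parts present. With \<open>a\<close> about \<open>x / t\<close>, each
  present part contributes \<open>exp (- x)\<close>, and each of the \<open>w\<close> settled values
  contributes a factor \<open>1 / (1 + exp (- x))\<close>.\<close>

lemma distinct_window_limit:
  assumes J: "J \<subseteq> {..<w}" "0 \<in> J"
  shows "(\<lambda>x. exp (- real (card J) * x) / (1 + exp (- x)) ^ w) integrable_on {0..}"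
    and "(\<lambda>n. saddle n * (\<Sum>a\<in>{w..n}. count_ratio (dcount ((\<lambda>i. a - i) ` {..<w})) n (\<Sum>i\<in>J. a - i)))
      \<longlonglongrightarrow> I_B (card J) w"
    (is ?lim)
proof -
  let ?f = "\<lambda>x::real. exp (- real (card J) * x) / (1 + exp (- x)) ^ w"
  have finJ: "finite J" using J finite_subset by blast
  define R where "R a = (\<lambda>i. a - i) ` {..<w}" for a :: nat
  define m where "m a = (\<Sum>i\<in>J. a - i)" for a :: nat
  define g where "g n a = (if w \<le> a \<and> a \<le> n then count_ratio (dcount (R a)) n (m a) else 0)" for n a
  obtain C1 where C1: "C1 > 0" "\<forall>\<^sub>F n in sequentially. \<forall>m. count_ratio (dcount {}) n m \<le> C1 * exp (- (1 / 2 * (saddle n * real m)))"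
    using count_ratio_dcount_bound by blast
  obtain C2 where C2: "C2 > 0"
    "ratio_estimate C2"
    using dcount_ratio by blast
  have m_ge: "m a \<ge> a" for a
    using member_le_sum[of 0 J "\<lambda>i. a - i"] J finJ by (simp add: m_def)
  have bound: "\<forall>\<^sub>F n in sequentially. \<forall>a. \<bar>g n a\<bar> \<le> C1 * exp (- (1 / 2 * (saddle n * real a)))"
    using C1(2) saddle_pos_ev
  proof eventually_elim
    case (elim n)
    show ?case
    proof
      fix a
      have "\<bar>g n a\<bar> \<le> count_ratio (dcount {}) n (m a)"
        by (auto simp: g_def count_ratio_nonneg intro!: count_ratio_mono dcount_le)
      also have "\<dots> \<le> C1 * exp (- (1 / 2 * (saddle n * real (m a))))" using elim by blast
      also have "\<dots> \<le> C1 * exp (- (1 / 2 * (saddle n * real a)))"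
        using C1(1) elim m_ge[of a] by (intro mult_left_mono) auto
      finally show "\<bar>g n a\<bar> \<le> C1 * exp (- (1 / 2 * (saddle n * real a)))" .
    qed
  qed
  have lim: "(\<lambda>n. g n (nat \<lfloor>x / saddle n\<rfloor>)) \<longlonglongrightarrow> ?f x" if x: "x > 0" for x
  proof -
    define a where "a n = nat \<lfloor>x / saddle n\<rfloor>" for n
    have ta: "(\<lambda>n. saddle n * real (a n)) \<longlonglongrightarrow> x"
      unfolding a_def by (rule tendsto_mult_floor[OF saddle_tendsto saddle_pos_ev x])
    have aw: "\<forall>\<^sub>F n in sequentially. a n \<ge> w + 1"
      unfolding a_def by (rule filterlim_nat_floor[OF saddle_tendsto saddle_pos_ev x])
    have tai: "(\<lambda>n. saddle n * real (a n - i)) \<longlonglongrightarrow> x" if "i < w" for i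
      using aw that by (intro tendsto_mult_nat_diff[OF saddle_tendsto ta]) (auto elim: eventually_mono)
    define t where "t = saddle"
    have tm: "(\<lambda>n. t n * real (m (a n))) \<longlonglongrightarrow> real (card J) * x"
    proof -
      have "(\<lambda>n. \<Sum>i\<in>J. t n * real (a n - i)) \<longlonglongrightarrow> (\<Sum>i\<in>J. x)"
        unfolding t_def using J by (intro tendsto_sum tai) auto
      then show ?thesis by (simp add: m_def sum_distrib_left)
    qed
    define P where "P n = (\<Prod>i<w. 1 + exp (- (t n * real (a n - i))))" for n
    define Q where "Q n = (\<Prod>i<w. 1 - exp (- (t n * real (a n - i)) / 2))" for n
    have P: "P \<longlonglongrightarrow> (1 + exp (- x)) ^ w"
    proof -
      have "P \<longlonglongrightarrow> (\<Prod>i<w. 1 + exp (- x))" unfolding P_def t_def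
        by (intro tendsto_prod tendsto_add tendsto_const tendsto_exp tendsto_minus tai) auto
      then show ?thesis by simp
    qed
    have Q: "Q \<longlonglongrightarrow> (1 - exp (- x / 2)) ^ w"
    proof -
      have "Q \<longlonglongrightarrow> (\<Prod>i<w. 1 - exp (- x / 2))" unfolding Q_def t_def
        by (intro tendsto_prod tendsto_diff tendsto_const tendsto_exp tendsto_divide tendsto_minus tai) auto
      then show ?thesis by simp
    qed
    have main: "(\<lambda>n. 1 / P n * exp (- (t n * real (m (a n))))) \<longlonglongrightarrow> 1 / (1 + exp (- x)) ^ w * exp (- (real (card J) * x))"
      using one_plus_exp_pos[of "- x"] by (intro tendsto_intros P tm) auto
    \<comment> \<open>The denominator has a nonzero limit because \<open>x > 0\<close>, so
      \<open>sqrt (t n)\<close> sends the error to 0.\<close>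
    have err: "(\<lambda>n. C2 * sqrt (t n) / Q n * exp (- (t n * real (m (a n))) / 2)) \<longlonglongrightarrow>
        C2 * sqrt 0 / (1 - exp (- x / 2)) ^ w * exp (- (real (card J) * x) / 2)"
      using x unfolding t_def by (intro tendsto_intros Q[unfolded t_def] tm[unfolded t_def] saddle_tendsto) auto
    have close: "\<forall>\<^sub>F n in sequentially. \<bar>g n (a n) - 1 / P n * exp (- (t n * real (m (a n))))\<bar>
        \<le> C2 * sqrt (t n) / Q n * exp (- (t n * real (m (a n))) / 2)"
    proof -
      have an: "\<forall>\<^sub>F n in sequentially. a n \<le> n"
        using eventually_le_self[OF ta] .
      show ?thesis using C2(2) saddle_pos_ev aw an
      proof eventually_elim
        case (elim n)
        have inj: "inj_on (\<lambda>i. a n - i) {..<w}" using elim(3) by (auto simp: inj_on_def)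
        have "0 \<notin> R (a n)" using elim(3) by (auto simp: R_def)
        moreover have "finite (R (a n))" by (simp add: R_def)
        ultimately have "\<bar>count_ratio (dcount (R (a n))) n (m (a n)) - 1 / (\<Prod>b\<in>R (a n). 1 + exp (- (t n * real b))) * exp (- (t n * real (m (a n))))\<bar>
          \<le> C2 * sqrt (t n) / (\<Prod>b\<in>R (a n). 1 - exp (- (t n * real b) / 2)) * exp (- (t n * real (m (a n))) / 2)"
          using elim by (intro count_ratio_dcount_approx) (auto simp: t_def)
        then show ?case
          using elim by (simp add: R_def prod.reindex[OF inj] P_def Q_def g_def)
      qed
    qed
    have "(\<lambda>n. g n (a n) - 1 / P n * exp (- (t n * real (m (a n))))) \<longlonglongrightarrow> 0"
      by (rule Lim_null_comparison[OF close[folded real_norm_def]]) (use err in simp)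
    from tendsto_add[OF this main] show ?thesis by (simp add: a_def mult.commute)
  qed
  have meas: "?f \<in> borel_measurable borel" by measurable
  have half: "(1 / 2 :: real) > 0" by simp
  have supp: "\<And>n i. i > n \<Longrightarrow> g n i = 0" by (simp add: g_def)
  note RL = riemann_limit[OF saddle_tendsto saddle_pos_ev half bound supp lim meas]
  show "?f integrable_on {0..}" by (rule RL(1))
  have "(\<Sum>a\<le>n. g n a) = (\<Sum>a\<in>{w..n}. count_ratio (dcount (R a)) n (m a))" for n
    by (rule sum.mono_neutral_cong_right) (auto simp: g_def)
  with RL(2) show ?lim
    by (simp add: I_B_def R_def m_def)
qed


text \<open>\<open>W\<close> is at most the number of odd values in the window below and including
  \<open>a\<close>. The entry \<open>l ! 0\<close> counts the further copies of \<open>a\<close>,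
  and \<open>l ! i\<close> the copies of \<open>a - 2 * i\<close>, so \<open>sum_list l + 1\<close>
  parts are removed. The \<open>W - 1\<close> values below \<open>a\<close> have exact
  multiplicities and give the power of \<open>1 - exp (-2 * x)\<close>; \<open>a\<close> does not.
  Writing \<open>a = 2 * i + 1\<close> makes \<open>i\<close> the summation index, so
  \<open>t * a\<close> tends to \<open>2 * x\<close>; this explains the exponents in
  \<open>I_A\<close>.\<close>

lemma odd_window_limit:
  assumes W: "W > 0" "2 * W \<le> w + 1" and l: "length l = W"
  shows "(\<lambda>x. (1 - exp (-2 * x)) ^ (W - 1) * exp (- real (2 * (sum_list l + 1)) * x)) integrable_on {0..}"
    and "(\<lambda>n. saddle n * (\<Sum>a\<in>{a\<in>{w..n}. odd a}.
        count_ratio (mcount ({k. odd k} - (\<lambda>i. a - 2 * i) ` {1..<W})) n (a + (\<Sum>i<W. l ! i * (a - 2 * i)))))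
      \<longlonglongrightarrow> I_A (W - 1) (2 * (sum_list l + 1))"
    (is ?lim)
proof -
  let ?f = "\<lambda>x::real. (1 - exp (-2 * x)) ^ (W - 1) * exp (- real (2 * (sum_list l + 1)) * x)"
  define R where "R a = (\<lambda>i. a - 2 * i) ` {1..<W}" for a :: nat
  define m where "m a = a + (\<Sum>i<W. l ! i * (a - 2 * i))" for a :: nat
  define h where "h n a = (if w \<le> a \<and> a \<le> n then count_ratio (mcount ({k. odd k} - R a)) n (m a) else 0)" for n a
  define g where "g n i = h n (2 * i + 1)" for n i
  have suml: "sum_list l = (\<Sum>i<W. l ! i)" by (simp add: sum_list_sum_nth l atLeast0LessThan)
  obtain C1 where C1: "C1 > 0" "\<forall>\<^sub>F n in sequentially. \<forall>m. count_ratio (dcount {}) n m \<le> C1 * exp (- (1 / 2 * (saddle n * real m)))"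
    using count_ratio_dcount_bound by blast
  obtain C2 where C2: "C2 > 0"
    "ratio_estimate C2"
    using dcount_ratio by blast
  have mc: "mcount ({k. odd k} - S) N \<le> dcount {} N" for S N
    unfolding euler_odd_distinct[symmetric] by (rule mcount_mono) auto
  have bound: "\<forall>\<^sub>F n in sequentially. \<forall>i. \<bar>g n i\<bar> \<le> C1 * exp (- (1 / 2 * (saddle n * real i)))"
    using C1(2) saddle_pos_ev
  proof eventually_elim
    case (elim n)
    show ?case
    proof
      fix i
      have "real i \<le> real (m (2 * i + 1))" by (simp only: m_def of_nat_le_iff)
      have "\<bar>g n i\<bar> \<le> count_ratio (dcount {}) n (m (2 * i + 1))"
        by (auto simp: g_def h_def count_ratio_nonneg intro!: count_ratio_mono mc)
      also have "\<dots> \<le> C1 * exp (- (1 / 2 * (saddle n * real (m (2 * i + 1)))))" using elim by blast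
      also have "\<dots> \<le> C1 * exp (- (1 / 2 * (saddle n * real i)))"
        using C1(1) elim \<open>real i \<le> real (m (2 * i + 1))\<close> by (intro mult_left_mono) auto
      finally show "\<bar>g n i\<bar> \<le> C1 * exp (- (1 / 2 * (saddle n * real i)))" .
    qed
  qed
  have lim: "(\<lambda>n. g n (nat \<lfloor>x / saddle n\<rfloor>)) \<longlonglongrightarrow> ?f x" if x: "x > 0" for x
  proof -
    define a where "a n = 2 * nat \<lfloor>x / saddle n\<rfloor> + 1" for n
    define t where "t = saddle"
    have ta: "(\<lambda>n. saddle n * real (a n)) \<longlonglongrightarrow> 2 * x"
    proof -
      have "(\<lambda>n. 2 * (saddle n * real (nat \<lfloor>x / saddle n\<rfloor>)) + saddle n) \<longlonglongrightarrow> 2 * x + 0"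
        by (intro tendsto_intros tendsto_mult_floor saddle_tendsto saddle_pos_ev x)
      then show ?thesis by (simp add: a_def algebra_simps)
    qed
    have "\<forall>\<^sub>F n in sequentially. nat \<lfloor>x / saddle n\<rfloor> \<ge> w + 1"
      by (rule filterlim_nat_floor[OF saddle_tendsto saddle_pos_ev x])
    then have aw: "\<forall>\<^sub>F n in sequentially. a n \<ge> w + 1"
      by eventually_elim (auto simp: a_def)
    have tai: "(\<lambda>n. saddle n * real (a n - 2 * i)) \<longlonglongrightarrow> 2 * x" if "i < W" for i
      using aw that W by (intro tendsto_mult_nat_diff[OF saddle_tendsto ta]) (auto elim!: eventually_mono)
    have tm: "(\<lambda>n. t n * real (m (a n))) \<longlonglongrightarrow> real (2 * (sum_list l + 1)) * x"
    proof -
      have "(\<lambda>n. t n * real (a n) + (\<Sum>i<W. real (l ! i) * (t n * real (a n - 2 * i))))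
         \<longlonglongrightarrow> 2 * x + (\<Sum>i<W. real (l ! i) * (2 * x))"
        unfolding t_def by (intro tendsto_add tendsto_sum tendsto_mult_left ta tai) auto
      moreover have "2 * x + (\<Sum>i<W. real (l ! i) * (2 * x)) = real (2 * (sum_list l + 1)) * x"
        by (simp add: suml sum_distrib_right algebra_simps sum_distrib_left)
      moreover have "t n * real (m (a n)) = t n * real (a n) + (\<Sum>i<W. real (l ! i) * (t n * real (a n - 2 * i)))" for n
        by (simp add: m_def sum_distrib_left distrib_left mult_ac)
      ultimately show ?thesis by (simp only:)
    qed
    define P where "P n = (\<Prod>i\<in>{1..<W}. 1 - exp (- (t n * real (a n - 2 * i))))" for n
    have P: "P \<longlonglongrightarrow> (1 - exp (- (2 * x))) ^ (W - 1)"
    proof -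
      have "P \<longlonglongrightarrow> (\<Prod>i\<in>{1..<W}. 1 - exp (- (2 * x)))" unfolding P_def t_def
        by (intro tendsto_prod tendsto_diff tendsto_const tendsto_exp tendsto_minus tai) auto
      then show ?thesis by simp
    qed
    have main: "(\<lambda>n. P n * exp (- (t n * real (m (a n))))) \<longlonglongrightarrow> (1 - exp (- (2 * x))) ^ (W - 1) * exp (- (real (2 * (sum_list l + 1)) * x))"
      by (intro tendsto_mult tendsto_exp tendsto_minus P tm)
    have "(\<lambda>n. 2 ^ (W - 1) * (C2 * sqrt (t n)) * exp (- (t n * real (m (a n))) / 2)) \<longlonglongrightarrow>
        2 ^ (W - 1) * (C2 * sqrt 0) * exp (- (real (2 * (sum_list l + 1)) * x) / 2)"
      unfolding t_def by (intro tendsto_mult tendsto_const tendsto_real_sqrt saddle_tendsto tendsto_exp tendsto_divide tendsto_minus tm[unfolded t_def]) auto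
    then have err: "(\<lambda>n. 2 ^ (W - 1) * (C2 * sqrt (t n)) * exp (- (t n * real (m (a n))) / 2)) \<longlonglongrightarrow> 0" by simp
    have close: "\<forall>\<^sub>F n in sequentially. norm (h n (a n) - P n * exp (- (t n * real (m (a n)))))
        \<le> 2 ^ (W - 1) * (C2 * sqrt (t n)) * exp (- (t n * real (m (a n))) / 2)"
      using C2(2) saddle_pos_ev aw eventually_le_self[OF ta]
    proof eventually_elim
      case (elim n)
      have inj: "inj_on (\<lambda>i. a n - 2 * i) {1..<W}" using elim(3) W by (auto simp: inj_on_def)
      have "R (a n) \<subseteq> {k. odd k}" using elim(3) W by (auto simp: R_def a_def)
      moreover have "finite (R (a n))" by (simp add: R_def)
      ultimately have "\<bar>count_ratio (mcount ({k. odd k} - R (a n))) n (m (a n)) - (\<Prod>b\<in>R (a n). 1 - exp (- (t n * real b))) * exp (- (t n * real (m (a n))))\<bar>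
        \<le> 2 ^ card (R (a n)) * (C2 * sqrt (t n)) * exp (- (t n * real (m (a n))) / 2)"
        using elim by (intro count_ratio_mcount_approx) (auto simp: t_def)
      moreover have "card (R (a n)) = W - 1" unfolding R_def using card_image[OF inj] by simp
      moreover have "(\<Prod>b\<in>R (a n). 1 - exp (- (t n * real b))) = P n"
        by (simp only: R_def P_def prod.reindex[OF inj] o_def)
      ultimately show ?case
        using elim by (simp add: h_def)
    qed
    have z: "(\<lambda>n. h n (a n) - P n * exp (- (t n * real (m (a n))))) \<longlonglongrightarrow> 0"
      by (rule Lim_null_comparison[OF close err])
    have fx: "?f x = (1 - exp (- (2 * x))) ^ (W - 1) * exp (- (real (2 * (sum_list l + 1)) * x))"
      by (simp add: algebra_simps)
    show ?thesis
      using tendsto_add[OF z main] unfolding fx by (simp only: a_def g_def diff_add_cancel add_0_left)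
  qed
  have meas: "?f \<in> borel_measurable borel" by measurable
  have half: "(1 / 2 :: real) > 0" by simp
  have supp: "\<And>n i. i > n \<Longrightarrow> g n i = 0" by (simp add: g_def h_def)
  note RL = riemann_limit[OF saddle_tendsto saddle_pos_ev half bound supp lim meas]
  show "?f integrable_on {0..}" by (rule RL(1))
  have "(\<Sum>i\<le>n. g n i) = (\<Sum>a\<in>{a\<in>{w..n}. odd a}. count_ratio (mcount ({k. odd k} - R a)) n (m a))" for n
  proof -
    have "(\<Sum>i\<le>n. g n i) = (\<Sum>a\<in>(\<lambda>i. 2 * i + 1) ` {..n}. h n a)"
      by (subst sum.reindex) (auto simp: inj_on_def g_def)
    also have "\<dots> = (\<Sum>a\<in>{a\<in>{w..n}. odd a}. count_ratio (mcount ({k. odd k} - R a)) n (m a))"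
    proof (rule sum.mono_neutral_cong_right)
      show "{a\<in>{w..n}. odd a} \<subseteq> (\<lambda>i. 2 * i + 1) ` {..n}"
      proof
        fix a assume "a \<in> {a\<in>{w..n}. odd a}"
        then have "a = 2 * (a div 2) + 1" "a div 2 \<le> n" by auto
        then show "a \<in> (\<lambda>i. 2 * i + 1) ` {..n}" by blast
      qed
    qed (auto simp: h_def)
    finally show ?thesis .
  qed
  with RL(2) show ?lim
    by (simp add: I_A_def R_def m_def)
qed

section \<open>The number of rows of odd partitions\<close>

text \<open>This is the limit constant for the number of all rows of distinct partitions. The
  antiderivative is \<open>- ln (1 + exp (- x))\<close>.\<close>

lemma I_B_1_1: "I_B 1 1 = ln 2"
proof -
  let ?f = "\<lambda>x::real. exp (- x) / (1 + exp (- x))"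
  have pos: "1 + exp (- x) > 0" for x :: real by (rule one_plus_exp_pos)
  have nn: "?f x \<ge> 0" for x using pos[of x] by simp
  have "(\<integral>\<^sup>+x. ennreal (?f x) * indicator {0..} x \<partial>lborel) = ennreal (- ln (1 + 0) - - ln (1 + exp (- 0)))"
  proof (rule nn_integral_FTC_atLeast)
    fix x :: real
    show "DERIV (\<lambda>x. - ln (1 + exp (- x))) x :> ?f x"
      using pos[of x] by (auto intro!: derivative_eq_intros simp: field_simps)
    show "((\<lambda>x::real. - ln (1 + exp (- x))) \<longlongrightarrow> - ln (1 + 0)) at_top"
      by real_asymp
  qed (use nn in auto)
  then have N: "(\<integral>\<^sup>+x. ennreal (indicator {0..} x * ?f x) \<partial>lborel) = ennreal (ln 2)"
  proof -
    have "ennreal (indicator {0..} x * ?f x) = ennreal (?f x) * indicator {0..} x" for x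
      by (auto simp: indicator_def)
    then show ?thesis using \<open>_ = ennreal (- ln (1 + 0) - - ln (1 + exp (- 0)))\<close> by simp
  qed
  have int: "integrable lborel (\<lambda>x. indicator {0..} x * ?f x)"
    by (rule integrableI_nonneg) (use N nn in auto)
  then have "set_integrable lborel {0..} ?f" by (simp add: set_integrable_def)
  then have "integral {0..} ?f = integral\<^sup>L lborel (\<lambda>x. indicator {0..} x * ?f x)"
    using set_borel_integral_eq_integral(2)[of "{0..}" ?f] by (simp add: set_lebesgue_integral_def)
  also have "\<dots> = ln 2"
    using N nn by (subst integral_eq_nn_integral) auto
  finally show ?thesis by (simp add: I_B_def)
qed

lemma integral_Ici_pos:
  fixes f :: "real \<Rightarrow> real"
  assumes f: "f integrable_on {0..}" and nn: "\<And>x. x \<ge> 0 \<Longrightarrow> f x \<ge> 0"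
    and c: "c > 0" "\<And>x. 1 \<le> x \<Longrightarrow> x \<le> 2 \<Longrightarrow> f x \<ge> c"
  shows "integral {0..} f > 0"
proof -
  have f12: "f integrable_on {1..2}" by (rule integrable_on_subinterval[OF f]) auto
  have "c = integral {1..2::real} (\<lambda>_. c)" by simp
  also have "\<dots> \<le> integral {1..2} f" using c f12 by (intro integral_le) auto
  also have "\<dots> \<le> integral {0..} f" using nn f f12 by (intro integral_subset_le) auto
  finally show ?thesis using c by simp
qed

lemma I_B_pos: "w > 0 \<Longrightarrow> I_B 1 w > 0"
  unfolding I_B_def
proof (rule integral_Ici_pos[where c = "exp (- 2) / 2 ^ w"])
  assume w: "w > 0"
  show "(\<lambda>x. exp (- real 1 * x) / (1 + exp (- x)) ^ w) integrable_on {0..}"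
    using distinct_window_limit(1)[of "{0}" w] w by simp
  show "exp (- 2) / 2 ^ w \<le> exp (- real 1 * x) / (1 + exp (- x)) ^ w" if "1 \<le> x" "x \<le> 2" for x :: real
    using that one_plus_exp_pos[of "- x"] by (intro frac_le power_mono) auto
qed (use one_plus_exp_pos in \<open>auto simp: less_imp_le\<close>)

text \<open>Where the integral diverges, \<open>integral\<close> has the value 0, so the bound holds
  there as well.\<close>

lemma I_B_nonneg: "I_B j w \<ge> 0"
  unfolding I_B_def
  by (cases "(\<lambda>x. exp (- real j * x) / (1 + exp (- x)) ^ w) integrable_on {0..}")
     (auto simp: not_integrable_integral add_nonneg_nonneg intro!: integral_nonneg)

lemma I_A_pos: "h > 0 \<Longrightarrow> I_A 0 (2 * h) > 0"
  unfolding I_A_def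
proof (rule integral_Ici_pos[where c = "exp (- (2 * real (2 * h)))"])
  assume h: "h > 0"
  show "(\<lambda>x. (1 - exp (-2 * x)) ^ 0 * exp (- real (2 * h) * x)) integrable_on {0..}"
    using odd_window_limit(1)[of 1 1 "[h - 1]"] h by (simp add: of_nat_diff)
  show "exp (- (2 * real (2 * h))) \<le> (1 - exp (-2 * x)) ^ 0 * exp (- real (2 * h) * x)"
    if "1 \<le> x" "x \<le> 2" for x :: real
    using mult_left_mono[OF that(2), of "real (2 * h)"] by simp
qed auto

lemma I_A_nonneg: "I_A j l \<ge> 0"
  unfolding I_A_def
  by (cases "(\<lambda>x. (1 - exp (-2 * x)) ^ j * exp (- real l * x)) integrable_on {0..}")
     (auto simp: not_integrable_integral intro!: integral_nonneg)

text \<open>The term with \<open>j = 0\<close> is already positive. Positivity turns the limit of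
  the probability into an asymptotic equivalence.\<close>

lemma alpha_pos: "h \<ge> 1 \<Longrightarrow> alpha h > 0"
proof -
  assume h: "h \<ge> 1"
  let ?f = "\<lambda>j. real ((h - j - 1) choose j) * I_A j (2 * h - 4 * j)"
  have "0 < nat \<lceil>real h / 2\<rceil>" using h by simp
  then have "?f 0 \<le> (\<Sum>j<nat \<lceil>real h / 2\<rceil>. ?f j)"
    by (intro member_le_sum) (auto simp: I_A_nonneg)
  moreover have "?f 0 > 0" using I_A_pos[of h] h by simp
  moreover have "(\<Sum>j<nat \<lfloor>real h / 2\<rfloor>. real ((h - j - 2) choose j) * I_A j (2 * h - 4 * j - 2)) \<ge> 0"
    by (intro sum_nonneg mult_nonneg_nonneg I_A_nonneg) auto
  ultimately show ?thesis unfolding alpha_def by linarith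
qed

lemma beta_pos: "h \<ge> 1 \<Longrightarrow> beta h > 0"
proof -
  assume h: "h \<ge> 1"
  let ?f = "\<lambda>j. real ((h - j - 1) choose j) * I_B (j + 1) (h - j)"
  have "0 < nat \<lceil>real h / 2\<rceil>" using h by simp
  then have "?f 0 \<le> (\<Sum>j<nat \<lceil>real h / 2\<rceil>. ?f j)"
    by (intro member_le_sum) (auto simp: I_B_nonneg)
  moreover have "?f 0 > 0" using I_B_pos[of h] h by simp
  ultimately show ?thesis unfolding beta_def by linarith
qed

section \<open>Harmonic sums over odd numbers and the total number of rows\<close>

definition odd_harm :: "nat \<Rightarrow> real" where
  "odd_harm L = (\<Sum>a\<in>{a\<in>{1..L}. odd a}. 1 / real a)"

lemma harm_le: "n \<ge> 1 \<Longrightarrow> harm n \<le> 1 + ln (real n)"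
proof (induction n rule: nat_induct_at_least)
  case base
  then show ?case by (simp add: harm_expand)
next
  case (Suc n)
  have "harm (Suc (Suc (n - 1))) - ln (real (Suc (Suc (n - 1)))) \<le> harm (Suc (n - 1)) - ln (real (Suc (n - 1)))"
    using decseq_harm_diff_ln unfolding decseq_Suc_iff by blast
  then show ?case using Suc by simp
qed

text \<open>Comparison of \<open>1 / (2 i + 1)\<close> with \<open>1 / (2 i)\<close>; with the
  converse comparison in \<open>odd_harm_ge\<close> this fixes the leading term
  \<open>ln L / 2\<close>.\<close>

lemma odd_harm_le: "L \<ge> 1 \<Longrightarrow> odd_harm L \<le> 3 / 2 + ln (real L) / 2"
proof -
  assume L: "L \<ge> 1"
  have sub: "{a\<in>{1..L}. odd a} \<subseteq> insert 1 ((\<lambda>i. 2 * i + 1) ` {1..L})"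
  proof
    fix a assume a: "a \<in> {a\<in>{1..L}. odd a}"
    then have "a = 2 * (a div 2) + 1" "a div 2 \<le> L" by auto
    then show "a \<in> insert 1 ((\<lambda>i. 2 * i + 1) ` {1..L})" by (cases "a div 2 = 0") force+
  qed
  have "odd_harm L \<le> (\<Sum>a\<in>insert 1 ((\<lambda>i. 2 * i + 1) ` {1..L}). 1 / real a)"
    unfolding odd_harm_def by (rule sum_mono2[OF _ sub]) auto
  also have "\<dots> = 1 + (\<Sum>i=1..L. 1 / real (2 * i + 1))"
    by (subst sum.insert) (auto simp: sum.reindex inj_on_def)
  also have "\<dots> \<le> 1 + (\<Sum>i=1..L. inverse (real i) / 2)"
    by (intro add_left_mono sum_mono) (auto simp: field_simps)
  also have "\<dots> = 1 + harm L / 2" by (simp add: harm_def sum_divide_distrib)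
  also have "\<dots> \<le> 3 / 2 + ln (real L) / 2" using harm_le[OF L] by simp
  finally show ?thesis .
qed

lemma odd_harm_ge: "odd_harm L \<ge> ln ((real L + 1) / 2) / 2"
proof -
  define N where "N = (L + 1) div 2"
  have sub: "(\<lambda>i. 2 * i - 1) ` {1..N} \<subseteq> {a\<in>{1..L}. odd a}" by (auto simp: N_def)
  have "ln ((real L + 1) / 2) \<le> ln (real N + 1)"
  proof -
    have "L + 1 \<le> 2 * N + 1" by (simp add: N_def)
    then show ?thesis by simp
  qed
  also have "\<dots> \<le> harm N" by (rule ln_le_harm)
  finally have "ln ((real L + 1) / 2) / 2 \<le> harm N / 2" by simp
  also have "harm N / 2 = (\<Sum>i=1..N. inverse (real i) / 2)"
    by (simp add: harm_def sum_divide_distrib)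
  also have "\<dots> \<le> (\<Sum>i=1..N. 1 / real (2 * i - 1))"
    by (intro sum_mono) (auto simp: field_simps of_nat_diff)
  also have "\<dots> = (\<Sum>a\<in>(\<lambda>i. 2 * i - 1) ` {1..N}. 1 / real a)"
    by (subst sum.reindex) (auto simp: inj_on_def)
  also have "\<dots> \<le> odd_harm L" unfolding odd_harm_def by (rule sum_mono2[OF _ sub]) auto
  finally show ?thesis .
qed

text \<open>Counterpart of \<open>sum_exp_le\<close>: the full geometric series is at least
  \<open>1 / u - 1\<close>, and cutting it off at \<open>n\<close> costs at most the proportion
  \<open>r\<close>.\<close>

lemma sum_exp_ge:
  assumes u: "0 < u" "u \<le> (1::real)" and r: "exp (- (u * real n)) \<le> r"
  shows "(\<Sum>k=1..n. exp (- u * real k)) \<ge> (1 / u - 1) * (1 - r)"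
proof -
  define x where "x = exp (- u)"
  have x: "0 < x" "x < 1" using u by (auto simp: x_def)
  have S: "(1 - x) * (\<Sum>k=1..n. x ^ k) = x - x ^ Suc n"
    by (rule sum_power_telescope)
  have xn: "x ^ n = exp (- (u * real n))" by (simp add: x_def exp_of_nat_mult[symmetric] mult.commute)
  have "(1 / u - 1) * (1 - x) \<le> x"
  proof -
    have "exp u \<le> 1 + u + u\<^sup>2" using u by (intro exp_bound) auto
    then have "(1 / u - 1) * (exp u - 1) \<le> (1 / u - 1) * (u + u\<^sup>2)"
      using u by (intro mult_left_mono) auto
    also have "\<dots> = 1 - u\<^sup>2" using u by (simp add: field_simps power2_eq_square)
    also have "\<dots> \<le> 1" by simp
    finally have "(1 / u - 1) * (exp u - 1) * x \<le> 1 * x" using x by (intro mult_right_mono) auto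
    moreover have "(exp u - 1) * x = 1 - x" by (simp add: x_def left_diff_distrib exp_add[symmetric])
    ultimately show ?thesis by (simp only: mult.assoc)
  qed
  then have "1 / u - 1 \<le> x / (1 - x)" using x by (simp add: field_simps)
  then have "(1 / u - 1) * (1 - r) \<le> x / (1 - x) * (1 - x ^ n)"
  proof (cases "r \<le> 1")
    case True
    have "(1 / u - 1) * (1 - r) \<le> x / (1 - x) * (1 - r)"
      using \<open>1 / u - 1 \<le> x / (1 - x)\<close> True by (intro mult_right_mono) auto
    also have "\<dots> \<le> x / (1 - x) * (1 - x ^ n)"
      using r x unfolding xn by (intro mult_left_mono) auto
    finally show ?thesis .
  next
    case False
    have "(1 / u - 1) * (1 - r) \<le> 0" using u False by (intro mult_nonneg_nonpos) auto
    also have "0 \<le> x / (1 - x) * (1 - x ^ n)" using x by (auto simp: power_le_one)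
    finally show ?thesis .
  qed
  also have "\<dots> = (\<Sum>k=1..n. x ^ k)" using S x by (simp add: field_simps)
  also have "\<dots> = (\<Sum>k=1..n. exp (- u * real k))"
    by (simp add: x_def exp_of_nat_mult[symmetric] mult.commute)
  finally show ?thesis .
qed

text \<open>Main term for the number of rows of odd partitions: the pair \<open>(a, k)\<close>
  stands for the \<open>k\<close>-th copy of the part \<open>a\<close>, which is present with
  probability about \<open>exp (- t k a)\<close>.\<close>

definition odd_exp_sum :: "nat \<Rightarrow> real \<Rightarrow> real" where
  "odd_exp_sum n t = (\<Sum>a\<in>{a\<in>{1..n}. odd a}. \<Sum>k=1..n. exp (- (t * real (k * a))))"

text \<open>Parts up to about \<open>1 / t\<close> contribute at most \<open>1 / (t a)\<close> each,
  a harmonic sum. For larger ones half of the exponent is split off using \<open>k \<ge> 1\<close>,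
  and what is left is a geometric series bounded by 2; their total is
  \<open>O (1 / t)\<close>.\<close>

lemma odd_exp_sum_le:
  assumes t: "0 < t" "t \<le> 1"
  shows "t * odd_exp_sum n t \<le> 6 + ln (2 / t) / 2"
proof -
  define L where "L = nat \<lceil>1 / t\<rceil>"
  have t1: "1 / t \<ge> 1" using t by simp
  then have L: "real L \<ge> 1 / t" "real L \<le> 2 / t" "L \<ge> 1" unfolding L_def by linarith+
  have inner: "(\<Sum>k=1..n. exp (- (t * real (k * a)))) \<le> (if a \<le> L then 1 / (t * real a) else 0) + 2 * exp (- (t / 2) * real a)"
    if a: "a \<ge> 1" for a
  proof (cases "a \<le> L")
    case True
    have "(\<Sum>k=1..n. exp (- (t * real (k * a)))) = (\<Sum>k=1..n. exp (- (t * real a) * real k))"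
      by (simp add: mult_ac)
    also have "\<dots> \<le> 1 / (t * real a)" using t a by (intro sum_exp_le) auto
    finally show ?thesis using True by (auto intro: add_increasing2)
  next
    case False
    have ta: "t * real a \<ge> 1"
    proof -
      have "1 / t \<le> real a" using False L by linarith
      then show ?thesis using t by (simp add: field_simps)
    qed
    have "(\<Sum>k=1..n. exp (- (t * real (k * a)))) \<le> (\<Sum>k=1..n. exp (- (t / 2) * real a) * exp (- (t * real a / 2) * real k))"
    proof (rule sum_mono)
      fix k assume "k \<in> {1..n}"
      then have "t * real a * 1 \<le> t * real a * real k" using ta by (intro mult_left_mono) auto
      then show "exp (- (t * real (k * a))) \<le> exp (- (t / 2) * real a) * exp (- (t * real a / 2) * real k)"
        unfolding exp_add[symmetric] by (simp add: mult_ac)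
    qed
    also have "\<dots> = exp (- (t / 2) * real a) * (\<Sum>k=1..n. exp (- (t * real a / 2) * real k))"
      by (simp add: sum_distrib_left)
    also have "\<dots> \<le> exp (- (t / 2) * real a) * (1 / (t * real a / 2))"
      using t a by (intro mult_left_mono sum_exp_le) auto
    also have "\<dots> \<le> exp (- (t / 2) * real a) * 2"
      using ta by (intro mult_left_mono) (auto simp: field_simps)
    finally show ?thesis using False by simp
  qed
  have "odd_exp_sum n t \<le> (\<Sum>a\<in>{a\<in>{1..n}. odd a}. (if a \<le> L then 1 / (t * real a) else 0) + 2 * exp (- (t / 2) * real a))"
    unfolding odd_exp_sum_def by (intro sum_mono inner) auto
  also have "\<dots> = (\<Sum>a\<in>{a\<in>{1..n}. odd a}. if a \<le> L then 1 / (t * real a) else 0) + 2 * (\<Sum>a\<in>{a\<in>{1..n}. odd a}. exp (- (t / 2) * real a))"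
    by (simp add: sum.distrib sum_distrib_left)
  also have "(\<Sum>a\<in>{a\<in>{1..n}. odd a}. if a \<le> L then 1 / (t * real a) else 0) \<le> odd_harm L / t"
  proof -
    have "(\<Sum>a\<in>{a\<in>{1..n}. odd a}. if a \<le> L then 1 / (t * real a) else 0) = (\<Sum>a\<in>{a\<in>{1..n}. odd a \<and> a \<le> L}. 1 / (t * real a))"
      by (rule sum.mono_neutral_cong_right) auto
    also have "\<dots> \<le> (\<Sum>a\<in>{a\<in>{1..L}. odd a}. 1 / (t * real a))"
      using t by (intro sum_mono2) auto
    also have "\<dots> = odd_harm L / t" by (simp add: odd_harm_def sum_divide_distrib mult.commute)
    finally show ?thesis .
  qed
  also have "(\<Sum>a\<in>{a\<in>{1..n}. odd a}. exp (- (t / 2) * real a)) \<le> (\<Sum>a=1..n. exp (- (t / 2) * real a))"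
    by (intro sum_mono2) auto
  also have "\<dots> \<le> 1 / (t / 2)" using t by (intro sum_exp_le) auto
  finally have "odd_exp_sum n t \<le> odd_harm L / t + 4 / t" by simp
  then have "t * odd_exp_sum n t \<le> t * (odd_harm L / t + 4 / t)" using t by (intro mult_left_mono) auto
  also have "\<dots> = odd_harm L + 4" using t by (simp add: field_simps)
  also have "odd_harm L \<le> 3 / 2 + ln (real L) / 2" using L by (intro odd_harm_le)
  also have "ln (real L) \<le> ln (2 / t)" using L t by simp
  finally show ?thesis by simp
qed

text \<open>Only parts up to \<open>1 / t\<close> are kept. The \<open>- 1\<close> in
  \<open>sum_exp_ge\<close> then costs at most \<open>t * L \<le> 1\<close> in total.\<close>

lemma odd_exp_sum_ge:
  assumes t: "0 < t" "1 / t \<le> real n" and r: "exp (- (t * real n)) \<le> r" "r \<le> 1"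
  shows "t * odd_exp_sum n t \<ge> (1 - r) * (ln (1 / (2 * t)) / 2 - 1)"
proof -
  define L where "L = nat \<lfloor>1 / t\<rfloor>"
  have "1 / t > 0" using t by simp
  then have L: "real L \<le> 1 / t" "real L + 1 \<ge> 1 / t" unfolding L_def by linarith+
  then have Ln: "L \<le> n" using t by linarith
  have tL: "t * real L \<le> 1" using L(1) t by (simp add: field_simps)
  have "(\<Sum>a\<in>{a\<in>{1..L}. odd a}. (1 / (t * real a) - 1) * (1 - r))
     \<le> (\<Sum>a\<in>{a\<in>{1..L}. odd a}. \<Sum>k=1..n. exp (- (t * real (k * a))))"
  proof (rule sum_mono)
    fix a assume "a \<in> {a\<in>{1..L}. odd a}"
    then have a: "a \<ge> 1" "a \<le> L" by auto
    have "t * real a \<le> t * real L" using a t by (intro mult_left_mono) auto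
    then have ta: "t * real a \<le> 1" using tL by simp
    have "t * 1 * real n \<le> t * real a * real n" using a t by (intro mult_left_mono mult_right_mono) auto
    then have "exp (- (t * real a * real n)) \<le> r" using r by (intro order_trans[OF _ r(1)]) auto
    then have "(1 / (t * real a) - 1) * (1 - r) \<le> (\<Sum>k=1..n. exp (- (t * real a) * real k))"
      using t a ta by (intro sum_exp_ge) auto
    then show "(1 / (t * real a) - 1) * (1 - r) \<le> (\<Sum>k=1..n. exp (- (t * real (k * a))))"
      by (simp add: mult_ac)
  qed
  also have "\<dots> \<le> odd_exp_sum n t"
    unfolding odd_exp_sum_def using Ln by (intro sum_mono2) (auto intro!: sum_nonneg)
  finally have "t * (\<Sum>a\<in>{a\<in>{1..L}. odd a}. (1 / (t * real a) - 1) * (1 - r)) \<le> t * odd_exp_sum n t"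
    using t by (intro mult_left_mono) auto
  also have "t * (\<Sum>a\<in>{a\<in>{1..L}. odd a}. (1 / (t * real a) - 1) * (1 - r))
     = (1 - r) * (odd_harm L - t * real (card {a\<in>{1..L}. odd a}))"
  proof -
    have "t * (\<Sum>a\<in>{a\<in>{1..L}. odd a}. (1 / (t * real a) - 1) * (1 - r)) = (1 - r) * (\<Sum>a\<in>{a\<in>{1..L}. odd a}. 1 / real a - t)"
      unfolding sum_distrib_left using t by (intro sum.cong) (auto simp: field_simps)
    then show ?thesis by (simp add: sum_subtractf odd_harm_def)
  qed
  finally have A: "(1 - r) * (odd_harm L - t * real (card {a\<in>{1..L}. odd a})) \<le> t * odd_exp_sum n t" .
  have "card {a\<in>{1..L}. odd a} \<le> card {1..L}" by (rule card_mono) auto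
  then have "t * real (card {a\<in>{1..L}. odd a}) \<le> t * real L" using t by (intro mult_left_mono) auto
  then have "t * real (card {a\<in>{1..L}. odd a}) \<le> 1" using tL by simp
  moreover have "ln (1 / (2 * t)) / 2 \<le> odd_harm L"
  proof -
    have "1 / (2 * t) \<le> (real L + 1) / 2" using L(2) by simp
    then have "ln (1 / (2 * t)) \<le> ln ((real L + 1) / 2)" using t by (subst ln_le_cancel_iff) auto
    then show ?thesis using odd_harm_ge[of L] by simp
  qed
  ultimately have "(1 - r) * (ln (1 / (2 * t)) / 2 - 1) \<le> (1 - r) * (odd_harm L - t * real (card {a\<in>{1..L}. odd a}))"
    using r by (intro mult_left_mono) auto
  then show ?thesis using A by simp
qed

text \<open>One factor 1/2 is the density of the odd numbers in the harmonic sum, the other comes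
  from \<open>ln (1 / t)\<close> being asymptotic to \<open>ln n / 2\<close>. Replacing the ratios
  by exponentials costs \<open>sqrt t * (1 + ln n)\<close> up to a constant, which vanishes after
  division by \<open>ln n\<close>.\<close>

lemma odd_rows_limit:
  "(\<lambda>n. saddle n * (\<Sum>a\<in>{a\<in>{1..n}. odd a}. \<Sum>k=1..n. count_ratio (dcount {}) n (k * a)) / ln (real n)) \<longlonglongrightarrow> 1 / 4"
proof -
  let ?T = "\<lambda>n. \<Sum>a\<in>{a\<in>{1..n}. odd a}. \<Sum>k=1..n. count_ratio (dcount {}) n (k * a)"
  obtain C where C: "C > 0"
    "ratio_estimate C"
    using dcount_ratio by blast
  have err: "\<forall>\<^sub>F n in sequentially. \<bar>saddle n * ?T n - saddle n * odd_exp_sum n (saddle n)\<bar> \<le> 2 * C * sqrt (saddle n) * (1 + ln (real n))"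
    using C(2) eventually_ge_at_top[of 36]
  proof eventually_elim
    case (elim n)
    define t where "t = saddle n"
    have t: "t > 0" using elim saddle_pos by (simp add: t_def)
    have "\<bar>?T n - odd_exp_sum n t\<bar> \<le> (\<Sum>a\<in>{a\<in>{1..n}. odd a}. \<Sum>k=1..n. \<bar>count_ratio (dcount {}) n (k * a) - exp (- (t * real (k * a)))\<bar>)"
      unfolding odd_exp_sum_def sum_subtractf[symmetric]
      by (intro order_trans[OF sum_abs] sum_mono order_refl)
    also have "\<dots> \<le> (\<Sum>a\<in>{a\<in>{1..n}. odd a}. \<Sum>k=1..n. C * sqrt t * exp (- (t * real (k * a)) / 2))"
      using elim(1) unfolding t_def by (intro sum_mono) blast
    also have "\<dots> \<le> (\<Sum>a=1..n. \<Sum>k=1..n. C * sqrt t * exp (- (t * real (k * a)) / 2))"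
      using C(1) t by (intro sum_mono2 sum_nonneg) auto
    also have "\<dots> = (\<Sum>a=1..n. C * sqrt t * (\<Sum>k=1..n. exp (- (t * real a / 2) * real k)))"
      by (simp add: sum_distrib_left mult_ac)
    also have "\<dots> \<le> (\<Sum>a=1..n. C * sqrt t * (1 / (t * real a / 2)))"
      using C(1) t by (intro sum_mono mult_left_mono sum_exp_le) auto
    also have "\<dots> = 2 * C * sqrt t / t * harm n"
      unfolding harm_def sum_distrib_left using t by (intro sum.cong refl) (simp add: field_simps)
    also have "\<dots> \<le> 2 * C * sqrt t / t * (1 + ln (real n))"
      using C(1) t elim by (intro mult_left_mono harm_le) auto
    finally have "t * \<bar>?T n - odd_exp_sum n t\<bar> \<le> t * (2 * C * sqrt t / t * (1 + ln (real n)))"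
      using t by (intro mult_left_mono) auto
    then show ?case using t by (simp add: t_def abs_mult right_diff_distrib[symmetric])
  qed
  have "(\<lambda>n. (saddle n * ?T n - saddle n * odd_exp_sum n (saddle n)) / ln (real n)) \<longlonglongrightarrow> 0"
  proof (rule Lim_null_comparison)
    show "\<forall>\<^sub>F n in sequentially. norm ((saddle n * ?T n - saddle n * odd_exp_sum n (saddle n)) / ln (real n))
       \<le> 2 * C * sqrt (saddle n) * ((1 + ln (real n)) / ln (real n))"
      using err eventually_ge_at_top[of 2]
    proof eventually_elim
      case (elim n)
      then have "ln (real n) > 0" by simp
      then show ?case using divide_right_mono[OF elim(1), of "ln (real n)"] by (simp add: abs_divide)
    qed
    have "(\<lambda>n::nat. (1 + ln (real n)) / ln (real n)) \<longlonglongrightarrow> 1" by real_asymp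
    from tendsto_mult[OF tendsto_mult[OF tendsto_const tendsto_real_sqrt[OF saddle_tendsto]] this]
    show "(\<lambda>n. 2 * C * sqrt (saddle n) * ((1 + ln (real n)) / ln (real n))) \<longlonglongrightarrow> 0"
      by simp
  qed
  moreover have "(\<lambda>n. saddle n * odd_exp_sum n (saddle n) / ln (real n)) \<longlonglongrightarrow> 1 / 4"
  proof (rule tendsto_sandwich)
    have s1: "\<forall>\<^sub>F n in sequentially. saddle n < 1" by (rule order_tendstoD(2)[OF saddle_tendsto]) simp
    show "\<forall>\<^sub>F n in sequentially. saddle n * odd_exp_sum n (saddle n) / ln (real n) \<le> (6 + ln (12 * sqrt (real n)) / 2) / ln (real n)"
      using s1 eventually_ge_at_top[of 36]
    proof eventually_elim
      case (elim n)
      have p: "saddle n > 0" using elim saddle_pos by simp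
      have "2 / saddle n \<le> 2 / (1 / (6 * sqrt n))"
        using saddle(1)[of n] elim p by (intro divide_left_mono mult_pos_pos) auto
      then have "ln (2 / saddle n) \<le> ln (12 * sqrt n)" using p elim by (subst ln_le_cancel_iff) auto
      then have "saddle n * odd_exp_sum n (saddle n) \<le> 6 + ln (12 * sqrt (real n)) / 2"
        using odd_exp_sum_le[OF p less_imp_le[OF elim(1)], of n] by linarith
      then show ?case using elim by (intro divide_right_mono) auto
    qed
    show "\<forall>\<^sub>F n in sequentially. (1 - exp (- (sqrt (real n) / 6))) * (ln (sqrt (real n) / 4) / 2 - 1) / ln (real n)
       \<le> saddle n * odd_exp_sum n (saddle n) / ln (real n)"
      using s1 eventually_ge_at_top[of 36]
    proof eventually_elim
      case (elim n)
      have p: "saddle n > 0" using elim saddle_pos by simp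
      have "1 / (6 * sqrt n) * real n \<le> saddle n * real n" using saddle(1)[of n] elim by (intro mult_right_mono) auto
      moreover have "1 / (6 * sqrt n) * real n = sqrt n / 6" using elim by (simp add: field_simps)
      ultimately have e: "exp (- (saddle n * real n)) \<le> exp (- (sqrt n / 6))" by simp
      have "sqrt n / 4 \<le> 1 / (2 * saddle n)"
      proof -
        have "sqrt n * saddle n \<le> sqrt n * (2 / sqrt n)" using saddle(2)[of n] elim by (intro mult_left_mono) auto
        then have "sqrt n * saddle n \<le> 2" using elim by simp
        then show ?thesis using p by (simp add: field_simps)
      qed
      then have "ln (sqrt n / 4) \<le> ln (1 / (2 * saddle n))" using p elim by (subst ln_le_cancel_iff) auto
      then have "(1 - exp (- (sqrt n / 6))) * (ln (sqrt n / 4) / 2 - 1) \<le> (1 - exp (- (sqrt n / 6))) * (ln (1 / (2 * saddle n)) / 2 - 1)"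
        by (intro mult_left_mono) auto
      also have "\<dots> \<le> saddle n * odd_exp_sum n (saddle n)"
        using p e elim inverse_saddle_le(1)[of n] by (intro odd_exp_sum_ge) auto
      finally show ?case using elim by (intro divide_right_mono) auto
    qed
    show "(\<lambda>n. (6 + ln (12 * sqrt (real n)) / 2) / ln (real n)) \<longlonglongrightarrow> 1 / 4" by real_asymp
    show "(\<lambda>n. (1 - exp (- (sqrt (real n) / 6))) * (ln (sqrt (real n) / 4) / 2 - 1) / ln (real n)) \<longlonglongrightarrow> 1 / 4"
      by real_asymp
  qed
  ultimately have "(\<lambda>n. (saddle n * ?T n - saddle n * odd_exp_sum n (saddle n)) / ln (real n)
     + saddle n * odd_exp_sum n (saddle n) / ln (real n)) \<longlonglongrightarrow> 0 + 1 / 4"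
    by (rule tendsto_add)
  then show ?thesis by (simp add: diff_divide_distrib)
qed

section \<open>Rows and multisets\<close>

lemma hook_number_row:
  assumes "i < length p" "c < p ! i"
  shows "hook_number p (i, c) = (p ! i - c) + card {k. i < k \<and> k < length p \<and> c < p ! k}"
proof -
  have "hook p (i, c) = Pair i ` {c..<p ! i} \<union> (\<lambda>k. (k, c)) ` {k. i < k \<and> k < length p \<and> c < p ! k}"
    using assms by (force simp: hook_def ferrers_def)
  moreover have "card (Pair i ` {c..<p ! i} \<union> (\<lambda>k. (k, c)) ` {k. i < k \<and> k < length p \<and> c < p ! k})
    = card (Pair i ` {c..<p ! i}) + card ((\<lambda>k. (k, c)) ` {k. i < k \<and> k < length p \<and> c < p ! k})"
    by (rule card_Un_disjoint) auto
  ultimately show ?thesis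
    unfolding hook_number_def by (simp add: card_image inj_on_def)
qed

text \<open>Separates equally long rows of one diagram, so that a row is determined by the multiset
  of parts, its length and this number.\<close>

definition later_copies :: "nat list \<Rightarrow> nat \<Rightarrow> nat" where
  "later_copies p i = card {k. i < k \<and> k < length p \<and> p ! k = p ! i}"

text \<open>The left side is the leg length of the box for which \<open>w\<close> boxes of the row,
  itself included, lie from it to the end. As the parts are sorted, the rows reached are copies of
  the row or belong to strictly smaller parts, and all of the latter lie below it automatically; so
  positions disappear from the count.\<close>

lemma card_later_in_window:
  assumes p: "sorted_wrt (\<ge>) p" and i: "i < length p" and w: "0 < w" "w \<le> p ! i"
  shows "card {k. i < k \<and> k < length p \<and> p ! i - w < p ! k} =
    later_copies p i + size {#x \<in># mset p. p ! i - w < x \<and> x < p ! i#}"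
proof -
  let ?A = "{k. i < k \<and> k < length p \<and> p ! k = p ! i}"
  let ?B = "{k. k < length p \<and> p ! i - w < p ! k \<and> p ! k < p ! i}"
  have le: "p ! l \<le> p ! k" if "k < l" "l < length p" for k l
    using p that by (auto simp: sorted_wrt_iff_nth_less)
  have "i < k" if "k < length p" "p ! k < p ! i" for k
  proof (rule ccontr)
    assume "\<not> i < k"
    then have "p ! i \<le> p ! k" using le[of k i] i by (cases "k = i") auto
    then show False using that by simp
  qed
  moreover have "p ! k = p ! i \<or> p ! k < p ! i" if "i < k" "k < length p" for k
    using le[OF that] by auto
  ultimately have eq: "{k. i < k \<and> k < length p \<and> p ! i - w < p ! k} = ?A \<union> ?B"
    using w by auto
  have "card (?A \<union> ?B) = card ?A + card ?B"
    by (rule card_Un_disjoint) auto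
  also have "card ?B = size {#x \<in># mset p. p ! i - w < x \<and> x < p ! i#}"
    by (simp add: length_filter_conv_card flip: mset_filter)
  finally show ?thesis unfolding eq later_copies_def .
qed

text \<open>Here \<open>j\<close> is the leg length and \<open>h - j\<close> the arm length
  including the box. The condition \<open>h - j \<le> p ! i\<close> says that the box exists and
  keeps the subtraction from being truncated.\<close>

lemma row_has_hook_iff:
  assumes p: "sorted_wrt (\<ge>) p" and i: "i < length p"
  shows "row_has_hook h p i \<longleftrightarrow> (\<exists>j<h. h - j \<le> p ! i \<and>
     later_copies p i + size {#x \<in># mset p. p ! i - (h - j) < x \<and> x < p ! i#} = j)"
proof
  assume "row_has_hook h p i"
  then obtain c where c: "c < p ! i" "hook_number p (i, c) = h"
    by (auto simp: row_has_hook_def ferrers_def)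
  define j where "j = card {k. i < k \<and> k < length p \<and> c < p ! k}"
  have h: "h = (p ! i - c) + j" using hook_number_row[OF i c(1)] c(2) by (simp add: j_def)
  have "j < h" "h - j \<le> p ! i" "p ! i - (h - j) = c" "0 < h - j" using h c by auto
  then show "\<exists>j<h. h - j \<le> p ! i \<and>
     later_copies p i + size {#x \<in># mset p. p ! i - (h - j) < x \<and> x < p ! i#} = j"
    using card_later_in_window[OF p i, of "h - j"] by (intro exI[of _ j]) (auto simp: j_def)
next
  assume "\<exists>j<h. h - j \<le> p ! i \<and>
     later_copies p i + size {#x \<in># mset p. p ! i - (h - j) < x \<and> x < p ! i#} = j"
  then obtain j where j: "j < h" "h - j \<le> p ! i"
    "later_copies p i + size {#x \<in># mset p. p ! i - (h - j) < x \<and> x < p ! i#} = j" by blast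
  define c where "c = p ! i - (h - j)"
  have c: "c < p ! i" "p ! i - c = h - j" using j by (auto simp: c_def)
  have "card {k. i < k \<and> k < length p \<and> c < p ! k} = j"
    using card_later_in_window[OF p i, of "h - j"] j by (simp add: c_def)
  then have "hook_number p (i, c) = h" using hook_number_row[OF i c(1)] c(2) j(1) by simp
  then show "row_has_hook h p i" using i c by (auto simp: row_has_hook_def ferrers_def)
qed

lemma sorted_desc_unique:
  assumes "sorted_wrt (\<ge>) p" "sorted_wrt (\<ge>) q" "mset p = mset (q :: nat list)"
  shows "p = q"
proof -
  have "sorted (rev p)" "sorted (rev q)" using assms by (auto simp: sorted_wrt_rev)
  moreover have "mset (rev p) = mset (rev q)" using assms by simp
  ultimately have "rev p = rev q" by (metis properties_for_sort)
  then show ?thesis by simp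
qed

lemma card_nth_eq_count: "card {k. k < length p \<and> p ! k = a} = count (mset p) a"
  by (simp add: count_mset count_list_eq_length_filter length_filter_conv_card eq_commute)

lemma later_copies_less:
  assumes "i < length p"
  shows "later_copies p i < count (mset p) (p ! i)"
  unfolding later_copies_def card_nth_eq_count[symmetric]
  by (rule psubset_card_mono) (use assms in auto)

lemma later_copies_strict:
  assumes "i < i'" "i' < length p" "p ! i = p ! i'"
  shows "later_copies p i' < later_copies p i"
  unfolding later_copies_def
  by (rule psubset_card_mono) (use assms in auto)

text \<open>\<open>later_copies\<close> is injective on the rows of length \<open>a\<close> with
  values below their number, hence takes every such value.\<close>

lemma exists_later_copies:
  assumes "r < count (mset p) a"
  obtains i where "i < length p" "p ! i = a" "later_copies p i = r"
proof -
  let ?I = "{k. k < length p \<and> p ! k = a}"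
  have inj: "inj_on (later_copies p) ?I"
  proof (rule inj_onI)
    fix i i' assume "i \<in> ?I" "i' \<in> ?I" "later_copies p i = later_copies p i'"
    then show "i = i'"
      using later_copies_strict[of i i' p] later_copies_strict[of i' i p] by (cases i i' rule: linorder_cases) auto
  qed
  have sub: "later_copies p ` ?I \<subseteq> {..<count (mset p) a}" using later_copies_less by auto
  have "later_copies p ` ?I = {..<count (mset p) a}"
    by (rule card_subset_eq[OF _ sub]) (use card_image[OF inj] card_nth_eq_count[of p a] in auto)
  then have "r \<in> later_copies p ` ?I" using assms by auto
  then show thesis using that by auto
qed

text \<open>Passage from rows of sorted lists to triples of multiset, part and number of later
  copies, for any property expressible by these three.\<close>

lemma card_rows_eq:
  assumes P: "\<And>p. p \<in> P \<Longrightarrow> sorted_wrt (\<ge>) p"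
  shows "card {(p, i). p \<in> P \<and> i < length p \<and> \<Phi> (mset p) (p ! i) (later_copies p i)}
    = card {(M, a, r). M \<in> mset ` P \<and> r < count M a \<and> \<Phi> M a r}"
proof (rule bij_betw_same_card[of "\<lambda>(p, i). (mset p, p ! i, later_copies p i)"], rule bij_betwI')
  fix x y
  assume x: "x \<in> {(p, i). p \<in> P \<and> i < length p \<and> \<Phi> (mset p) (p ! i) (later_copies p i)}"
    and y: "y \<in> {(p, i). p \<in> P \<and> i < length p \<and> \<Phi> (mset p) (p ! i) (later_copies p i)}"
  obtain p i q k where xy: "x = (p, i)" "y = (q, k)" by (cases x, cases y)
  have "x = y" if "mset p = mset q" "p ! i = q ! k" "later_copies p i = later_copies q k"
  proof -
    have "p = q" using x y xy that(1) P by (intro sorted_desc_unique) auto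
    moreover have "i = k"
      using that x y xy \<open>p = q\<close> later_copies_strict[of i k p] later_copies_strict[of k i p]
      by (cases i k rule: linorder_cases) auto
    ultimately show ?thesis by (simp add: xy)
  qed
  then show "((case x of (p, i) \<Rightarrow> (mset p, p ! i, later_copies p i)) = (case y of (p, i) \<Rightarrow> (mset p, p ! i, later_copies p i))) = (x = y)"
    by (auto simp: xy)
next
  fix x assume "x \<in> {(p, i). p \<in> P \<and> i < length p \<and> \<Phi> (mset p) (p ! i) (later_copies p i)}"
  then show "(case x of (p, i) \<Rightarrow> (mset p, p ! i, later_copies p i)) \<in> {(M, a, r). M \<in> mset ` P \<and> r < count M a \<and> \<Phi> M a r}"
    using later_copies_less by auto
next
  fix y assume "y \<in> {(M, a, r). M \<in> mset ` P \<and> r < count M a \<and> \<Phi> M a r}"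
  then obtain p a r where p: "p \<in> P" "y = (mset p, a, r)" "r < count (mset p) a" "\<Phi> (mset p) a r" by auto
  obtain i where "i < length p" "p ! i = a" "later_copies p i = r" using exists_later_copies[OF p(3)] .
  then show "\<exists>x\<in>{(p, i). p \<in> P \<and> i < length p \<and> \<Phi> (mset p) (p ! i) (later_copies p i)}.
      y = (case x of (p, i) \<Rightarrow> (mset p, p ! i, later_copies p i))"
    using p by (intro bexI[of _ "(p, i)"]) auto
qed

text \<open>Rows of length \<open>a\<close> in which the box with \<open>w\<close> boxes from it to
  the end has leg length \<open>j\<close>; its hook number is \<open>w + j\<close>.\<close>

definition window_rows :: "nat multiset set \<Rightarrow> nat \<Rightarrow> nat \<Rightarrow> (nat multiset \<times> nat \<times> nat) set" where
  "window_rows X w j = {(M, a, r). M \<in> X \<and> r < count M a \<and> w \<le> a \<and> r + size {#x \<in># M. a - w < x \<and> x < a#} = j}"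

lemma count_le_sum_mset:
  fixes M :: "nat multiset"
  assumes "0 \<notin># M" 
  shows "count M a \<le> \<Sum>\<^sub># M"
  using size_le_sum_mset[OF assms] count_le_size[of M a] by linarith

lemma elem_le_sum_mset:
  fixes M :: "nat multiset"
  shows "a \<in># M \<Longrightarrow> a \<le> \<Sum>\<^sub># M"
  using sum_mset.remove[of a M] by auto

lemma finite_all_rows:
  fixes X :: "nat multiset set"
  assumes "\<And>M. M \<in> X \<Longrightarrow> 0 \<notin># M \<and> \<Sum>\<^sub># M = n"
  shows "finite {(M, a, r). M \<in> X \<and> r < count M a}"
proof (rule finite_subset)
  show "finite ({M. set_mset M \<subseteq> {k. k > 0} \<and> \<Sum>\<^sub># M = n} \<times> {..n} \<times> {..n})"
    by (intro finite_cartesian_product finite_multisets_sum) auto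
  show "{(M, a, r). M \<in> X \<and> r < count M a} \<subseteq> {M. set_mset M \<subseteq> {k. k > 0} \<and> \<Sum>\<^sub># M = n} \<times> {..n} \<times> {..n}"
  proof
    fix y assume "y \<in> {(M, a, r). M \<in> X \<and> r < count M a}"
    then obtain M a r where y: "y = (M, a, r)" and M: "M \<in> X" "r < count M a" by auto
    have "k > 0" if "k \<in># M" for k using assms[OF M(1)] that by (cases k) auto
    moreover have "\<Sum>\<^sub># M = n" using assms[OF M(1)] by simp
    moreover have "a \<in># M" using M(2) by (metis count_eq_zero_iff not_less_zero)
    then have "a \<le> n" using assms[OF M(1)] elem_le_sum_mset by auto
    moreover have "r \<le> n" using M(2) count_le_sum_mset[of M a] assms[OF M(1)] by simp
    ultimately show "y \<in> {M. set_mset M \<subseteq> {k. k > 0} \<and> \<Sum>\<^sub># M = n} \<times> {..n} \<times> {..n}"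
      by (auto simp: y)
  qed
qed

lemma card_hook_rows:
  assumes P: "\<And>p. p \<in> P \<Longrightarrow> sorted_wrt (\<ge>) p"
    and X: "\<And>M. M \<in> mset ` P \<Longrightarrow> 0 \<notin># M \<and> \<Sum>\<^sub># M = n"
  shows "card (diagram_rows P \<inter> {(p, i). row_has_hook h p i}) = (\<Sum>j<h. card (window_rows (mset ` P) (h - j) j))"
proof -
  let ?\<Phi> = "\<lambda>M a r. \<exists>j<h. h - j \<le> a \<and> r + size {#x \<in># M. a - (h - j) < x \<and> x < a#} = j"
  have "diagram_rows P \<inter> {(p, i). row_has_hook h p i} = {(p, i). p \<in> P \<and> i < length p \<and> ?\<Phi> (mset p) (p ! i) (later_copies p i)}"
    using row_has_hook_iff[OF P] by (auto simp: diagram_rows_def)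
  then have "card (diagram_rows P \<inter> {(p, i). row_has_hook h p i}) = card {(M, a, r). M \<in> mset ` P \<and> r < count M a \<and> ?\<Phi> M a r}"
    using card_rows_eq[OF P, where \<Phi> = ?\<Phi>] by simp
  also have "{(M, a, r). M \<in> mset ` P \<and> r < count M a \<and> ?\<Phi> M a r} = (\<Union>j\<in>{..<h}. window_rows (mset ` P) (h - j) j)"
    unfolding window_rows_def by blast
  also have "card \<dots> = (\<Sum>j<h. card (window_rows (mset ` P) (h - j) j))"
  proof (rule card_UN_disjoint)
    show "\<forall>j\<in>{..<h}. finite (window_rows (mset ` P) (h - j) j)"
      using finite_all_rows[of "mset ` P" n] X
      by (auto simp: window_rows_def intro: finite_subset[rotated])
    \<comment> \<open>A row contains at most one box with hook number \<open>h\<close>: a larger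
      \<open>j\<close> narrows the window, which then holds no more parts, although it would have to
      hold more.\<close>
    have False if "j < j'" "j' < h" "x \<in> window_rows (mset ` P) (h - j) j" "x \<in> window_rows (mset ` P) (h - j') j'" for j j' x
    proof -
      obtain M a r where x: "x = (M, a, r)" by (cases x)
      have "{#x \<in># M. a - (h - j') < x \<and> x < a#} \<subseteq># {#x \<in># M. a - (h - j) < x \<and> x < a#}"
        using that by (auto simp: subseteq_mset_def)
      then have "size {#x \<in># M. a - (h - j') < x \<and> x < a#} \<le> size {#x \<in># M. a - (h - j) < x \<and> x < a#}"
        by (rule size_mset_mono)
      then show False using that by (auto simp: window_rows_def x)
    qed
    then show "\<forall>i\<in>{..<h}. \<forall>j\<in>{..<h}. i \<noteq> j \<longrightarrow> window_rows (mset ` P) (h - i) i \<inter> window_rows (mset ` P) (h - j) j = {}"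
      by (metis disjoint_iff lessThan_iff linorder_neqE_nat)
  qed simp
  finally show ?thesis .
qed

lemma card_diagram_rows:
  assumes P: "\<And>p. p \<in> P \<Longrightarrow> sorted_wrt (\<ge>) p"
  shows "card (diagram_rows P) = card {(M, a, r). M \<in> mset ` P \<and> r < count M a}"
  using card_rows_eq[OF P, where \<Phi> = "\<lambda>_ _ _. True"] by (simp add: diagram_rows_def)

lemma mset_partitions: "mset ` partitions n = {M. 0 \<notin># M \<and> \<Sum>\<^sub># M = n}"
proof safe
  fix p assume p: "p \<in> partitions n"
  show "\<Sum>\<^sub># (mset p) = n" using p by (simp add: partitions_def sum_mset_sum_list)
  show False if "0 \<in># mset p" using p that by (auto simp: partitions_def)
next
  fix M :: "nat multiset" assume M: "0 \<notin># M"
  let ?p = "rev (sorted_list_of_multiset M)"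
  have m: "mset ?p = M" by simp
  have "sorted_wrt (\<ge>) ?p" by (simp add: sorted_wrt_rev)
  moreover have "sum_list ?p = \<Sum>\<^sub># M" by (metis m sum_mset_sum_list)
  moreover have "\<forall>k\<in>set ?p. k > 0" using M by (auto intro!: Nat.gr0I)
  ultimately have "?p \<in> partitions (\<Sum>\<^sub># M)" by (simp add: partitions_def)
  then show "M \<in> mset ` partitions (\<Sum>\<^sub># M)" using m by (metis imageI)
qed

lemma mset_odd_partitions: "mset ` odd_partitions n = {M. set_mset M \<subseteq> {k. odd k} \<and> \<Sum>\<^sub># M = n}"
proof -
  have "mset ` odd_partitions n = {M \<in> mset ` partitions n. set_mset M \<subseteq> {k. odd k}}"
    by (auto simp: odd_partitions_def intro!: imageI)
  then show ?thesis by (auto simp: mset_partitions)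
qed

lemma mset_distinct_partitions: "mset ` distinct_partitions n = mset_set ` {S. finite S \<and> 0 \<notin> S \<and> \<Sum>S = n}"
proof -
  have "mset ` distinct_partitions n = {M \<in> mset ` partitions n. M = mset_set (set_mset M)}"
  proof -
    have "distinct p \<longleftrightarrow> mset p = mset_set (set_mset (mset p))" for p :: "nat list"
      by (metis mset_set_set distinct_count_atmost_1 count_mset_set' finite_set_mset mset_eq_setD set_mset_mset One_nat_def)
    then have "distinct_partitions n = {p \<in> partitions n. mset p = mset_set (set_mset (mset p))}"
      unfolding distinct_partitions_def by presburger
    then show ?thesis by blast
  qed
  also have "\<dots> = mset_set ` {S. finite S \<and> 0 \<notin> S \<and> \<Sum>S = n}"
  proof (intro subset_antisym subsetI)
    fix M assume "M \<in> {M \<in> mset ` partitions n. M = mset_set (set_mset M)}"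
    then have M: "M \<in> mset ` partitions n" "M = mset_set (set_mset M)" by auto
    have "\<Sum>(set_mset M) = \<Sum>\<^sub># (mset_set (set_mset M))"
      by (simp add: sum_unfold_sum_mset)
    then have "\<Sum>(set_mset M) = n" using M by (simp add: mset_partitions)
    then show "M \<in> mset_set ` {S. finite S \<and> 0 \<notin> S \<and> \<Sum>S = n}"
      using M by (intro image_eqI[where x = "set_mset M"]) (auto simp: mset_partitions)
  next
    fix M assume "M \<in> mset_set ` {S. finite S \<and> 0 \<notin> S \<and> \<Sum>S = n}"
    then obtain S :: "nat set" where S: "finite S" "0 \<notin> S" "\<Sum>S = n" "M = mset_set S" by auto
    then show "M \<in> {M \<in> mset ` partitions n. M = mset_set (set_mset M)}"
      by (simp add: mset_partitions sum_unfold_sum_mset)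
  qed
  finally show ?thesis .
qed

section \<open>Counting rows with a given window\<close>

abbreviation distinct_msets :: "nat \<Rightarrow> nat multiset set" where
  "distinct_msets n \<equiv> mset_set ` {S. finite S \<and> 0 \<notin> S \<and> \<Sum>S = n}"

abbreviation odd_msets :: "nat \<Rightarrow> nat multiset set" where
  "odd_msets n \<equiv> {M. set_mset M \<subseteq> {k. odd k} \<and> \<Sum>\<^sub># M = n}"

lemma inj_on_minus_nat:
  assumes "A \<subseteq> {..a}"
  shows "inj_on (\<lambda>i. a - i :: nat) A"
proof (rule inj_onI)
  fix i k assume "i \<in> A" "k \<in> A" "a - i = a - k"
  moreover from this assms have "i \<le> a" "k \<le> a" by auto
  ultimately show "i = k" by simp
qed

text \<open>A row corresponds to \<open>(J, a, S)\<close>, where \<open>J\<close> records which of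
  the values \<open>a - 1, ..., a - w + 1\<close> are parts. Parts being distinct,
  \<open>r = 0\<close> and the leg length is \<open>card J\<close>. With \<open>a\<close> present
  this settles the whole window, so \<open>card_sets_fixed_part\<close> applies.\<close>

lemma card_distinct_window_rows:
  assumes w: "w > 0"
  shows "real (card (window_rows (distinct_msets n) w j)) / real (dcount {} n) =
    (\<Sum>J\<in>{J. J \<subseteq> {1..<w} \<and> card J = j}. \<Sum>a\<in>{w..n}.
       count_ratio (dcount ((\<lambda>i. a - i) ` {..<w})) n (\<Sum>i\<in>insert 0 J. a - i))"
proof -
  let ?Js = "{J. J \<subseteq> {1..<w} \<and> card J = j}"
  let ?T = "\<lambda>a J. (\<lambda>i. a - i) ` insert 0 J"
  let ?W = "\<lambda>a::nat. (\<lambda>i. a - i) ` {..<w}"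
  define Y where "Y a J = {S. finite S \<and> 0 \<notin> S \<and> \<Sum>S = n \<and> S \<inter> ?W a = ?T a J}" for a J
  have YD: "finite S" "0 \<notin> S" "\<Sum>S = n" "S \<inter> ?W a = ?T a J" if "S \<in> Y a J" for S a J
    using that unfolding Y_def by blast+
  have YI: "S \<in> Y a J" if "finite S" "0 \<notin> S" "\<Sum>S = n" "S \<inter> ?W a = ?T a J" for S a J
    using that unfolding Y_def by blast
  have finY: "finite (Y a J)" for a J
    by (rule finite_subset[OF _ finite_dcount_sets[of "{}" n]]) (use YD(1-3) in blast)
  have finJs: "finite ?Js" by simp
  let ?g = "\<lambda>(M, a, r). ({i\<in>{1..<w}. a - i \<in># M}, a, set_mset M)"
  let ?f = "\<lambda>(J, a, S). (mset_set S, a, 0)"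
  let ?D = "SIGMA J:?Js. SIGMA a:{w..n}. Y a J"
  have "bij_betw ?f ?D (window_rows (distinct_msets n) w j)"
  proof (rule bij_betwI[where g = "?g"])
    show "?f \<in> ?D \<rightarrow> window_rows (distinct_msets n) w j"
    proof (rule funcsetI)
      fix y assume "y \<in> ?D"
      then obtain J a S where y: "y = (J, a, S)" and J: "J \<subseteq> {1..<w}" "card J = j" and a: "w \<le> a" "a \<le> n"
        and "S \<in> Y a J" by auto
      note S = YD[OF \<open>S \<in> Y a J\<close>]
      have "a \<in> ?T a J" by auto
      then have aS: "a \<in> S" using S(4) by blast
      have inj: "inj_on (\<lambda>i. a - i) J" using J a by (intro inj_on_minus_nat) (auto dest: subsetD[OF J(1)])
      have "{x \<in> S. a - w < x \<and> x < a} = (\<lambda>i. a - i) ` J"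
      proof (intro subset_antisym subsetI)
        fix x assume x: "x \<in> {x \<in> S. a - w < x \<and> x < a}"
        then have "x = a - (a - x)" "a - x < w" using a by auto
        then have "x \<in> ?W a" by blast
        then have "x \<in> ?T a J" using x S(4) by blast
        then show "x \<in> (\<lambda>i. a - i) ` J" using x by auto
      next
        fix x assume x: "x \<in> (\<lambda>i. a - i) ` J"
        then have "x \<in> S" using S(4) by blast
        moreover obtain i where "i \<in> J" "x = a - i" using x by blast
        moreover from \<open>i \<in> J\<close> have "1 \<le> i" "i < w" using J(1) by auto
        ultimately show "x \<in> {x \<in> S. a - w < x \<and> x < a}" using a by auto
      qed
      then have "size {#x \<in># mset_set S. a - w < x \<and> x < a#} = j"
        using S(1) J card_image[OF inj] by (simp add: filter_mset_mset_set)
      then show "?f y \<in> window_rows (distinct_msets n) w j"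
        using S a aS by (auto simp: y window_rows_def count_mset_set')
    qed
    show "?g \<in> window_rows (distinct_msets n) w j \<rightarrow> ?D"
    proof (rule funcsetI)
      fix y assume "y \<in> window_rows (distinct_msets n) w j"
      then obtain S a r where y: "y = (mset_set S, a, r)" and S: "finite S" "0 \<notin> S" "\<Sum>S = n"
        and r: "r < count (mset_set S) a" and a: "w \<le> a"
        and sz: "r + size {#x \<in># mset_set S. a - w < x \<and> x < a#} = j"
        by (auto simp: window_rows_def)
      have aS: "a \<in> S" "r = 0" using r S by (auto simp: count_mset_set' split: if_splits)
      define J where "J = {i\<in>{1..<w}. a - i \<in> S}"
      have inj: "inj_on (\<lambda>i. a - i) J" using a by (intro inj_on_minus_nat) (auto simp: J_def)
      have "{x \<in> S. a - w < x \<and> x < a} = (\<lambda>i. a - i) ` J"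
      proof (intro subset_antisym subsetI)
        fix x assume x: "x \<in> {x \<in> S. a - w < x \<and> x < a}"
        then have "x = a - (a - x)" "a - x \<in> {1..<w}" using a by auto
        then show "x \<in> (\<lambda>i. a - i) ` J" using x unfolding J_def by force
      qed (use a in \<open>auto simp: J_def\<close>)
      then have "card J = j"
        using sz aS S(1) card_image[OF inj] by (simp add: filter_mset_mset_set)
      moreover have "S \<inter> ?W a = ?T a J"
      proof (intro subset_antisym subsetI)
        fix x assume "x \<in> S \<inter> ?W a"
        then obtain i where i: "i < w" "x = a - i" "x \<in> S" by auto
        then have "i \<in> insert 0 J" by (auto simp: J_def)
        then show "x \<in> ?T a J" using i by blast
      next
        fix x assume "x \<in> ?T a J"
        then obtain i where i: "x = a - i" "i \<in> insert 0 J" by (elim imageE)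
        then have "i \<in> {..<w}" "x \<in> S" using aS w by (auto simp: J_def)
        then show "x \<in> S \<inter> ?W a" using i(1) by blast
      qed
      moreover have "a \<le> n" using sum_mem_le[OF S(1) aS(1)] S by simp
      moreover have "J \<subseteq> {1..<w}" by (auto simp: J_def)
      ultimately show "?g y \<in> ?D"
      proof -
        assume J: "card J = j" "S \<inter> ?W a = ?T a J" "a \<le> n" "J \<subseteq> {1..<w}"
        have e: "{i\<in>{1..<w}. a - i \<in># mset_set S} = J" "set_mset (mset_set S) = S"
          using S(1) by (simp_all add: J_def)
        show ?thesis
          unfolding y prod.case e(1) unfolding e(2) using S a J by (intro SigmaI CollectI conjI YI) auto
      qed
    qed
  next
    fix y assume "y \<in> ?D"
    then obtain J a S where y: "y = (J, a, S)" and J: "J \<subseteq> {1..<w}" and a: "w \<le> a"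
      and "S \<in> Y a J" by auto
    note S = YD(1,4)[OF \<open>S \<in> Y a J\<close>]
    have "i \<in> J" if "i \<in> {1..<w}" "a - i \<in> S" for i
    proof -
      have "a - i \<in> ?T a J" using that S(2) by auto
      then obtain i' where "i' \<in> insert 0 J" "a - i = a - i'" by (elim imageE)
      moreover have "i' < w" using \<open>i' \<in> insert 0 J\<close> J w by auto
      ultimately have "i = i'" using that a by auto
      then show ?thesis using \<open>i' \<in> insert 0 J\<close> that by auto
    qed
    moreover have "a - i \<in> S" if "i \<in> J" for i using S(2) that by blast
    ultimately have "{i\<in>{1..<w}. a - i \<in> S} = J" using J by blast
    then show "?g (?f y) = y"
      using S(1) by (simp add: y)
  next
    fix y assume "y \<in> window_rows (distinct_msets n) w j"
    then show "?f (?g y) = y"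
      by (auto simp: window_rows_def count_mset_set' split: if_splits)
  qed
  then have "card (window_rows (distinct_msets n) w j) = card ?D"
    by (simp add: bij_betw_same_card)
  also have "\<dots> = (\<Sum>J\<in>?Js. \<Sum>a\<in>{w..n}. card (Y a J))"
    using finJs finY by (simp add: card_SigmaI)
  finally have c: "card (window_rows (distinct_msets n) w j) = (\<Sum>J\<in>?Js. \<Sum>a\<in>{w..n}. card (Y a J))" .
  have "real (card (Y a J)) / real (dcount {} n) = count_ratio (dcount (?W a)) n (\<Sum>i\<in>insert 0 J. a - i)"
    if "J \<in> ?Js" "a \<in> {w..n}" for a J
  proof -
    have J: "J \<subseteq> {1..<w}" and a: "w \<le> a" using that by auto
    have sub: "insert 0 J \<subseteq> {..<w}" using J w by auto
    have finJ: "finite J" using J finite_subset by blast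
    have inj: "inj_on (\<lambda>i. a - i) (insert 0 J)" using a by (intro inj_on_minus_nat order_trans[OF sub]) auto
    have "?T a J \<union> (?W a - ?T a J) = ?W a" using sub by blast
    moreover have "0 \<notin> ?T a J" using sub a by auto
    moreover have "\<Sum>(?T a J) = (\<Sum>i\<in>insert 0 J. a - i)" by (simp only: sum.reindex[OF inj] o_def)
    ultimately have "card (Y a J) = (if (\<Sum>i\<in>insert 0 J. a - i) \<le> n then dcount (?W a) (n - (\<Sum>i\<in>insert 0 J. a - i)) else 0)"
      using card_sets_fixed_part[of "?T a J" "?W a - ?T a J" n] finJ unfolding Y_def by (simp only: finite_imageI finite_insert Diff_disjoint simp_thms)
    then show ?thesis by (simp add: count_ratio_def)
  qed
  then show ?thesis unfolding c by (simp add: sum_divide_distrib)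
qed

text \<open>The only odd values in the window strictly below \<open>a\<close> are
  \<open>a - 2 * i\<close> with \<open>0 < i\<close> and \<open>2 * i < w\<close>.\<close>

lemma size_odd_window:
  fixes a w W :: nat
  assumes M: "set_mset M \<subseteq> {k. odd k}" and a: "odd a" "w \<le> a" and W: "W = (w + 1) div 2"
  shows "size {#x \<in># M. a - w < x \<and> x < a#} = (\<Sum>i\<in>{1..<W}. count M (a - 2 * i))"
proof -
  let ?B = "(\<lambda>i. a - 2 * i) ` {1..<W}"
  let ?F = "{#x \<in># M. a - w < x \<and> x < a#}"
  have inj: "inj_on (\<lambda>i. a - 2 * i) {1..<W}" using a W by (auto simp: inj_on_def)
  have "size ?F = (\<Sum>x\<in>set_mset ?F. count ?F x)" by (simp add: size_multiset_overloaded_eq)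
  also have "\<dots> = (\<Sum>x\<in>?B. count M x)"
  proof (rule sum.mono_neutral_cong_left)
    show "set_mset ?F \<subseteq> ?B"
    proof
      fix x assume "x \<in># ?F"
      then have x: "odd x" "a - w < x" "x < a" using M by auto
      then have "even (a - x)" using a by simp
      then obtain i where i: "a - x = 2 * i" by (rule evenE)
      then have "x = a - 2 * i" "i \<in> {1..<W}" using x a W by auto
      then show "x \<in> ?B" by blast
    qed
    show "\<forall>x\<in>?B - set_mset ?F. count M x = 0"
      using a W by (auto simp: count_eq_zero_iff)
  qed auto
  also have "\<dots> = (\<Sum>i\<in>{1..<W}. count M (a - 2 * i))" by (simp only: sum.reindex[OF inj] o_def)
  finally show ?thesis .
qed

lemma sum_mset_sum: "\<Sum>\<^sub># (\<Sum>i\<in>A. f i) = (\<Sum>i\<in>A. \<Sum>\<^sub># (f i))"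
  by (induction A rule: infinite_finite_induct) auto

text \<open>A row corresponds to \<open>(l, a, M)\<close>, where \<open>l\<close> starts with the
  number \<open>r\<close> of later copies and continues with the multiplicities of
  \<open>a - 2\<close>, \<open>a - 4\<close> and so on. Its entries add up to the leg length
  \<open>j\<close>.\<close>

lemma card_odd_window_rows:
  assumes w: "w > 0" and W: "W = (w + 1) div 2"
  shows "real (card (window_rows (odd_msets n) w j)) / real (dcount {} n) =
    (\<Sum>l\<in>{l. length l = W \<and> sum_list l = j}. \<Sum>a\<in>{a\<in>{w..n}. odd a}.
       count_ratio (mcount ({k. odd k} - (\<lambda>i. a - 2 * i) ` {1..<W})) n (a + (\<Sum>i<W. l ! i * (a - 2 * i))))"
proof -
  let ?Ls = "{l. length l = W \<and> sum_list l = j}"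
  let ?A = "{a\<in>{w..n}. odd a}"
  let ?Y = "\<lambda>a l. {M. set_mset M \<subseteq> {k. odd k} \<and> \<Sum>\<^sub># M = n \<and> l ! 0 < count M a \<and> (\<forall>i\<in>{1..<W}. count M (a - 2 * i) = l ! i)}"
  have W0: "W > 0" using w W by simp
  have finO: "finite (odd_msets n)" by (intro finite_multisets_sum) auto
  have finY: "finite (?Y a l)" for a l by (rule finite_subset[OF _ finO]) auto
  have finLs: "finite ?Ls"
  proof (rule finite_subset[OF _ finite_lists_length_eq[of "{..j}" W]])
    show "?Ls \<subseteq> {xs. set xs \<subseteq> {..j} \<and> length xs = W}" using member_le_sum_list by auto
  qed simp
  have suml: "sum_list l = l ! 0 + (\<Sum>i\<in>{1..<W}. l ! i)" if "length l = W" for l :: "nat list"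
  proof -
    have "sum_list l = (\<Sum>i\<in>{0..<W}. l ! i)" by (simp add: sum_list_sum_nth that)
    also have "\<dots> = l ! 0 + (\<Sum>i\<in>{1..<W}. l ! i)" using W0 by (simp add: sum.atLeast_Suc_lessThan)
    finally show ?thesis .
  qed
  let ?g = "\<lambda>(M, a, r). (map (\<lambda>i. if i = 0 then r else count M (a - 2 * i)) [0..<W], a, M)"
  let ?f = "\<lambda>(l, a, M). (M, a, l ! 0)"
  let ?D = "SIGMA l:?Ls. SIGMA a:?A. ?Y a l"
  have "bij_betw ?f ?D (window_rows (odd_msets n) w j)"
  proof (rule bij_betwI[where g = "?g"])
    show "?f \<in> ?D \<rightarrow> window_rows (odd_msets n) w j"
    proof (rule funcsetI)
      fix y assume "y \<in> ?D"
      then obtain l a M where y: "y = (l, a, M)" and l: "length l = W" "sum_list l = j"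
        and a: "w \<le> a" "odd a" and M: "set_mset M \<subseteq> {k. odd k}" "\<Sum>\<^sub># M = n" "l ! 0 < count M a"
          "\<forall>i\<in>{1..<W}. count M (a - 2 * i) = l ! i" by auto
      have "l ! 0 + size {#x \<in># M. a - w < x \<and> x < a#} = j"
        unfolding size_odd_window[OF M(1) a(2,1) W] using suml[OF l(1)] l M(4) by simp
      then show "?f y \<in> window_rows (odd_msets n) w j"
        using M a by (simp add: y window_rows_def)
    qed
    show "?g \<in> window_rows (odd_msets n) w j \<rightarrow> ?D"
    proof (rule funcsetI)
      fix y assume "y \<in> window_rows (odd_msets n) w j"
      then obtain M a r where y: "y = (M, a, r)" and M: "set_mset M \<subseteq> {k. odd k}" "\<Sum>\<^sub># M = n"
        and r: "r < count M a" and a: "w \<le> a" and sz: "r + size {#x \<in># M. a - w < x \<and> x < a#} = j"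
        by (auto simp: window_rows_def)
      have "a \<in># M" using r by (metis count_eq_zero_iff not_less_zero)
      then have a': "odd a" "a \<le> n" using M elem_le_sum_mset[of a M] by auto
      define l where "l = map (\<lambda>i. if i = 0 then r else count M (a - 2 * i)) [0..<W]"
      have l: "length l = W" "l ! 0 = r" "\<forall>i\<in>{1..<W}. count M (a - 2 * i) = l ! i"
        using W0 by (auto simp: l_def)
      have "sum_list l = j"
        using suml[OF l(1)] l sz size_odd_window[OF M(1) a'(1) a W] by simp
      then show "?g y \<in> ?D"
        using l a a' M r by (simp add: y l_def[symmetric])
    qed
  next
    fix y assume "y \<in> ?D"
    then obtain l a M where y: "y = (l, a, M)" and l: "length l = W" 
      "\<forall>i\<in>{1..<W}. count M (a - 2 * i) = l ! i" by auto
    have "map (\<lambda>i. if i = 0 then l ! 0 else count M (a - 2 * i)) [0..<W] = l"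
      by (rule nth_equalityI) (use l in auto)
    then show "?g (?f y) = y"
      by (simp add: y)
  next
    fix y assume "y \<in> window_rows (odd_msets n) w j"
    then show "?f (?g y) = y"
      using W0 by (cases y) simp
  qed
  then have "card (window_rows (odd_msets n) w j) = card ?D"
    by (simp add: bij_betw_same_card)
  also have "\<dots> = (\<Sum>l\<in>?Ls. \<Sum>a\<in>?A. card (?Y a l))"
    using finLs finY by (subst card_SigmaI) (auto simp: card_SigmaI)
  finally have c: "card (window_rows (odd_msets n) w j) = (\<Sum>l\<in>?Ls. \<Sum>a\<in>?A. card (?Y a l))" .
  have "real (card (?Y a l)) / real (dcount {} n) = count_ratio (mcount ({k. odd k} - (\<lambda>i. a - 2 * i) ` {1..<W})) n (a + (\<Sum>i<W. l ! i * (a - 2 * i)))"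
    if "l \<in> ?Ls" "a \<in> ?A" for a l
  proof -
    have a: "w \<le> a" "odd a" using that by auto
    let ?B = "(\<lambda>i. a - 2 * i) ` {1..<W}"
    \<comment> \<open>\<open>Suc\<close>, because the row itself counts besides its
      \<open>l ! 0\<close> later copies. Since \<open>a\<close> is not in \<open>?B\<close>, this
      number of copies of \<open>a\<close> is only a lower bound, while the other multiplicities are
      exact.\<close>
    define K where "K = replicate_mset (Suc (l ! 0)) a + (\<Sum>i\<in>{1..<W}. replicate_mset (l ! i) (a - 2 * i))"
    have cK: "count K x = (if x = a then Suc (l ! 0) else 0) + (\<Sum>i\<in>{1..<W}. if x = a - 2 * i then l ! i else 0)" for x
      by (auto simp: K_def count_sum intro!: sum.cong)
    have cKa: "count K a = Suc (l ! 0)" using a W by (auto simp: cK intro!: sum.neutral)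
    have cKi: "count K (a - 2 * i) = l ! i" if i: "i \<in> {1..<W}" for i
    proof -
      have "(\<Sum>i'\<in>{1..<W}. if a - 2 * i = a - 2 * i' then l ! i' else 0) = (\<Sum>i'\<in>{1..<W}. if i = i' then l ! i' else 0)"
        using i a W by (intro sum.cong refl) auto
      also have "\<dots> = l ! i" using i by (simp add: sum.delta')
      finally show ?thesis using i a W by (auto simp: cK)
    qed
    have cK0: "count K x = 0" if "x \<noteq> a" "x \<notin> ?B" for x
      using that by (auto simp: cK intro!: sum.neutral)
    have Kodd: "set_mset K \<subseteq> {k. odd k}"
    proof
      fix x assume "x \<in># K"
      then have "x = a \<or> x \<in> ?B" using cK0[of x] by (auto simp: count_eq_zero_iff)
      then show "x \<in> {k. odd k}" using a W by auto
    qed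
    have sumK: "\<Sum>\<^sub># K = a + (\<Sum>i<W. l ! i * (a - 2 * i))"
    proof -
      have "\<Sum>\<^sub># (\<Sum>i\<in>{1..<W}. replicate_mset (l ! i) (a - 2 * i)) = (\<Sum>i\<in>{1..<W}. l ! i * (a - 2 * i))"
        by (simp add: sum_mset_sum sum_mset_replicate_mset)
      moreover have "(\<Sum>i<W. l ! i * (a - 2 * i)) = l ! 0 * a + (\<Sum>i\<in>{1..<W}. l ! i * (a - 2 * i))"
        using W0 by (simp add: lessThan_atLeast0 sum.atLeast_Suc_lessThan)
      ultimately show ?thesis by (simp add: K_def sum_mset_replicate_mset)
    qed
    have "?Y a l = {M. set_mset M \<subseteq> {k. odd k} \<and> \<Sum>\<^sub># M = n \<and> K \<subseteq># M \<and> (\<forall>b\<in>?B. count M b = count K b)}"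
    proof -
      have "l ! 0 < count M a \<and> (\<forall>i\<in>{1..<W}. count M (a - 2 * i) = l ! i) \<longleftrightarrow> K \<subseteq># M \<and> (\<forall>b\<in>?B. count M b = count K b)" for M
      proof (intro iffI conjI)
        assume M: "l ! 0 < count M a \<and> (\<forall>i\<in>{1..<W}. count M (a - 2 * i) = l ! i)"
        show B: "\<forall>b\<in>?B. count M b = count K b" using M cKi by auto
        have "count K x \<le> count M x" for x
          using M B cKa cK0[of x] by (cases "x = a"; cases "x \<in> ?B") auto
        then show "K \<subseteq># M" by (simp add: subseteq_mset_def)
      next
        assume M: "K \<subseteq># M \<and> (\<forall>b\<in>?B. count M b = count K b)"
        then have "count K a \<le> count M a" by (simp add: subseteq_mset_def)
        then show "l ! 0 < count M a" using cKa by simp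
        show "\<forall>i\<in>{1..<W}. count M (a - 2 * i) = l ! i" using M cKi by auto
      qed
      then show ?thesis by blast
    qed
    then have "card (?Y a l) = (if \<Sum>\<^sub># K \<le> n then mcount ({k. odd k} - ?B) (n - \<Sum>\<^sub># K) else 0)"
      using card_multisets_fixed_part[OF Kodd, of n ?B] by simp
    then show ?thesis by (simp add: count_ratio_def sumK)
  qed
  then show ?thesis unfolding c by (simp add: sum_divide_distrib)
qed

text \<open>The copies of \<open>a\<close> are counted one by one: there are at least
  \<open>k\<close> of them iff \<open>k\<close> copies can be removed, leaving an arbitrary odd
  partition of \<open>n - k * a\<close>.\<close>

lemma card_odd_rows:
  "real (card {(M, a, r). M \<in> odd_msets n \<and> r < count M a}) / real (dcount {} n) =
    (\<Sum>a\<in>{a\<in>{1..n}. odd a}. \<Sum>k=1..n. count_ratio (dcount {}) n (k * a))"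
proof -
  let ?Y = "\<lambda>a k. {M. set_mset M \<subseteq> {k. odd k} \<and> \<Sum>\<^sub># M = n \<and> k \<le> count M a}"
  let ?A = "{a\<in>{1..n}. odd a}"
  have finO: "finite (odd_msets n)" by (intro finite_multisets_sum) auto
  have finY: "finite (?Y a k)" for a k by (rule finite_subset[OF _ finO]) auto
  have "bij_betw (\<lambda>(a, k, M). (M, a, k - 1)) (SIGMA a:?A. SIGMA k:{1..n}. ?Y a k) {(M, a, r). M \<in> odd_msets n \<and> r < count M a}"
  proof (rule bij_betwI[where g = "\<lambda>(M, a, r). (a, Suc r, M)"])
    show "(\<lambda>(a, k, M). (M, a, k - 1)) \<in> (SIGMA a:?A. SIGMA k:{1..n}. ?Y a k) \<rightarrow> {(M, a, r). M \<in> odd_msets n \<and> r < count M a}"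
      by auto
    show "(\<lambda>(M, a, r). (a, Suc r, M)) \<in> {(M, a, r). M \<in> odd_msets n \<and> r < count M a} \<rightarrow> (SIGMA a:?A. SIGMA k:{1..n}. ?Y a k)"
    proof (rule funcsetI)
      fix y assume "y \<in> {(M, a, r). M \<in> odd_msets n \<and> r < count M a}"
      then obtain M a r where y: "y = (M, a, r)" and M: "set_mset M \<subseteq> {k. odd k}" "\<Sum>\<^sub># M = n" and r: "r < count M a" by auto
      have "a \<in># M" using r by (metis count_eq_zero_iff not_less_zero)
      then have a: "odd a" "a \<le> n" using M elem_le_sum_mset[of a M] by auto
      have "count M a \<le> n" using count_le_sum_mset[of M a] M by auto
      then show "(\<lambda>(M, a, r). (a, Suc r, M)) y \<in> (SIGMA a:?A. SIGMA k:{1..n}. ?Y a k)"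
        using a M r odd_pos[OF a(1)] by (simp add: y)
    qed
  qed auto
  then have "card {(M, a, r). M \<in> odd_msets n \<and> r < count M a} = card (SIGMA a:?A. SIGMA k:{1..n}. ?Y a k)"
    by (simp add: bij_betw_same_card)
  also have "\<dots> = (\<Sum>a\<in>?A. \<Sum>k=1..n. card (?Y a k))"
    using finY by (subst card_SigmaI) (auto simp: card_SigmaI)
  finally have c: "card {(M, a, r). M \<in> odd_msets n \<and> r < count M a} = (\<Sum>a\<in>?A. \<Sum>k=1..n. card (?Y a k))" .
  have "real (card (?Y a k)) / real (dcount {} n) = count_ratio (dcount {}) n (k * a)" if "a \<in> ?A" for a k
  proof -
    have K: "set_mset (replicate_mset k a) \<subseteq> {k. odd k}" using that by auto
    have "card (?Y a k) = (if k * a \<le> n then mcount {k. odd k} (n - k * a) else 0)"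
      using card_multisets_fixed_part[OF K, of n "{}"]
      by (simp add: count_le_replicate_mset_subset_eq sum_mset_replicate_mset)
    then show ?thesis by (simp add: count_ratio_def euler_odd_distinct)
  qed
  then show ?thesis unfolding c by (simp add: sum_divide_distrib)
qed

section \<open>Limits of the hook probabilities\<close>

lemma sorted_partitions: "p \<in> partitions n \<Longrightarrow> sorted_wrt (\<ge>) p"
  by (simp add: partitions_def)

lemma hook_prob_eq:
  assumes P: "P n \<subseteq> partitions n" and pos: "card (diagram_rows (P n)) > 0"
  shows "hook_prob P h n = (\<Sum>j<h. real (card (window_rows (mset ` P n) (h - j) j))) / real (card (diagram_rows (P n)))"
proof -
  have "diagram_rows (P n) \<noteq> {}" "finite (diagram_rows (P n))" using pos card_gt_0_iff by blast+
  then have "hook_prob P h n = real (card (diagram_rows (P n) \<inter> {(p, i). row_has_hook h p i})) / real (card (diagram_rows (P n)))"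
    unfolding hook_prob_def by (rule measure_pmf_of_set)
  also have "card (diagram_rows (P n) \<inter> {(p, i). row_has_hook h p i}) = (\<Sum>j<h. card (window_rows (mset ` P n) (h - j) j))"
  proof (rule card_hook_rows)
    show "sorted_wrt (\<ge>) p" if "p \<in> P n" for p using P that sorted_partitions by blast
    fix M assume "M \<in> mset ` P n"
    then have "M \<in> mset ` partitions n" using P by blast
    then show "0 \<notin># M \<and> \<Sum>\<^sub># M = n" by (simp add: mset_partitions)
  qed
  finally show ?thesis by simp
qed

text \<open>The limit for a given \<open>J\<close> depends on its cardinality only, and there are
  \<open>(w - 1) choose j\<close> choices of \<open>J\<close>.\<close>

lemma distinct_window_rows_limit:
  assumes "w > 0"
  shows "(\<lambda>n. saddle n * (real (card (window_rows (distinct_msets n) w j)) / real (dcount {} n)))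
     \<longlonglongrightarrow> real ((w - 1) choose j) * I_B (j + 1) w"
proof -
  let ?Js = "{J. J \<subseteq> {1..<w} \<and> card J = j}"
  have "(\<lambda>n. \<Sum>J\<in>?Js. saddle n * (\<Sum>a\<in>{w..n}. count_ratio (dcount ((\<lambda>i. a - i) ` {..<w})) n (\<Sum>i\<in>insert 0 J. a - i)))
     \<longlonglongrightarrow> (\<Sum>J\<in>?Js. I_B (j + 1) w)"
  proof (rule tendsto_sum)
    fix J assume J: "J \<in> ?Js"
    then have "finite J" "0 \<notin> J" "insert 0 J \<subseteq> {..<w}" using assms finite_subset[of J "{1..<w}"] by auto
    moreover from this J have "card (insert 0 J) = j + 1" by simp
    ultimately show "(\<lambda>n. saddle n * (\<Sum>a\<in>{w..n}. count_ratio (dcount ((\<lambda>i. a - i) ` {..<w})) n (\<Sum>i\<in>insert 0 J. a - i)))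
     \<longlonglongrightarrow> I_B (j + 1) w"
      using distinct_window_limit(2)[of "insert 0 J" w] by simp
  qed
  moreover have "card ?Js = (w - 1) choose j" using n_subsets[of "{1..<w}" j] by simp
  ultimately show ?thesis
    unfolding card_distinct_window_rows[OF assms] by (simp add: sum_distrib_left)
qed

text \<open>The limit for a given \<open>l\<close> depends on its sum only; stars and bars count the
  lists of length \<open>W\<close> with sum \<open>j\<close>.\<close>

lemma odd_window_rows_limit:
  assumes "w > 0" and W: "W = (w + 1) div 2"
  shows "(\<lambda>n. saddle n * (real (card (window_rows (odd_msets n) w j)) / real (dcount {} n)))
     \<longlonglongrightarrow> real ((j + W - 1) choose j) * I_A (W - 1) (2 * (j + 1))"
proof -
  let ?Ls = "{l. length l = W \<and> sum_list l = j}"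
  let ?S = "\<lambda>l n. \<Sum>a\<in>{a\<in>{w..n}. odd a}.
       count_ratio (mcount ({k. odd k} - (\<lambda>i. a - 2 * i) ` {1..<W})) n (a + (\<Sum>i<W. l ! i * (a - 2 * i)))"
  have "(\<lambda>n. \<Sum>l\<in>?Ls. saddle n * ?S l n) \<longlonglongrightarrow> (\<Sum>l\<in>?Ls. I_A (W - 1) (2 * (j + 1)))"
  proof (rule tendsto_sum)
    fix l assume "l \<in> ?Ls"
    then show "(\<lambda>n. saddle n * ?S l n) \<longlonglongrightarrow> I_A (W - 1) (2 * (j + 1))"
      using odd_window_limit(2)[of W w l] assms by auto
  qed
  then show ?thesis
    unfolding card_odd_window_rows[OF assms] by (simp add: sum_distrib_left card_length_sum_list)
qed

lemma nat_ceiling_half: "nat \<lceil>real h / 2\<rceil> = (h + 1) div 2"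
  by linarith

lemma nat_floor_half: "nat \<lfloor>real h / 2\<rfloor> = h div 2"
  by linarith

text \<open>From \<open>j = (h + 1) div 2\<close> on, the \<open>h - j - 1\<close> values available
  in the window are fewer than the \<open>j\<close> distinct parts it would have to contain.\<close>

lemma beta_eq: "(\<Sum>j<h. real ((h - j - 1) choose j) * I_B (j + 1) (h - j)) = beta h"
  unfolding beta_def nat_ceiling_half
proof (rule sum.mono_neutral_right)
  show "\<forall>j\<in>{..<h} - {..<(h + 1) div 2}. real ((h - j - 1) choose j) * I_B (j + 1) (h - j) = 0"
  proof
    fix j assume "j \<in> {..<h} - {..<(h + 1) div 2}"
    then have "h - j - 1 < j" by auto
    then show "real ((h - j - 1) choose j) * I_B (j + 1) (h - j) = 0" by (simp add: binomial_eq_0)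
  qed
qed auto

text \<open>The two sums in \<open>alpha\<close> are the terms with odd and even
  \<open>h - j\<close>. With \<open>i = W - 1\<close>, one has \<open>h - j = 2 * i + 1\<close> or
  \<open>h - j = 2 * i + 2\<close>, so \<open>2 * (j + 1)\<close> is \<open>2 * h - 4 * i\<close> or
  \<open>2 * h - 4 * i - 2\<close>; the binomial coefficients agree by symmetry.\<close>

lemma alpha_eq:
  "(\<Sum>j<h. real ((j + (h - j + 1) div 2 - 1) choose j) * I_A ((h - j + 1) div 2 - 1) (2 * (j + 1))) = alpha h"
proof -
  let ?f = "\<lambda>j. real ((j + (h - j + 1) div 2 - 1) choose j) * I_A ((h - j + 1) div 2 - 1) (2 * (j + 1))"
  let ?O = "{j\<in>{..<h}. odd (h - j)}" and ?E = "{j\<in>{..<h}. even (h - j)}"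
  have "(\<Sum>j<h. ?f j) = (\<Sum>j\<in>?O \<union> ?E. ?f j)" by (rule sum.cong) auto
  also have "\<dots> = (\<Sum>j\<in>?O. ?f j) + (\<Sum>j\<in>?E. ?f j)" by (rule sum.union_disjoint) auto
  also have "(\<Sum>j\<in>?O. ?f j) = (\<Sum>i<(h + 1) div 2. real ((h - i - 1) choose i) * I_A i (2 * h - 4 * i))"
  proof (rule sum.reindex_bij_witness[of _ "\<lambda>i. h - 2 * i - 1" "\<lambda>j. (h - j - 1) div 2"])
    fix j assume j: "j \<in> ?O"
    then have "odd (h - j)" by blast
    then obtain i where i: "h - j = 2 * i + 1" by (rule oddE)
    have e: "(h - j - 1) div 2 = i" "j = h - 2 * i - 1" "(h - j + 1) div 2 = i + 1" using i j by auto
    show "h - 2 * ((h - j - 1) div 2) - 1 = j" using i j by auto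
    show "(h - j - 1) div 2 \<in> {..<(h + 1) div 2}" using i j by auto
    have "(j + i) choose j = (j + i) choose i" using binomial_symmetric[of j "j + i"] by simp
    moreover have "h - i - 1 = j + i" "2 * h - 4 * i = 2 * (j + 1)" using i by auto
    ultimately show "real ((h - (h - j - 1) div 2 - 1) choose ((h - j - 1) div 2)) * I_A ((h - j - 1) div 2) (2 * h - 4 * ((h - j - 1) div 2)) = ?f j"
      unfolding e(1,3) by simp
  qed auto
  also have "(\<Sum>j\<in>?E. ?f j) = (\<Sum>i<h div 2. real ((h - i - 2) choose i) * I_A i (2 * h - 4 * i - 2))"
  proof (rule sum.reindex_bij_witness[of _ "\<lambda>i. h - 2 * i - 2" "\<lambda>j. (h - j - 2) div 2"])
    fix j assume j: "j \<in> ?E"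
    then have "even (h - j)" by blast
    then obtain k where k: "h - j = 2 * k" by (rule evenE)
    moreover have "k > 0" using j k by (cases k) auto
    ultimately obtain i where i: "h - j = 2 * i + 2" by (cases k) auto
    have e: "(h - j - 2) div 2 = i" "(h - j + 1) div 2 = i + 1" using i j by auto
    show "h - 2 * ((h - j - 2) div 2) - 2 = j" using i j by auto
    show "(h - j - 2) div 2 \<in> {..<h div 2}" using i j by auto
    have "(j + i) choose j = (j + i) choose i" using binomial_symmetric[of j "j + i"] by simp
    moreover have "h - i - 2 = j + i" "2 * h - 4 * i - 2 = 2 * (j + 1)" using i by auto
    ultimately show "real ((h - (h - j - 2) div 2 - 2) choose ((h - j - 2) div 2)) * I_A ((h - j - 2) div 2) (2 * h - 4 * ((h - j - 2) div 2) - 2) = ?f j"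
      unfolding e by simp
  qed auto
  finally show ?thesis unfolding alpha_def nat_ceiling_half nat_floor_half .
qed

lemma distinct_partitions_limit:
  "(\<lambda>n. hook_prob distinct_partitions h n) \<longlonglongrightarrow> beta h / ln 2"
proof -
  let ?X = "\<lambda>n. mset ` distinct_partitions n"
  define q where "q n = real (dcount {} n)" for n
  define T where "T n = real (card (diagram_rows (distinct_partitions n)))" for n
  define N where "N n = (\<Sum>j<h. real (card (window_rows (?X n) (h - j) j)))" for n
  have sub: "distinct_partitions n \<subseteq> partitions n" for n by (auto simp: distinct_partitions_def)
  have q: "q n > 0" for n using dcount_pos[of n] by (simp add: q_def)
  have N: "(\<lambda>n. saddle n * (N n / q n)) \<longlonglongrightarrow> beta h"
  proof -
    have "(\<lambda>n. \<Sum>j<h. saddle n * (real (card (window_rows (?X n) (h - j) j)) / q n))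
      \<longlonglongrightarrow> (\<Sum>j<h. real ((h - j - 1) choose j) * I_B (j + 1) (h - j))"
      unfolding mset_distinct_partitions q_def by (intro tendsto_sum distinct_window_rows_limit) auto
    then show ?thesis unfolding beta_eq by (simp add: N_def sum_distrib_left sum_divide_distrib)
  qed
  have T: "(\<lambda>n. saddle n * (T n / q n)) \<longlonglongrightarrow> ln 2"
  proof -
    \<comment> \<open>The count of all rows is the case \<open>w = 1\<close>, \<open>j = 0\<close>
      of the window count: a window of width 1 contains no smaller part, and a row of a distinct
      partition has no later copies. So the same limit lemma serves numerator and
      denominator.\<close>
    have "T n = real (card (window_rows (?X n) 1 0))" for n
    proof -
      have "{(M, a, r). M \<in> ?X n \<and> r < count M a} = window_rows (?X n) 1 0"
      proof (intro subset_antisym subsetI)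
        fix y assume "y \<in> {(M, a, r). M \<in> ?X n \<and> r < count M a}"
        then obtain S a r where y: "y = (mset_set S, a, r)" "mset_set S \<in> ?X n" "finite S" "0 \<notin> S" "r < count (mset_set S) a"
          unfolding mset_distinct_partitions by auto
        then have "a \<in> S" "r = 0" by (auto simp: count_mset_set' split: if_splits)
        moreover from this y have "a \<ge> 1" by (cases a) auto
        moreover have "(\<lambda>x. a - 1 < x \<and> x < a) = (\<lambda>_. False)" by auto
        then have "{#x \<in># mset_set S. a - 1 < x \<and> x < a#} = {#}" by (simp only: filter_mset_False)
        ultimately show "y \<in> window_rows (?X n) 1 0" using y by (auto simp: window_rows_def)
      qed (auto simp: window_rows_def)
      then show ?thesis
        using card_diagram_rows[of "distinct_partitions n"] sorted_partitions[OF subsetD[OF sub]]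
        by (simp add: T_def)
    qed
    then show ?thesis
      using distinct_window_rows_limit[of 1 0] unfolding mset_distinct_partitions q_def by (simp add: I_B_1_1[simplified])
  qed
  have "\<forall>\<^sub>F n in sequentially. saddle n * (T n / q n) > 0"
    by (rule order_tendstoD(1)[OF T]) simp
  then have "\<forall>\<^sub>F n in sequentially. (saddle n * (N n / q n)) / (saddle n * (T n / q n)) = hook_prob distinct_partitions h n"
    using saddle_pos_ev
  proof eventually_elim
    case (elim n)
    then have "T n \<noteq> 0" by auto
    then have "T n > 0" by (simp add: T_def)
    then have "hook_prob distinct_partitions h n = N n / T n"
      unfolding N_def T_def using hook_prob_eq[where P = distinct_partitions and n = n, OF sub] by simp
    then show ?case using elim q[of n] by simp
  qed
  moreover have "(\<lambda>n. (saddle n * (N n / q n)) / (saddle n * (T n / q n))) \<longlonglongrightarrow> beta h / ln 2"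
    by (rule tendsto_divide[OF N T]) simp
  ultimately show ?thesis by (rule Lim_transform_eventually[rotated])
qed

text \<open>The numerator grows like \<open>q n / saddle n\<close> and the number of rows is larger
  by the factor \<open>ln n / (4 * alpha h)\<close>; after multiplication by \<open>ln n\<close> the
  factors \<open>q n\<close> and \<open>saddle n\<close> cancel.\<close>

lemma odd_partitions_limit:
  "(\<lambda>n. hook_prob odd_partitions h n * ln (real n)) \<longlonglongrightarrow> 4 * alpha h"
proof -
  let ?X = "\<lambda>n. mset ` odd_partitions n"
  define q where "q n = real (dcount {} n)" for n
  define T where "T n = real (card (diagram_rows (odd_partitions n)))" for n
  define N where "N n = (\<Sum>j<h. real (card (window_rows (?X n) (h - j) j)))" for n
  have sub: "odd_partitions n \<subseteq> partitions n" for n by (auto simp: odd_partitions_def)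
  have q: "q n > 0" for n using dcount_pos[of n] by (simp add: q_def)
  have N: "(\<lambda>n. saddle n * (N n / q n)) \<longlonglongrightarrow> alpha h"
  proof -
    have "(\<lambda>n. \<Sum>j<h. saddle n * (real (card (window_rows (?X n) (h - j) j)) / q n))
      \<longlonglongrightarrow> (\<Sum>j<h. real ((j + (h - j + 1) div 2 - 1) choose j) * I_A ((h - j + 1) div 2 - 1) (2 * (j + 1)))"
      unfolding mset_odd_partitions q_def by (intro tendsto_sum odd_window_rows_limit) auto
    then show ?thesis unfolding alpha_eq by (simp add: N_def sum_distrib_left sum_divide_distrib)
  qed
  have T: "(\<lambda>n. saddle n * (T n / q n) / ln (real n)) \<longlonglongrightarrow> 1 / 4"
  proof -
    have "T n = real (card {(M, a, r). M \<in> odd_msets n \<and> r < count M a})" for n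
      unfolding T_def mset_odd_partitions[symmetric]
      using card_diagram_rows[of "odd_partitions n"] sorted_partitions[OF subsetD[OF sub]] by simp
    then show ?thesis using odd_rows_limit unfolding card_odd_rows[symmetric] q_def by simp
  qed
  have "\<forall>\<^sub>F n in sequentially. saddle n * (T n / q n) / ln (real n) > 0"
    by (rule order_tendstoD(1)[OF T]) simp
  then have "\<forall>\<^sub>F n in sequentially. (saddle n * (N n / q n)) / (saddle n * (T n / q n) / ln (real n)) = hook_prob odd_partitions h n * ln (real n)"
    using saddle_pos_ev eventually_ge_at_top[of 2]
  proof eventually_elim
    case (elim n)
    have ln: "ln (real n) > 0" using elim by simp
    have "T n \<noteq> 0" using elim by auto
    then have "T n > 0" by (simp add: T_def)
    then have "hook_prob odd_partitions h n = N n / T n"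
      unfolding N_def T_def using hook_prob_eq[where P = odd_partitions and n = n, OF sub] by simp
    then show ?case using elim q[of n] ln by simp
  qed
  moreover have "(\<lambda>n. (saddle n * (N n / q n)) / (saddle n * (T n / q n) / ln (real n))) \<longlonglongrightarrow> alpha h / (1 / 4)"
    by (rule tendsto_divide[OF N T]) simp
  ultimately have "(\<lambda>n. hook_prob odd_partitions h n * ln (real n)) \<longlonglongrightarrow> alpha h / (1 / 4)"
    by (rule Lim_transform_eventually[rotated])
  then show ?thesis by (simp add: mult.commute)
qed

theorem corollary6p2:
  fixes h :: nat
  assumes "h \<ge> 1"
  shows "(\<lambda>n. hook_prob odd_partitions h n) \<sim>[sequentially] (\<lambda>n. 4 * alpha h / ln (real n))
    \<and> (\<lambda>n. hook_prob distinct_partitions h n) \<sim>[sequentially] (\<lambda>n. beta h / ln 2)"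
proof
  have a: "alpha h > 0" by (rule alpha_pos[OF assms])
  have "(\<lambda>n. hook_prob odd_partitions h n * ln (real n) / (4 * alpha h)) \<longlonglongrightarrow> 4 * alpha h / (4 * alpha h)"
    by (intro tendsto_divide odd_partitions_limit tendsto_const) (use a in simp)
  then have "(\<lambda>n. hook_prob odd_partitions h n / (4 * alpha h / ln (real n))) \<longlonglongrightarrow> 1"
    using a by simp
  then show "(\<lambda>n. hook_prob odd_partitions h n) \<sim>[sequentially] (\<lambda>n. 4 * alpha h / ln (real n))"
    by (rule asymp_equivI')
next
  have b: "beta h > 0" by (rule beta_pos[OF assms])
  show "(\<lambda>n. hook_prob distinct_partitions h n) \<sim>[sequentially] (\<lambda>n. beta h / ln 2)"
  proof (rule asymp_equivI')
    have "(\<lambda>n. hook_prob distinct_partitions h n / (beta h / ln 2)) \<longlonglongrightarrow> (beta h / ln 2) / (beta h / ln 2)"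
      by (intro tendsto_divide distinct_partitions_limit tendsto_const) (use b in simp)
    then show "(\<lambda>n. hook_prob distinct_partitions h n / (beta h / ln 2)) \<longlonglongrightarrow> 1"
      using b by simp
  qed
qed

end
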